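(* Let $(V,\mu)$ be an infinite, connected, locally finite weighted graph satisfying the volume doubling condition (VD), the Poincaré inequality (PI) and condition $(P_0)$. Then $$g(x,y)\simeq\sum_{n=d(x,y)}^{\infty}\frac{n}{V(x,n)},$$ i.e. there is a constant $C\ge1$ such that for all $x,y\in V$, $C^{-1}\sum_{n=d(x,y)}^{\infty}\frac{n}{V(x,n)}\le g(x,y)\le C\sum_{n=d(x,y)}^{\infty}\frac{n}{V(x,n)}$ (values in $[0,\infty]$).
   Context: Weighted graph: $(V,E)$ is an infinite, connected, locally finite graph (loops allowed), and $\mu:V\times V\to[0,\infty)$, $\mu_{xy}=\mu_{yx}$, with $\mu_{xy}>0$ iff $x\sim y$. Vertex weight: $\mu(x)=\sum_{y\sim x}\mu_{xy}$; $\mu(A)=\sum_{x\in A}\mu(x)$ for $A\subset V$. $d$ is the graph distance, $B(x,r)=\{y\in V: d(x,y)\le r\}$, $V(x,r)=\mu(B(x,r))$. Random walk: $P(x,y)=\mu_{xy}/\mu(x)$, with $n$-step transition function $P_n(x,y)$, $P_0(x,y)=\mathbf 1_{\{x=y\}}$, and $p_n(x,y)=P_n(x,y)/\mu(y)$. Green function: $g(x,y)=\sum_{n\ge0}p_n(x,y)\in(0,\infty]$. (VD): there is a constant $C$ such that $V(x,2r)\le C\,V(x,r)$ for all $x\in V$ and all $r>0$. (PI): there is a constant $C$ such that for all $x_0\in V$, all $r>0$ and all $f:V\to\mathbb R$, $$\sum_{x\in B(x_0,r)}|f(x)-f_B|^2\mu(x)\le C\,r^2\sum_{x,y\in B(x_0,2r)}\mu_{xy}(f(y)-f(x))^2,$$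 where $f_B=\frac1{V(x_0,r)}\sum_{x\in B(x_0,r)}f(x)\mu(x)$. $(P_0)$: there is a constant $\alpha>0$ such that $\mu_{xy}/\mu(x)\ge\alpha$ whenever $x\sim y$. *)

theory Defs
  imports "HOL-Analysis.Analysis"
begin

text \<open>
  The vertex set is the whole type \<open>'a\<close>; the edge set is a symmetric relation \<open>E\<close>, where loops
  are pairs \<open>(x, x)\<close>.
\<close>

locale weighted_graph =
  fixes E :: "('a \<times> 'a) set" and \<mu> :: "'a \<Rightarrow> 'a \<Rightarrow> real"
  assumes infinite_vertices: "infinite (UNIV :: 'a set)"
    and sym_edges: "sym E"
    and connected: "(x, y) \<in> E\<^sup>*"
    and locally_finite: "finite {y. (x, y) \<in> E}"
    and weight_nonneg: "0 \<le> \<mu> x y"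
    and weight_sym: "\<mu> x y = \<mu> y x"
    and weight_pos_iff: "0 < \<mu> x y \<longleftrightarrow> (x, y) \<in> E"

definition graph_dist :: "('a \<times> 'a) set \<Rightarrow> 'a \<Rightarrow> 'a \<Rightarrow> nat" where
  "graph_dist E x y = (LEAST n. (x, y) \<in> E ^^ n)"

definition graph_ball :: "('a \<times> 'a) set \<Rightarrow> 'a \<Rightarrow> real \<Rightarrow> 'a set" where
  "graph_ball E x r = {y. real (graph_dist E x y) \<le> r}"

definition vertex_weight :: "('a \<times> 'a) set \<Rightarrow> ('a \<Rightarrow> 'a \<Rightarrow> real) \<Rightarrow> 'a \<Rightarrow> real" where
  "vertex_weight E \<mu> x = (\<Sum>y | (x, y) \<in> E. \<mu> x y)"

text \<open>
  The sums over balls below are finite sums: in a locally finite connected graph every ball is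
  finite.
\<close>

definition graph_volume :: "('a \<times> 'a) set \<Rightarrow> ('a \<Rightarrow> 'a \<Rightarrow> real) \<Rightarrow> 'a \<Rightarrow> real \<Rightarrow> real" where
  "graph_volume E \<mu> x r = (\<Sum>y\<in>graph_ball E x r. vertex_weight E \<mu> y)"

definition transition :: "('a \<times> 'a) set \<Rightarrow> ('a \<Rightarrow> 'a \<Rightarrow> real) \<Rightarrow> 'a \<Rightarrow> 'a \<Rightarrow> real" where
  "transition E \<mu> x y = \<mu> x y / vertex_weight E \<mu> x"

text \<open>
  In the recursion it suffices to sum over the neighbours \<open>z\<close> of \<open>x\<close>, since the one-step
  probability from \<open>x\<close> to \<open>z\<close> vanishes for all other \<open>z\<close>.
\<close>

primrec transition_n ::
  "('a \<times> 'a) set \<Rightarrow> ('a \<Rightarrow> 'a \<Rightarrow> real) \<Rightarrow> nat \<Rightarrow> 'a \<Rightarrow> 'a \<Rightarrow> real" where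
  "transition_n E \<mu> 0 x y = (if x = y then 1 else 0)"
| "transition_n E \<mu> (Suc n) x y =
     (\<Sum>z | (x, z) \<in> E. transition E \<mu> x z * transition_n E \<mu> n z y)"

definition heat_kernel ::
  "('a \<times> 'a) set \<Rightarrow> ('a \<Rightarrow> 'a \<Rightarrow> real) \<Rightarrow> nat \<Rightarrow> 'a \<Rightarrow> 'a \<Rightarrow> real" where
  "heat_kernel E \<mu> n x y = transition_n E \<mu> n x y / vertex_weight E \<mu> y"

definition green :: "('a \<times> 'a) set \<Rightarrow> ('a \<Rightarrow> 'a \<Rightarrow> real) \<Rightarrow> 'a \<Rightarrow> 'a \<Rightarrow> ennreal" where
  "green E \<mu> x y = (\<Sum>n. ennreal (heat_kernel E \<mu> n x y))"

definition volume_doubling :: "('a \<times> 'a) set \<Rightarrow> ('a \<Rightarrow> 'a \<Rightarrow> real) \<Rightarrow> bool" where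
  "volume_doubling E \<mu> \<longleftrightarrow>
     (\<exists>C. \<forall>x. \<forall>r>0. graph_volume E \<mu> x (2 * r) \<le> C * graph_volume E \<mu> x r)"

definition ball_average ::
  "('a \<times> 'a) set \<Rightarrow> ('a \<Rightarrow> 'a \<Rightarrow> real) \<Rightarrow> 'a \<Rightarrow> real \<Rightarrow> ('a \<Rightarrow> real) \<Rightarrow> real" where
  "ball_average E \<mu> x\<^sub>0 r f =
     1 / graph_volume E \<mu> x\<^sub>0 r * (\<Sum>x\<in>graph_ball E x\<^sub>0 r. f x * vertex_weight E \<mu> x)"

definition poincare_inequality :: "('a \<times> 'a) set \<Rightarrow> ('a \<Rightarrow> 'a \<Rightarrow> real) \<Rightarrow> bool" where
  "poincare_inequality E \<mu> \<longleftrightarrow>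
     (\<exists>C. \<forall>x\<^sub>0. \<forall>r>0. \<forall>f :: 'a \<Rightarrow> real.
        (\<Sum>x\<in>graph_ball E x\<^sub>0 r. \<bar>f x - ball_average E \<mu> x\<^sub>0 r f\<bar>\<^sup>2 * vertex_weight E \<mu> x)
        \<le> C * r\<^sup>2 * (\<Sum>x\<in>graph_ball E x\<^sub>0 (2 * r). \<Sum>y\<in>graph_ball E x\<^sub>0 (2 * r).
                     \<mu> x y * (f y - f x)\<^sup>2))"

definition condition_P0 :: "('a \<times> 'a) set \<Rightarrow> ('a \<Rightarrow> 'a \<Rightarrow> real) \<Rightarrow> bool" where
  "condition_P0 E \<mu> \<longleftrightarrow>
     (\<exists>\<alpha>>0. \<forall>x y. (x, y) \<in> E \<longrightarrow> \<mu> x y / vertex_weight E \<mu> x \<ge> \<alpha>)"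

end

theory Submission
  imports Defs
begin

text \<open>
  Instead of heat kernel bounds, the proof uses only the elliptic De Giorgi method. Volume doubling and the
  Poincare inequality give a Faber--Krahn inequality, hence a mean value inequality for
  subharmonic functions and, applied to the negative part of the logarithm of a positive
  superharmonic function, a growth lemma: such a function is bounded below on a ball as soon as
  it is at least \<open>1\<close> on a fixed proportion of that ball. The mean exit time of a ball of
  radius \<open>r\<close> from its centre is therefore comparable to \<open>r\<^sup>2\<close>; it equals the total mass of the
  Green function of the ball. The difference between the Green functions of two
  concentric balls of comparable radii is thus a superharmonic function of mass of order
  \<open>r\<^sup>2\<close>, so it is of order \<open>r\<^sup>2 / V(y, r)\<close> by the mean value inequality and the growth lemma.
  Telescoping over geometric scales gives the theorem.

  Balls are open balls of natural radius \<open>r \<ge> 1\<close>, that is, closed balls of radius \<open>r - 1/2\<close>; for these,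
  doubling and the Poincare inequality hold without lower-order corrections.
\<close>

section \<open>Balls, energy and cutoff functions\<close>

text \<open>The walk may be recurrent, and then both sides are infinite. All estimates therefore
  concern the Green functions \<open>green_ball y r\<close> of the walk killed outside a ball,
  finite by an energy estimate, and finite partial sums of the series; suprema are taken only at the
  end.

  The lower bound has to face the pole. The growth lemma asks for a set of fixed proportion on which
  the function is large, and this is extracted from a first and a second moment; a single
  \<open>green_ball\<close> can be so singular at \<open>y\<close> that its second moment is not
  controlled at the scale of the ball. Subtracting the Green function of a smaller ball cancels the
  pole, and the difference is bounded by the mean value inequality. Little mass is lost: the Green
  function of a ball of radius \<open>s\<close> has mass at most a constant times
  \<open>s\<^sup>2\<close>, so a fixed large ratio of radii suffices.

  (P_0) serves at the smallest scale, where a heavy loop could hold the walk at one vertex.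
  Infinitude serves in the Dirichlet problem: near any ball there is a disjoint one of the same
  radius, on which the solution vanishes.\<close>

context weighted_graph
begin

abbreviation nb :: "'a \<Rightarrow> 'a set" where "nb x \<equiv> {y. (x, y) \<in> E}"
abbreviation d :: "'a \<Rightarrow> 'a \<Rightarrow> nat" where "d \<equiv> graph_dist E"
abbreviation m :: "'a \<Rightarrow> real" where "m \<equiv> vertex_weight E \<mu>"

definition oball :: "'a \<Rightarrow> nat \<Rightarrow> 'a set" where
  "oball x r = {y. d x y < r}"

definition mass :: "'a set \<Rightarrow> real" where
  "mass A = (\<Sum>x\<in>A. m x)"

abbreviation vol :: "'a \<Rightarrow> nat \<Rightarrow> real" where
  "vol x r \<equiv> mass (oball x r)"

text \<open>
  The sign makes \<open>lap\<close> a nonnegative operator: \<open>u\<close> is subharmonic at \<open>x\<close> iff \<open>lap u x \<le> 0\<close>.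
\<close>

definition lap :: "('a \<Rightarrow> real) \<Rightarrow> 'a \<Rightarrow> real" where
  "lap u x = (\<Sum>y\<in>nb x. \<mu> x y * (u x - u y))"

text \<open>Every edge between distinct points is counted in both directions, whence the factor 2
  between \<open>energy\<close> and the pairing of \<open>f\<close> with
  \<open>lap f\<close>.\<close>

definition energy :: "'a set \<Rightarrow> ('a \<Rightarrow> real) \<Rightarrow> real" where
  "energy D f = (\<Sum>x\<in>D. \<Sum>y\<in>D. \<mu> x y * (f x - f y)\<^sup>2)"

text \<open>Asking for the neighbours as well keeps every edge at a nonzero point of
  \<open>f\<close> inside \<open>D\<close>, so that sums over \<open>D\<close> alone can be
  integrated by parts without boundary terms.\<close>

definition supp_inside :: "'a set \<Rightarrow> ('a \<Rightarrow> real) \<Rightarrow> bool" where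
  "supp_inside D f \<longleftrightarrow> (\<forall>x. f x \<noteq> 0 \<longrightarrow> x \<in> D \<and> nb x \<subseteq> D)"

section \<open>Graph distance and finiteness of balls\<close>

lemma edge_sym: "(x, y) \<in> E \<longleftrightarrow> (y, x) \<in> E"
  using sym_edges by (auto simp: sym_def)

lemma weight_zero: "(x, y) \<notin> E \<Longrightarrow> \<mu> x y = 0"
  using weight_nonneg[of x y] weight_pos_iff[of x y] by linarith

lemma relpow_sym: "(x, y) \<in> E ^^ n \<Longrightarrow> (y, x) \<in> E ^^ n"
proof (induction n arbitrary: y)
  case 0
  then show ?case by simp
next
  case (Suc n)
  then obtain z where "(x, z) \<in> E ^^ n" "(z, y) \<in> E" by auto
  then have "(y, z) \<in> E" "(z, x) \<in> E ^^ n" using Suc.IH edge_sym by auto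
  then show ?case by (rule relpow_Suc_I2)
qed

lemma dist_relpow: "(x, y) \<in> E ^^ d x y"
proof -
  obtain n where "(x, y) \<in> E ^^ n" using connected[of x y] by (meson rtrancl_imp_relpow)
  then show ?thesis unfolding graph_dist_def by (rule LeastI)
qed

lemma dist_le: "(x, y) \<in> E ^^ n \<Longrightarrow> d x y \<le> n"
  unfolding graph_dist_def by (rule Least_le)

lemma dist_self [simp]: "d x x = 0"
  using dist_le[of x x 0] by simp

lemma dist_eq_0_iff [simp]: "d x y = 0 \<longleftrightarrow> x = y"
proof
  assume "d x y = 0"
  with dist_relpow[of x y] show "x = y" by simp
qed simp

lemma dist_sym: "d x y = d y x"
  using dist_le[OF relpow_sym[OF dist_relpow[of x y]]] dist_le[OF relpow_sym[OF dist_relpow[of y x]]]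
  by simp

lemma dist_triangle: "d x z \<le> d x y + d y z"
proof (rule dist_le)
  show "(x, z) \<in> E ^^ (d x y + d y z)"
    unfolding relpow_add using dist_relpow[of x y] dist_relpow[of y z] by (rule relcompI)
qed

lemma dist_edge: "(x, y) \<in> E \<Longrightarrow> d x y \<le> 1"
  by (rule dist_le) simp

lemma dist_edge_le: "(x, y) \<in> E \<Longrightarrow> d z y \<le> d z x + 1"
  using dist_triangle[of z y x] dist_edge[of x y] by linarith

lemma oball_iff [simp]: "y \<in> oball x r \<longleftrightarrow> d x y < r"
  by (simp add: oball_def)

lemma nb_oball: "x \<in> oball z r \<Longrightarrow> nb x \<subseteq> oball z (Suc r)"
proof
  fix y assume "x \<in> oball z r" "y \<in> nb x"
  then show "y \<in> oball z (Suc r)" using dist_edge_le[of x y z] by simp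
qed

lemma finite_oball [simp]: "finite (oball x r)"
proof (induction r)
  case 0
  then show ?case by (simp add: oball_def)
next
  case (Suc r)
  have "oball x (Suc r) \<subseteq> {x} \<union> (\<Union>z\<in>oball x r. nb z)"
  proof
    fix y assume y: "y \<in> oball x (Suc r)"
    show "y \<in> {x} \<union> (\<Union>z\<in>oball x r. nb z)"
    proof (cases "d x y")
      case 0
      then show ?thesis by simp
    next
      case (Suc k)
      with dist_relpow[of x y] obtain z where z: "(x, z) \<in> E ^^ k" "(z, y) \<in> E" by auto
      then have "d x z \<le> k" by (intro dist_le)
      with y z Suc show ?thesis by auto
    qed
  qed
  moreover have "finite ({x} \<union> (\<Union>z\<in>oball x r. nb z))"
    using Suc.IH locally_finite by auto
  ultimately show ?case by (rule finite_subset)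
qed

lemma ex_dist_ge: "\<exists>y. n \<le> d x y"
proof (rule ccontr)
  assume "\<nexists>y. n \<le> d x y"
  then have "UNIV \<subseteq> oball x n" by (auto simp: not_le)
  then have "finite (UNIV :: 'a set)" using finite_oball finite_subset by blast
  then show False using infinite_vertices by simp
qed

text \<open>A shortest path to a far vertex passes through every smaller distance. The case
  \<open>n = 1\<close> gives each vertex a neighbour other than itself; \<open>n = 2 * r\<close>
  will supply a region where Dirichlet solutions vanish.\<close>

lemma ex_dist_eq: "\<exists>y. d x y = n"
proof -
  obtain y where y: "n \<le> d x y" using ex_dist_ge by blast
  have "(x, y) \<in> E ^^ n O E ^^ (d x y - n)"
    using dist_relpow[of x y] y by (metis le_add_diff_inverse relpow_add)
  then obtain z where z: "(x, z) \<in> E ^^ n" "(z, y) \<in> E ^^ (d x y - n)" by auto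
  then have "d x z \<le> n" "d z y \<le> d x y - n" by (auto intro: dist_le)
  with dist_triangle[of x y z] y have "d x z = n" by linarith
  then show ?thesis by blast
qed

lemma oball_mono: "r \<le> s \<Longrightarrow> oball x r \<subseteq> oball x s"
  by auto

lemma oball_shift: "d x y + r \<le> s \<Longrightarrow> oball y r \<subseteq> oball x s"
proof
  fix z assume "d x y + r \<le> s" "z \<in> oball y r"
  then show "z \<in> oball x s" using dist_triangle[of x z y] by simp
qed

section \<open>Sums of weights, vertex masses and volumes\<close>

lemma sum_weight_eq:
  assumes "finite D" "nb x \<subseteq> D"
  shows "(\<Sum>y\<in>D. \<mu> x y * f y) = (\<Sum>y\<in>nb x. \<mu> x y * f y)"
  using assms by (intro sum.mono_neutral_right) (auto simp: weight_zero)

lemma sum_weight_le: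
  assumes "finite D"
  shows "(\<Sum>y\<in>D. \<mu> x y) \<le> m x"
proof -
  have "(\<Sum>y\<in>D. \<mu> x y) = (\<Sum>y\<in>D \<inter> nb x. \<mu> x y)"
    using assms by (intro sum.mono_neutral_right) (auto simp: weight_zero)
  also have "\<dots> \<le> (\<Sum>y\<in>nb x. \<mu> x y)"
    by (intro sum_mono2) (auto simp: locally_finite weight_nonneg)
  finally show ?thesis by (simp add: vertex_weight_def)
qed

lemma lap_eq:
  assumes "finite D" "nb x \<subseteq> D"
  shows "lap u x = (\<Sum>y\<in>D. \<mu> x y * (u x - u y))"
  unfolding lap_def using sum_weight_eq[OF assms, of "\<lambda>y. u x - u y"] by simp

lemma m_pos: "0 < m x"
proof -
  obtain y where "d x y = 1" using ex_dist_eq by blast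
  then have "(x, y) \<in> E" using dist_relpow[of x y] by simp
  then have "0 < \<mu> x y" using weight_pos_iff by blast
  also have "\<mu> x y = (\<Sum>y\<in>{y}. \<mu> x y)" by simp
  also have "\<dots> \<le> m x" by (rule sum_weight_le) simp
  finally show ?thesis .
qed

lemma m_nonneg [simp]: "0 \<le> m x"
  using m_pos[of x] by simp

lemma mass_nonneg [simp]: "0 \<le> mass A"
  by (simp add: mass_def sum_nonneg)

lemma mass_mono: "finite B \<Longrightarrow> A \<subseteq> B \<Longrightarrow> mass A \<le> mass B"
  unfolding mass_def by (rule sum_mono2) auto

lemma vol_mono: "r \<le> s \<Longrightarrow> vol x r \<le> vol x s"
  by (intro mass_mono oball_mono finite_oball)

lemma m_le_vol: "0 < r \<Longrightarrow> m x \<le> vol x r"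
  using mass_mono[of "oball x r" "{x}"] by (simp add: mass_def)

lemma vol_pos: "0 < r \<Longrightarrow> 0 < vol x r"
  using m_le_vol[of r x] m_pos[of x] by linarith

lemma oball_1: "oball x (Suc 0) = {x}"
  by auto

lemma vol_1: "vol x (Suc 0) = m x"
  by (simp add: oball_1 mass_def)

lemma energy_nonneg: "0 \<le> energy D f"
  unfolding energy_def by (intro sum_nonneg mult_nonneg_nonneg weight_nonneg) simp

section \<open>Summation by parts and the Caccioppoli identity\<close>

lemma sum_weight_sym: "(\<Sum>x\<in>D. \<Sum>y\<in>D. \<mu> x y * f x y) = (\<Sum>x\<in>D. \<Sum>y\<in>D. \<mu> x y * f y x)"
  by (subst sum.swap) (simp add: weight_sym)

text \<open>The double sum is averaged with its transpose. Only \<open>f\<close> needs support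
  inside \<open>D\<close>; \<open>u\<close> is arbitrary, as for the superharmonic functions tested
  below.\<close>

lemma green_identity:
  assumes "finite D" "supp_inside D f"
  shows "(\<Sum>x\<in>D. f x * lap u x) = (\<Sum>x\<in>D. \<Sum>y\<in>D. \<mu> x y * ((f x - f y) * (u x - u y))) / 2"
proof -
  have 1: "(\<Sum>x\<in>D. f x * lap u x) = (\<Sum>x\<in>D. \<Sum>y\<in>D. \<mu> x y * (f x * (u x - u y)))"
  proof (rule sum.cong[OF refl])
    fix x assume "x \<in> D"
    show "f x * lap u x = (\<Sum>y\<in>D. \<mu> x y * (f x * (u x - u y)))"
    proof (cases "f x = 0")
      case True
      then show ?thesis by simp
    next
      case False
      then have "nb x \<subseteq> D" using assms by (auto simp: supp_inside_def)
      from lap_eq[OF assms(1) this] show ?thesis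
        by (simp add: sum_distrib_left algebra_simps)
    qed
  qed
  have 2: "(\<Sum>x\<in>D. \<Sum>y\<in>D. \<mu> x y * (f x * (u x - u y))) = (\<Sum>x\<in>D. \<Sum>y\<in>D. \<mu> x y * (f y * (u y - u x)))"
    by (rule sum_weight_sym)
  have "(\<Sum>x\<in>D. \<Sum>y\<in>D. \<mu> x y * ((f x - f y) * (u x - u y))) =
    (\<Sum>x\<in>D. \<Sum>y\<in>D. \<mu> x y * (f x * (u x - u y))) + (\<Sum>x\<in>D. \<Sum>y\<in>D. \<mu> x y * (f y * (u y - u x)))"
    unfolding sum.distrib[symmetric] by (intro sum.cong refl) (simp add: algebra_simps)
  with 1 2 show ?thesis by simp
qed

lemma energy_eq_lap:
  assumes "finite D" "supp_inside D f"
  shows "energy D f = 2 * (\<Sum>x\<in>D. f x * lap f x)"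
  using green_identity[OF assms, of f] by (simp add: energy_def power2_eq_square)

lemma lap_selfadjoint:
  assumes "finite D" "supp_inside D f" "supp_inside D u"
  shows "(\<Sum>x\<in>D. f x * lap u x) = (\<Sum>x\<in>D. u x * lap f x)"
  using green_identity[OF assms(1,2), of u] green_identity[OF assms(1,3), of f]
  by (simp add: mult.commute)

text \<open>The pointwise identity behind it is exact: \<open>(a * P - b * Q)^2 = (a * P^2 - b *
  Q^2) * (a - b) + a * b * (P - Q)^2\<close>. It replaces the product rule; the cutoff error carries
  \<open>v x * v y\<close> where the continuum has \<open>v\<^sup>2\<close>.\<close>

lemma caccioppoli_identity:
  assumes D: "finite D" "supp_inside D \<phi>"
  shows "energy D (\<lambda>x. v x * \<phi> x) = 2 * (\<Sum>x\<in>D. v x * (\<phi> x)\<^sup>2 * lap v x)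
    + (\<Sum>x\<in>D. \<Sum>y\<in>D. \<mu> x y * (v x * v y * (\<phi> x - \<phi> y)\<^sup>2))"
proof -
  have "supp_inside D (\<lambda>x. v x * (\<phi> x)\<^sup>2)" using D(2) by (auto simp: supp_inside_def)
  note g = green_identity[OF D(1) this, of v]
  have "energy D (\<lambda>x. v x * \<phi> x) =
      (\<Sum>x\<in>D. \<Sum>y\<in>D. \<mu> x y * ((v x * (\<phi> x)\<^sup>2 - v y * (\<phi> y)\<^sup>2) * (v x - v y)))
    + (\<Sum>x\<in>D. \<Sum>y\<in>D. \<mu> x y * (v x * v y * (\<phi> x - \<phi> y)\<^sup>2))"
    unfolding energy_def sum.distrib[symmetric]
    by (intro sum.cong refl) (simp add: algebra_simps power2_eq_square)
  with g show ?thesis by simp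
qed

text \<open>Young's inequality splits \<open>v x * v y\<close>, and the edge weights at
  \<open>x\<close> sum to at most \<open>m x\<close>. Besides the Caccioppoli error it bounds, with
  \<open>v = 1\<close>, the energy of a cutoff by a volume.\<close>

lemma double_sum_sq_le:
  assumes D: "finite D" and c: "\<And>x y. x \<in> D \<Longrightarrow> y \<in> D \<Longrightarrow> (x, y) \<in> E \<Longrightarrow> c x y \<le> C" "0 \<le> C"
    "\<And>x y. 0 \<le> c x y" and v: "\<And>x. 0 \<le> v x"
  shows "(\<Sum>x\<in>D. \<Sum>y\<in>D. \<mu> x y * (v x * v y * c x y)) \<le> C * (\<Sum>x\<in>D. (v x)\<^sup>2 * m x)"
proof -
  have s: "(\<Sum>x\<in>D. \<Sum>y\<in>D. \<mu> x y * (v x)\<^sup>2) \<le> (\<Sum>x\<in>D. (v x)\<^sup>2 * m x)"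
  proof (rule sum_mono)
    fix x
    have "(\<Sum>y\<in>D. \<mu> x y * (v x)\<^sup>2) = (v x)\<^sup>2 * (\<Sum>y\<in>D. \<mu> x y)"
      by (simp add: sum_distrib_right mult.commute)
    also have "\<dots> \<le> (v x)\<^sup>2 * m x" by (intro mult_left_mono sum_weight_le D) simp
    finally show "(\<Sum>y\<in>D. \<mu> x y * (v x)\<^sup>2) \<le> (v x)\<^sup>2 * m x" .
  qed
  have "(\<Sum>x\<in>D. \<Sum>y\<in>D. \<mu> x y * (v x * v y * c x y)) \<le>
    (\<Sum>x\<in>D. \<Sum>y\<in>D. C/2 * (\<mu> x y * (v x)\<^sup>2) + C/2 * (\<mu> x y * (v y)\<^sup>2))"
  proof (intro sum_mono)
    fix x y assume xy: "x \<in> D" "y \<in> D"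
    show "\<mu> x y * (v x * v y * c x y) \<le> C/2 * (\<mu> x y * (v x)\<^sup>2) + C/2 * (\<mu> x y * (v y)\<^sup>2)"
    proof (cases "(x, y) \<in> E")
      case True
      have "v x * v y * c x y \<le> (v x * v y) * C"
        using c(1)[OF xy True] v by (intro mult_left_mono) auto
      also have "\<dots> \<le> (((v x)\<^sup>2 + (v y)\<^sup>2)/2) * C"
        using sum_squares_bound[of "v x" "v y"] c(2) by (intro mult_right_mono) auto
      finally have "\<mu> x y * (v x * v y * c x y) \<le> \<mu> x y * ((((v x)\<^sup>2 + (v y)\<^sup>2)/2) * C)"
        by (intro mult_left_mono weight_nonneg)
      then show ?thesis by (simp add: algebra_simps)
    qed (simp add: weight_zero)
  qed
  also have "\<dots> = C/2 * (\<Sum>x\<in>D. \<Sum>y\<in>D. \<mu> x y * (v x)\<^sup>2) + C/2 * (\<Sum>x\<in>D. \<Sum>y\<in>D. \<mu> x y * (v y)\<^sup>2)"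
    by (simp add: sum.distrib sum_distrib_left)
  also have "(\<Sum>x\<in>D. \<Sum>y\<in>D. \<mu> x y * (v y)\<^sup>2) = (\<Sum>x\<in>D. \<Sum>y\<in>D. \<mu> x y * (v x)\<^sup>2)"
    by (rule sum_weight_sym)
  also have "C/2 * (\<Sum>x\<in>D. \<Sum>y\<in>D. \<mu> x y * (v x)\<^sup>2) + C/2 * (\<Sum>x\<in>D. \<Sum>y\<in>D. \<mu> x y * (v x)\<^sup>2)
      = C * (\<Sum>x\<in>D. \<Sum>y\<in>D. \<mu> x y * (v x)\<^sup>2)" by simp
  also have "\<dots> \<le> C * (\<Sum>x\<in>D. (v x)\<^sup>2 * m x)" using s c(2) by (rule mult_left_mono)
  finally show ?thesis .
qed

section \<open>Lipschitz cutoff functions\<close>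

definition cutoff :: "'a \<Rightarrow> nat \<Rightarrow> nat \<Rightarrow> 'a \<Rightarrow> real" where
  "cutoff x a b z = max 0 (min 1 ((real b - real (d x z)) / (real b - real a)))"

lemma cutoff_range: "0 \<le> cutoff x a b z" "cutoff x a b z \<le> 1"
  by (auto simp: cutoff_def)

lemma cutoff_eq_1: "a < b \<Longrightarrow> d x z \<le> a \<Longrightarrow> cutoff x a b z = 1"
  by (auto simp: cutoff_def field_simps)

lemma cutoff_eq_0: "a < b \<Longrightarrow> b \<le> d x z \<Longrightarrow> cutoff x a b z = 0"
  by (auto simp: cutoff_def field_simps)

lemma cutoff_supp:
  assumes "a < b" "b < c"
  shows "supp_inside (oball x c) (cutoff x a b)"
  unfolding supp_inside_def
proof (intro allI impI)
  fix z assume "cutoff x a b z \<noteq> 0"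
  then have z: "d x z < b" using cutoff_eq_0[of a b x z] assms by force
  then have "nb z \<subseteq> oball x (Suc b)" by (intro nb_oball) simp
  also have "\<dots> \<subseteq> oball x c" using assms by (intro oball_mono) simp
  finally show "z \<in> oball x c \<and> nb z \<subseteq> oball x c" using z assms by simp
qed

lemma cutoff_lipschitz:
  assumes "a < b" "(z, w) \<in> E"
  shows "(cutoff x a b z - cutoff x a b w)\<^sup>2 \<le> 1 / (real b - real a)\<^sup>2"
proof -
  define k where "k = real b - real a"
  have k: "k > 0" using assms by (simp add: k_def)
  have 1: "d x w \<le> d x z + 1" using dist_edge_le assms(2) by blast
  have 2: "d x z \<le> d x w + 1" using dist_edge_le assms(2) edge_sym by blast
  have "\<bar>cutoff x a b z - cutoff x a b w\<bar> \<le> \<bar>(real b - real (d x z)) / k - (real b - real (d x w)) / k\<bar>"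
    unfolding cutoff_def k_def by (simp add: abs_if max_def min_def)
  also have "\<dots> = \<bar>real (d x w) - real (d x z)\<bar> / k"
    using k by (simp add: diff_divide_distrib[symmetric] abs_divide)
  also have "\<dots> \<le> 1 / k" using 1 2 k by (intro divide_right_mono) auto
  finally have "\<bar>cutoff x a b z - cutoff x a b w\<bar>\<^sup>2 \<le> (1/k)\<^sup>2"
    by (intro power_mono) auto
  then show ?thesis by (simp add: k_def power_divide)
qed

end

section \<open>Volume doubling and the Faber--Krahn inequality\<close>

text \<open>A doubling constant \<open>2 ^ p\<close> makes volume ratios polynomial of natural
  degree \<open>p\<close> in the ratio of radii. In \<open>poincare\<close> the constant
  \<open>a\<close> is left open: its later use controls whichever constant occurs.\<close>

locale vd_pi_graph = weighted_graph E \<mu> for E :: "('a \<times> 'a) set" and \<mu> +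
  fixes p :: nat and cP \<alpha> :: real
  assumes doubling: "0 < r \<Longrightarrow> vol x (2 * r) \<le> 2 ^ p * vol x r"
    and poincare: "0 < r \<Longrightarrow>
      \<exists>a. (\<Sum>y\<in>oball x r. (f y - a)\<^sup>2 * m y) \<le> cP * (real r)\<^sup>2 * energy (oball x (2 * r)) f"
    and cP_pos: "0 < cP"
    and \<alpha>_pos: "0 < \<alpha>"
    and ellipticity: "(x, y) \<in> E \<Longrightarrow> \<alpha> * m x \<le> \<mu> x y"
begin

section \<open>Comparison of volumes\<close>

lemma vol_doubling_pow: "0 < r \<Longrightarrow> vol x (2 ^ k * r) \<le> (2 ^ p) ^ k * vol x r"
proof (induction k)
  case (Suc k)
  have "vol x (2 ^ Suc k * r) \<le> 2 ^ p * vol x (2 ^ k * r)"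
    using doubling[of "2 ^ k * r" x] Suc.prems by (simp add: mult.assoc)
  also have "\<dots> \<le> 2 ^ p * ((2 ^ p) ^ k * vol x r)"
    using Suc by (intro mult_left_mono) auto
  finally show ?case by (simp add: mult.assoc)
qed simp

lemma vol_shift:
  assumes "0 < r" "d y x + R \<le> 2 ^ k * r"
  shows "vol x R \<le> (2 ^ p) ^ k * vol y r"
proof -
  have "vol x R \<le> vol y (2 ^ k * r)"
    using assms(2) by (intro mass_mono oball_shift finite_oball)
  also have "\<dots> \<le> (2 ^ p) ^ k * vol y r" by (rule vol_doubling_pow[OF assms(1)])
  finally show ?thesis .
qed

lemma ex_dyadic_scale:
  assumes "0 < b" "b \<le> (a::nat)"
  shows "\<exists>k. a \<le> 2 ^ k * b \<and> 2 ^ k * b < 2 * a"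
proof -
  define k where "k = (LEAST k. a \<le> 2 ^ k * b)"
  have "a \<le> 2 ^ a * b" using assms less_exp[of a] by (metis le_trans less_imp_le_nat mult_le_mono nat_mult_1_right One_nat_def Suc_leI)
  then have k: "a \<le> 2 ^ k * b" unfolding k_def by (rule LeastI)
  show ?thesis
  proof (cases k)
    case 0
    with k assms show ?thesis by (intro exI[of _ 0]) auto
  next
    case (Suc j)
    then have "\<not> a \<le> 2 ^ j * b" using not_less_Least[of j "\<lambda>k. a \<le> 2 ^ k * b"] k_def by auto
    with k Suc show ?thesis by (intro exI[of _ k]) auto
  qed
qed

text \<open>Iterated doubling as polynomial growth; the factor 2 is the loss in rounding
  \<open>a / b\<close> up to a power of 2.\<close>

lemma vol_poly:
  assumes "0 < b" "b \<le> a"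
  shows "vol x a \<le> (2 * real a / real b) ^ p * vol x b"
proof -
  obtain k where k: "a \<le> 2 ^ k * b" "2 ^ k * b < 2 * a" using ex_dyadic_scale[OF assms] by blast
  have "vol x a \<le> vol x (2 ^ k * b)" using k by (intro vol_mono)
  also have "\<dots> \<le> (2 ^ p) ^ k * vol x b" by (rule vol_doubling_pow[OF assms(1)])
  also have "(2 ^ p) ^ k = ((2::real) ^ k) ^ p" by (simp flip: power_mult add: mult.commute)
  also have "\<dots> * vol x b \<le> (2 * real a / real b) ^ p * vol x b"
  proof (intro mult_right_mono power_mono)
    have "real (2 ^ k * b) \<le> real (2 * a)" using k(2) by (intro of_nat_mono) simp
    then show "2 ^ k \<le> 2 * real a / real b" using assms by (simp add: field_simps)
  qed auto
  finally show ?thesis .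
qed

text \<open>Zeros on a fixed proportion pin down the constant of the Poincare inequality: on
  \<open>A\<close> the integrand is \<open>a\<^sup>2\<close>, so \<open>a\<^sup>2 * mass A\<close>
  is bounded by the right-hand side, and
  \<open>f\<^sup>2 \<le> 2 * (f - a)\<^sup>2 + 2 * a\<^sup>2\<close>.\<close>

lemma poincare_vanishing:
  assumes r: "0 < r" and A: "A \<subseteq> oball x r" "\<And>y. y \<in> A \<Longrightarrow> f y = 0"
    and \<epsilon>: "0 < \<epsilon>" "\<epsilon> \<le> 1" "\<epsilon> * vol x r \<le> mass A"
  shows "(\<Sum>y\<in>oball x r. (f y)\<^sup>2 * m y) \<le> 4 / \<epsilon> * cP * (real r)\<^sup>2 * energy (oball x (2 * r)) f"
proof -
  define X where "X = cP * (real r)\<^sup>2 * energy (oball x (2 * r)) f"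
  obtain a where a: "(\<Sum>y\<in>oball x r. (f y - a)\<^sup>2 * m y) \<le> X"
    using poincare[OF r] unfolding X_def by blast
  have X0: "0 \<le> X" unfolding X_def using cP_pos energy_nonneg by simp
  have "a\<^sup>2 * mass A = (\<Sum>y\<in>A. (f y - a)\<^sup>2 * m y)"
    using A(2) by (simp add: mass_def sum_distrib_left)
  also have "\<dots> \<le> (\<Sum>y\<in>oball x r. (f y - a)\<^sup>2 * m y)"
    using A(1) by (intro sum_mono2) auto
  finally have "a\<^sup>2 * mass A \<le> X" using a by simp
  moreover have "a\<^sup>2 * (\<epsilon> * vol x r) \<le> a\<^sup>2 * mass A" using \<epsilon> by (intro mult_left_mono) auto
  ultimately have 1: "a\<^sup>2 * vol x r \<le> X / \<epsilon>" using \<epsilon> by (simp add: field_simps)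
  have "(\<Sum>y\<in>oball x r. (f y)\<^sup>2 * m y) \<le> (\<Sum>y\<in>oball x r. 2 * ((f y - a)\<^sup>2 * m y) + 2 * a\<^sup>2 * m y)"
  proof (rule sum_mono)
    fix y
    have "(f y)\<^sup>2 \<le> 2 * (f y - a)\<^sup>2 + 2 * a\<^sup>2"
      using zero_le_power2[of "f y - 2 * a"] by (simp add: power2_eq_square algebra_simps)
    then have "(f y)\<^sup>2 * m y \<le> (2 * (f y - a)\<^sup>2 + 2 * a\<^sup>2) * m y" by (rule mult_right_mono) simp
    then show "(f y)\<^sup>2 * m y \<le> 2 * ((f y - a)\<^sup>2 * m y) + 2 * a\<^sup>2 * m y" by (simp add: algebra_simps)
  qed
  also have "\<dots> = 2 * (\<Sum>y\<in>oball x r. (f y - a)\<^sup>2 * m y) + 2 * (a\<^sup>2 * vol x r)"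
    by (simp add: sum.distrib sum_distrib_left mass_def mult.assoc)
  also have "\<dots> \<le> 2 * X + 2 * (X / \<epsilon>)" using a 1 by simp
  also have "2 * X \<le> 2 * (X / \<epsilon>)" using \<epsilon> X0 by (simp add: field_simps mult_left_le)
  finally show ?thesis by (simp add: X_def)
qed

text \<open>The losses of the averaging argument: \<open>2 ^ p\<close> and \<open>4 ^ p\<close> come
  from bounding the total weight of the centres near a point from below and from above,
  \<open>8 * cP\<close> is \<open>poincare_vanishing\<close> with proportion 1/2.\<close>

definition cF :: real where "cF = 2 ^ p * 4 ^ p * 8 * cP"

lemma cF_pos: "0 < cF"
  using cP_pos by (simp add: cF_def)

text \<open>
  Average the Poincare inequality on the balls of radius \<open>s\<close>, on half of which \<open>f\<close> vanishes,
  over all centres \<open>z\<close> with weight \<open>m z / vol z s\<close>; no covering argument is needed.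
\<close>

lemma faber_krahn:
  assumes D: "finite D" "supp_inside D f" and s: "0 < s"
    and small: "\<And>x z. f x \<noteq> 0 \<Longrightarrow> d z x < s \<Longrightarrow> 2 * mass {y\<in>D. f y \<noteq> 0} \<le> vol z s"
  shows "(\<Sum>x\<in>D. (f x)\<^sup>2 * m x) \<le> cF * (real s)\<^sup>2 * energy D f"
proof -
  define \<Omega> where "\<Omega> = {y\<in>D. f y \<noteq> 0}"
  define Z where "Z = (\<Union>x\<in>D. oball x s)"
  define w where "w z = m z / vol z s" for z
  define e where "e x = (\<Sum>y\<in>D. \<mu> x y * (f x - f y)\<^sup>2)" for x
  have finZ: "finite Z" using D by (simp add: Z_def)
  have w0: "0 \<le> w z" for z by (simp add: w_def)
  have e0: "0 \<le> e x" for x unfolding e_def by (intro sum_nonneg mult_nonneg_nonneg weight_nonneg) simp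
  \<comment> \<open>An edge touching a nonzero value of \<open>f\<close> lies in \<open>D\<close>;
    so the energy of \<open>f\<close> on any ball is carried by pairs in \<open>D\<close>, even if
    the ball leaves \<open>D\<close>.\<close>
  have t: "\<mu> x y * (f x - f y)\<^sup>2 = 0" if "x \<notin> D \<or> y \<notin> D" for x y
  proof (cases "(x, y) \<in> E")
    case True
    with that D(2) have "f x = 0" "f y = 0"
      using edge_sym[of x y] by (auto simp: supp_inside_def)
    then show ?thesis by simp
  qed (simp add: weight_zero)
  have t1: "x \<in> D" if "\<mu> x y * (f x - f y)\<^sup>2 \<noteq> 0" for x y using t that by blast
  have t2: "y \<in> D" if "\<mu> x y * (f x - f y)\<^sup>2 \<noteq> 0" for x y using t that by blast
  \<comment> \<open>Balls that miss the set \<open>f \<noteq> 0\<close> contribute nothing, so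
    smallness is asked only of the balls that meet it.\<close>
  have A: "(\<Sum>x\<in>oball z s. (f x)\<^sup>2 * m x) \<le> 8 * cP * (real s)\<^sup>2 * energy (oball z (2 * s)) f" for z
  proof (cases "\<exists>x. f x \<noteq> 0 \<and> d z x < s")
    case True
    then have sm: "2 * mass \<Omega> \<le> vol z s" using small unfolding \<Omega>_def by blast
    have "vol z s = mass (oball z s - \<Omega>) + mass (oball z s \<inter> \<Omega>)"
      unfolding mass_def by (subst sum.union_disjoint[symmetric]) (auto intro!: sum.cong)
    moreover have "mass (oball z s \<inter> \<Omega>) \<le> mass \<Omega>"
      using D by (intro mass_mono) (auto simp: \<Omega>_def)
    ultimately have "1/2 * vol z s \<le> mass (oball z s - \<Omega>)" using sm by simp
    moreover have "f y = 0" if "y \<in> oball z s - \<Omega>" for y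
      using that D(2) by (auto simp: \<Omega>_def supp_inside_def)
    ultimately show ?thesis
      using poincare_vanishing[OF s, of "oball z s - \<Omega>" z f "1/2"] by auto
  next
    case False
    then have "(\<Sum>x\<in>oball z s. (f x)\<^sup>2 * m x) = 0" by (intro sum.neutral) auto
    then show ?thesis using cP_pos energy_nonneg by simp
  qed
  have B: "energy (oball z (2 * s)) f \<le> (\<Sum>x\<in>D. if d z x < 2 * s then e x else 0)" for z
  proof -
    let ?B = "oball z (2 * s)"
    have "energy ?B f = (\<Sum>x\<in>?B \<inter> D. \<Sum>y\<in>?B. \<mu> x y * (f x - f y)\<^sup>2)"
      unfolding energy_def by (rule sum.mono_neutral_right) (auto simp only: finite_oball Diff_iff Int_iff intro!: sum.neutral dest: t1)
    also have "\<dots> = (\<Sum>x\<in>?B \<inter> D. \<Sum>y\<in>?B \<inter> D. \<mu> x y * (f x - f y)\<^sup>2)"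
      by (intro sum.cong refl sum.mono_neutral_right) (auto simp only: finite_oball Diff_iff Int_iff dest: t2)
    also have "\<dots> \<le> (\<Sum>x\<in>?B \<inter> D. e x)"
      unfolding e_def using D by (intro sum_mono sum_mono2) (auto simp: weight_nonneg)
    also have "\<dots> = (\<Sum>x\<in>D. if x \<in> ?B then e x else 0)"
      using D by (simp add: sum.inter_restrict Int_commute)
    finally show ?thesis by simp
  qed
  \<comment> \<open>Bounded overlap: for centres \<open>z\<close> whose doubled ball contains
    \<open>x\<close>, \<open>vol x (2 * s)\<close> is at most
    \<open>4 ^ p * vol z s\<close>.\<close>
  have C: "(\<Sum>z\<in>Z. if d z x < 2 * s then w z else 0) \<le> 4 ^ p" for x
  proof -
    have "(\<Sum>z\<in>Z. if d z x < 2 * s then w z else 0) \<le> (\<Sum>z\<in>Z. if d z x < 2 * s then 4 ^ p / vol x (2 * s) * m z else 0)"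
    proof (intro sum_mono)
      fix z
      have "vol x (2 * s) \<le> (2 ^ p) ^ 2 * vol z s" if "d z x < 2 * s"
        using that by (intro vol_shift[OF s]) simp
      moreover have "0 < vol x (2 * s)" "0 < vol z s" using s by (auto intro!: vol_pos)
      ultimately have "w z \<le> 4 ^ p / vol x (2 * s) * m z" if "d z x < 2 * s"
        using that m_pos[of z] unfolding w_def
        by (simp add: field_simps power2_eq_square flip: power_mult_distrib)
      then show "(if d z x < 2 * s then w z else 0) \<le> (if d z x < 2 * s then 4 ^ p / vol x (2 * s) * m z else 0)"
        by simp
    qed
    also have "\<dots> = (\<Sum>z\<in>Z \<inter> oball x (2 * s). 4 ^ p / vol x (2 * s) * m z)"
      by (simp only: sum.inter_restrict[OF finZ] oball_iff dist_sym[of x])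
    also have "\<dots> = 4 ^ p / vol x (2 * s) * mass (Z \<inter> oball x (2 * s))"
      by (simp add: mass_def sum_distrib_left)
    also have "\<dots> \<le> 4 ^ p / vol x (2 * s) * vol x (2 * s)"
      by (intro mult_left_mono mass_mono) auto
    also have "\<dots> = 4 ^ p" using vol_pos[of "2 * s" x] s by (simp add: less_imp_neq[symmetric])
    finally show ?thesis .
  qed
  \<comment> \<open>Conversely, the balls containing \<open>x\<close> carry total weight at least
    \<open>1 / 2 ^ p\<close>; \<open>Z\<close> contains all of their centres.\<close>
  have F: "1 \<le> 2 ^ p * (\<Sum>z\<in>Z. if d z x < s then w z else 0)" if x: "x \<in> D" for x
  proof -
    have vp: "0 < vol z s" for z using s by (auto intro!: vol_pos)
    have "1 = 1 / vol x s * vol x s" using vp[of x] by simp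
    also have "\<dots> = (\<Sum>z\<in>oball x s. 1 / vol x s * m z)" by (simp add: mass_def sum_distrib_left)
    also have "\<dots> \<le> (\<Sum>z\<in>oball x s. 2 ^ p * w z)"
    proof (rule sum_mono)
      fix z assume z: "z \<in> oball x s"
      have "vol z s \<le> (2 ^ p) ^ 1 * vol x s" using z by (intro vol_shift[OF s]) simp
      with vp[of z] vp[of x] m_pos[of z] show "1 / vol x s * m z \<le> 2 ^ p * w z"
        unfolding w_def by (simp add: field_simps)
    qed
    also have "\<dots> = 2 ^ p * (\<Sum>z\<in>Z \<inter> oball x s. w z)"
    proof -
      have "oball x s = Z \<inter> oball x s" using x by (auto simp: Z_def)
      then show ?thesis by (simp add: sum_distrib_left)
    qed
    also have "\<dots> = 2 ^ p * (\<Sum>z\<in>Z. if d z x < s then w z else 0)"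
      by (simp only: sum.inter_restrict[OF finZ] oball_iff dist_sym[of x])
    finally show ?thesis .
  qed
  have "(\<Sum>x\<in>D. (f x)\<^sup>2 * m x) \<le> (\<Sum>x\<in>D. (f x)\<^sup>2 * m x * (2 ^ p * (\<Sum>z\<in>Z. if d z x < s then w z else 0)))"
  proof (rule sum_mono)
    fix x assume "x \<in> D"
    from mult_left_mono[OF F[OF this], of "(f x)\<^sup>2 * m x"]
    show "(f x)\<^sup>2 * m x \<le> (f x)\<^sup>2 * m x * (2 ^ p * (\<Sum>z\<in>Z. if d z x < s then w z else 0))" by simp
  qed
  also have "\<dots> = 2 ^ p * (\<Sum>x\<in>D. \<Sum>z\<in>Z. w z * (if d z x < s then (f x)\<^sup>2 * m x else 0))"
    by (simp add: sum_distrib_left mult_ac if_distrib cong: if_cong)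
  also have "(\<Sum>x\<in>D. \<Sum>z\<in>Z. w z * (if d z x < s then (f x)\<^sup>2 * m x else 0))
      = (\<Sum>z\<in>Z. w z * (\<Sum>x\<in>D. if d z x < s then (f x)\<^sup>2 * m x else 0))"
    by (subst sum.swap) (simp add: sum_distrib_left)
  also have "\<dots> \<le> (\<Sum>z\<in>Z. w z * (8 * cP * (real s)\<^sup>2 * (\<Sum>x\<in>D. if d z x < 2 * s then e x else 0)))"
  proof (intro sum_mono mult_left_mono w0)
    fix z
    have "(\<Sum>x\<in>D. if d z x < s then (f x)\<^sup>2 * m x else 0) = (\<Sum>x\<in>D \<inter> oball z s. (f x)\<^sup>2 * m x)"
      using D by (simp add: sum.inter_restrict)
    also have "\<dots> \<le> (\<Sum>x\<in>oball z s. (f x)\<^sup>2 * m x)" by (intro sum_mono2) auto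
    also have "\<dots> \<le> 8 * cP * (real s)\<^sup>2 * energy (oball z (2 * s)) f" by (rule A)
    also have "\<dots> \<le> 8 * cP * (real s)\<^sup>2 * (\<Sum>x\<in>D. if d z x < 2 * s then e x else 0)"
      using cP_pos by (intro mult_left_mono B) simp
    finally show "(\<Sum>x\<in>D. if d z x < s then (f x)\<^sup>2 * m x else 0) \<le>
      8 * cP * (real s)\<^sup>2 * (\<Sum>x\<in>D. if d z x < 2 * s then e x else 0)" .
  qed
  also have "\<dots> = 8 * cP * (real s)\<^sup>2 * (\<Sum>z\<in>Z. \<Sum>x\<in>D. e x * (if d z x < 2 * s then w z else 0))"
    by (simp add: sum_distrib_left mult_ac if_distrib cong: if_cong)
  also have "(\<Sum>z\<in>Z. \<Sum>x\<in>D. e x * (if d z x < 2 * s then w z else 0)) =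
      (\<Sum>x\<in>D. e x * (\<Sum>z\<in>Z. if d z x < 2 * s then w z else 0))"
    by (subst sum.swap) (simp add: sum_distrib_left)
  also have "\<dots> \<le> (\<Sum>x\<in>D. e x * 4 ^ p)" by (intro sum_mono mult_left_mono C e0)
  also have "\<dots> = 4 ^ p * energy D f" by (simp add: e_def energy_def sum_distrib_left sum_distrib_right mult_ac)
  finally show ?thesis using cP_pos by (simp add: cF_def mult_ac mult_right_mono)
qed

end

section \<open>Mean value inequalities\<close>

lemma pow2_sq: "((2::real) ^ k)\<^sup>2 = 4 ^ k"
  by (induction k) (simp_all add: power_mult_distrib)

section \<open>De Giorgi iteration: from integral to pointwise bounds\<close>

context vd_pi_graph
begin

text \<open>One De Giorgi step. Chebyshev bounds the mass of the level set
  \<open>u > \<kappa>'\<close> by \<open>A / (\<kappa>' - \<kappa>)\<^sup>2\<close>;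
  \<open>small\<close> compares this with balls of radius \<open>s\<close>, so that Faber--Krahn
  applies to the truncation times a cutoff, whose energy the Caccioppoli identity controls. The
  recursion is linear in \<open>A\<close>; the gain comes from choosing \<open>s\<close> small
  against \<open>r - r'\<close>.\<close>

lemma level_step:
  assumes r: "0 < r'" "r' < r" and \<kappa>: "\<kappa> < \<kappa>'" and M: "0 \<le> M" and s: "0 < s"
    and sub: "\<And>y. y \<in> oball x r \<Longrightarrow> lap u y \<le> M * m y"
    and A: "A = (\<Sum>y\<in>oball x r. (max 0 (u y - \<kappa>))\<^sup>2 * m y)"
    and small: "\<And>z. d x z < r + s \<Longrightarrow> 2 * (A / (\<kappa>' - \<kappa>)\<^sup>2) \<le> vol z s"
  shows "(\<Sum>y\<in>oball x r'. (max 0 (u y - \<kappa>'))\<^sup>2 * m y)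
    \<le> cF * (real s)\<^sup>2 * (2 * M / (\<kappa>' - \<kappa>) + 1 / (real r - real r')\<^sup>2) * A"
proof -
  define D where "D = oball x r"
  define v where "v y = max 0 (u y - \<kappa>')" for y
  define w where "w y = max 0 (u y - \<kappa>)" for y
  \<comment> \<open>Equal to 1 on \<open>oball x r'\<close>, that is up to distance
    \<open>r' - 1\<close>, and zero from distance \<open>r - 1\<close> on, so that neighbours of its
    support stay in \<open>oball x r\<close>.\<close>
  define \<phi> where "\<phi> = cutoff x (r' - 1) (r - 1)"
  define f where "f y = v y * \<phi> y" for y
  define \<delta> where "\<delta> = \<kappa>' - \<kappa>"
  have \<delta>: "0 < \<delta>" using \<kappa> by (simp add: \<delta>_def)
  have v0: "0 \<le> v y" for y by (simp add: v_def)
  have vw: "v y \<le> w y" for y using \<kappa> by (auto simp: v_def w_def)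
  \<comment> \<open>Turns the term linear in \<open>v\<close>, caused by the right-hand side
    \<open>M\<close>, into one quadratic in \<open>w\<close>: where \<open>v > 0\<close>,
    \<open>w\<close> exceeds \<open>\<delta>\<close>.\<close>
  have vw2: "v y * \<delta> \<le> (w y)\<^sup>2" for y
  proof (cases "v y = 0")
    case False
    then have "\<delta> \<le> w y" by (auto simp: v_def w_def \<delta>_def)
    then have "v y * \<delta> \<le> w y * w y" using vw[of y] v0[of y] \<delta> by (intro mult_mono) auto
    then show ?thesis by (simp add: power2_eq_square)
  qed simp
  have finD: "finite D" by (simp add: D_def)
  have \<phi>01: "0 \<le> \<phi> y" "\<phi> y \<le> 1" for y by (auto simp: \<phi>_def cutoff_range)
  have \<phi>2: "(\<phi> y)\<^sup>2 \<le> 1" for y using \<phi>01 by (simp add: power_le_one)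
  have supp: "supp_inside D \<phi>" unfolding D_def \<phi>_def using r by (intro cutoff_supp) auto
  then have suppf: "supp_inside D f" by (auto simp: supp_inside_def f_def)
  have A': "A = (\<Sum>y\<in>D. (w y)\<^sup>2 * m y)" by (simp add: A D_def w_def)
  have "(\<Sum>y\<in>oball x r'. (v y)\<^sup>2 * m y) = (\<Sum>y\<in>oball x r'. (f y)\<^sup>2 * m y)"
  proof (rule sum.cong[OF refl])
    fix y assume "y \<in> oball x r'"
    then have "\<phi> y = 1" unfolding \<phi>_def using r by (intro cutoff_eq_1) auto
    then show "(v y)\<^sup>2 * m y = (f y)\<^sup>2 * m y" by (simp add: f_def)
  qed
  also have "\<dots> \<le> (\<Sum>y\<in>D. (f y)\<^sup>2 * m y)"
    unfolding D_def using r by (intro sum_mono2) auto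
  also have "\<dots> \<le> cF * (real s)\<^sup>2 * energy D f"
  proof (rule faber_krahn[OF finD suppf s])
    fix y z assume y: "f y \<noteq> 0" "d z y < s"
    then have "y \<in> D" using suppf by (auto simp: supp_inside_def)
    then have "d x z < r + s" using dist_triangle[of x z y] dist_sym[of y z] y by (simp add: D_def)
    from small[OF this] have sm: "2 * (A / \<delta>\<^sup>2) \<le> vol z s" by (simp add: \<delta>_def)
    have "\<delta>\<^sup>2 * mass {y\<in>D. f y \<noteq> 0} = (\<Sum>y\<in>{y\<in>D. f y \<noteq> 0}. \<delta>\<^sup>2 * m y)"
      by (simp add: mass_def sum_distrib_left)
    also have "\<dots> \<le> (\<Sum>y\<in>{y\<in>D. f y \<noteq> 0}. (w y)\<^sup>2 * m y)"
    proof (intro sum_mono mult_right_mono power_mono)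
      fix y assume "y \<in> {y\<in>D. f y \<noteq> 0}"
      then have "v y \<noteq> 0" by (simp add: f_def)
      then show "\<delta> \<le> w y" by (auto simp: v_def w_def \<delta>_def)
    qed (use \<delta> in auto)
    also have "\<dots> \<le> A" unfolding A' using finD by (intro sum_mono2) auto
    finally have "mass {y\<in>D. f y \<noteq> 0} \<le> A / \<delta>\<^sup>2" using \<delta> by (simp add: field_simps)
    with sm show "2 * mass {y\<in>D. f y \<noteq> 0} \<le> vol z s" by simp
  qed
  also have "\<dots> \<le> cF * (real s)\<^sup>2 * ((2 * M / \<delta> + 1 / (real r - real r')\<^sup>2) * A)"
  proof (intro mult_left_mono)
    have "v y * (\<phi> y)\<^sup>2 * lap v y \<le> M / \<delta> * ((w y)\<^sup>2 * m y)" if y: "y \<in> D" for y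
    proof (cases "v y = 0")
      case False
      then have vy: "v y = u y - \<kappa>'" by (auto simp: v_def max_def split: if_splits)
      \<comment> \<open>Truncation preserves the bound on the Laplacian: at a point above the level
        \<open>v\<close> equals \<open>u - \<kappa>'\<close>, elsewhere it is at least that.\<close>
      have "lap v y \<le> lap u y" unfolding lap_def
      proof (intro sum_mono mult_left_mono weight_nonneg)
        fix z show "v y - v z \<le> u y - u z" unfolding vy by (simp add: v_def)
      qed
      also have "\<dots> \<le> M * m y" using sub y by (simp add: D_def)
      finally have "v y * (\<phi> y)\<^sup>2 * lap v y \<le> v y * (\<phi> y)\<^sup>2 * (M * m y)"
        using v0 by (intro mult_left_mono) auto
      also have "\<dots> \<le> v y * 1 * (M * m y)"
        using v0 M \<phi>2 by (intro mult_right_mono mult_left_mono) auto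
      also have "\<dots> = M / \<delta> * ((v y * \<delta>) * m y)" using \<delta> by simp
      also have "\<dots> \<le> M / \<delta> * ((w y)\<^sup>2 * m y)"
        using M \<delta> by (intro mult_left_mono mult_right_mono vw2) auto
      finally show ?thesis .
    qed (use M \<delta> in simp)
    then have "(\<Sum>y\<in>D. v y * (\<phi> y)\<^sup>2 * lap v y) \<le> (\<Sum>y\<in>D. M / \<delta> * ((w y)\<^sup>2 * m y))"
      by (rule sum_mono)
    also have "\<dots> = M / \<delta> * A" by (simp add: A' sum_distrib_left)
    finally have 1: "(\<Sum>y\<in>D. v y * (\<phi> y)\<^sup>2 * lap v y) \<le> M / \<delta> * A" .
    have "(\<Sum>y\<in>D. \<Sum>z\<in>D. \<mu> y z * (v y * v z * (\<phi> y - \<phi> z)\<^sup>2)) \<le> 1 / (real r - real r')\<^sup>2 * (\<Sum>y\<in>D. (v y)\<^sup>2 * m y)"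
    proof (rule double_sum_sq_le[OF finD])
      fix y z assume "(y, z) \<in> E"
      then have "(\<phi> y - \<phi> z)\<^sup>2 \<le> 1 / (real (r - 1) - real (r' - 1))\<^sup>2"
        unfolding \<phi>_def using r by (intro cutoff_lipschitz) auto
      also have "real (r - 1) - real (r' - 1) = real r - real r'" using r by (simp add: of_nat_diff)
      finally show "(\<phi> y - \<phi> z)\<^sup>2 \<le> 1 / (real r - real r')\<^sup>2" .
    qed (use v0 in auto)
    also have "\<dots> \<le> 1 / (real r - real r')\<^sup>2 * A"
      unfolding A' using vw v0 by (intro mult_left_mono sum_mono mult_right_mono power_mono) auto
    finally have 2: "(\<Sum>y\<in>D. \<Sum>z\<in>D. \<mu> y z * (v y * v z * (\<phi> y - \<phi> z)\<^sup>2)) \<le> 1 / (real r - real r')\<^sup>2 * A" .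
    have "energy D f \<le> 2 * (M / \<delta> * A) + 1 / (real r - real r')\<^sup>2 * A"
      unfolding f_def caccioppoli_identity[OF finD supp] using 1 2 by linarith
    then show "energy D f \<le> (2 * M / \<delta> + 1 / (real r - real r')\<^sup>2) * A" by (simp add: algebra_simps)
  qed (use cF_pos in simp)
  finally show ?thesis by (simp add: v_def \<delta>_def mult.assoc)
qed

text \<open>
  The iteration uses the Faber--Krahn inequality at radius \<open>2 ^ (n + 1 - k - t)\<close> and so must stop at
  \<open>k = n + 1 - t\<close>. By then the decay \<open>(1 / 2 ^ p) ^ k\<close> outweighs the ratio \<open>V / m x\<close>, which turns the
  bound on the sum into one at the centre.
\<close>

lemma de_giorgi_levels:
  fixes t n k :: nat
  assumes t: "80 * cF * 2 ^ p \<le> 4 ^ t" "1 \<le> t"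
    and K: "0 < K" "0 \<le> M" "M * (2 ^ (n + 1))\<^sup>2 \<le> K"
    and V: "V = vol x (2 ^ (n + 1))" and \<epsilon>: "\<epsilon> = 1 / (8 * (2 ^ p) ^ (t + 2))"
    and sub: "\<And>y. y \<in> oball x (2 ^ (n + 1)) \<Longrightarrow> lap u y \<le> M * m y"
    and init: "(\<Sum>y\<in>oball x (2 ^ (n + 1)). (u y)\<^sup>2 * m y) \<le> \<epsilon> * K\<^sup>2 * V"
    and k: "k + t \<le> n + 1"
  shows "(\<Sum>y\<in>oball x (2 ^ n + 2 ^ (n - k)). (max 0 (u y - K * (1 - 1 / 2 ^ k)))\<^sup>2 * m y)
    \<le> (1 / (4 * 2 ^ p)) ^ k * \<epsilon> * K\<^sup>2 * V"
  using k
proof (induction k)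
  case 0
  have "(\<Sum>y\<in>oball x (2 ^ (n + 1)). (max 0 (u y))\<^sup>2 * m y) \<le> (\<Sum>y\<in>oball x (2 ^ (n + 1)). (u y)\<^sup>2 * m y)"
    by (intro sum_mono mult_right_mono) (auto simp: max_def)
  with init show ?case by (simp flip: mult_2)
next
  case (Suc k)
  define CD where "CD = (2::real) ^ p"
  have CD: "1 \<le> CD" by (simp add: CD_def)
  \<comment> \<open>The 4 offsets the shrinking gap of the levels, \<open>K / (2 * 2 ^ k)\<close>,
    in Chebyshev's bound; \<open>2 ^ p\<close> offsets the volume lost each time \<open>s\<close> is
    halved.\<close>
  define q where "q = 1 / (4 * CD)"
  define r where "r = (2::nat) ^ n + 2 ^ (n - k)"
  define r' where "r' = (2::nat) ^ n + 2 ^ (n - Suc k)"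
  \<comment> \<open>The ratio of \<open>s\<close> to \<open>r - r'\<close> is
    \<open>4 / 2 ^ t\<close> at every level; a large \<open>t\<close> is what makes the step
    contract.\<close>
  define s where "s = (2::nat) ^ (n + 1 - k - t)"
  define N where "N = (4::real) ^ (n + 1)"
  define A where "A = (\<Sum>y\<in>oball x r. (max 0 (u y - K * (1 - 1 / 2 ^ k)))\<^sup>2 * m y)"
  have kn: "Suc k \<le> n" "k + t \<le> n" "k + t \<le> n + 1" using Suc.prems t by auto
  have IH: "A \<le> q ^ k * \<epsilon> * K\<^sup>2 * V" using Suc.IH kn by (simp add: A_def r_def q_def CD_def)
  have A0: "0 \<le> A" unfolding A_def by (intro sum_nonneg) auto
  have rr: "real r - real r' = 2 ^ (n - Suc k)"
  proof -
    have "n - k = Suc (n - Suc k)" using kn by simp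
    then have "(2::real) ^ (n - k) = 2 * 2 ^ (n - Suc k)" by (simp only: power_Suc)
    then show ?thesis by (simp add: r_def r'_def)
  qed
  then have r'r: "r' < r" using zero_less_power[of "2::real" "n - Suc k"] by linarith
  have "n + 1 = k + 2 + (n - Suc k)" using kn by simp
  then have N1: "N = 4 ^ k * 4 ^ 2 * 4 ^ (n - Suc k)" unfolding N_def by (simp only: power_add)
  have "n + 1 = k + t + (n + 1 - k - t)" using kn by simp
  then have N2: "N = 4 ^ k * 4 ^ t * 4 ^ (n + 1 - k - t)" unfolding N_def by (metis power_add)
  have s2: "(real s)\<^sup>2 = N / (4 ^ k * 4 ^ t)" unfolding N2 s_def
    by (simp add: pow2_sq)
  have rr2: "(real r - real r')\<^sup>2 = N / (4 ^ k * 16)" unfolding rr N1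
    by (simp add: pow2_sq)
  have N0: "0 < N" by (simp add: N_def)
  have rR: "r \<le> 2 ^ (n + 1)" unfolding r_def by (simp add: mult_2 power_increasing)
  have sR: "s \<le> 2 ^ (n + 1)" unfolding s_def by (intro power_increasing) auto
  have "(\<Sum>y\<in>oball x r'. (max 0 (u y - K * (1 - 1 / 2 ^ Suc k)))\<^sup>2 * m y)
    \<le> cF * (real s)\<^sup>2 * (2 * M / (K * (1 - 1 / 2 ^ Suc k) - K * (1 - 1 / 2 ^ k)) + 1 / (real r - real r')\<^sup>2) * A"
  proof (rule level_step)
    show "0 < r'" "r' < r" "0 \<le> M" "0 < s" using r'r K by (auto simp: r'_def s_def)
    show "K * (1 - 1 / 2 ^ k) < K * (1 - 1 / 2 ^ Suc k)" using K by (simp add: field_simps)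
    show "lap u y \<le> M * m y" if "y \<in> oball x r" for y
      using that rR by (intro sub) simp
    show "A = (\<Sum>y\<in>oball x r. (max 0 (u y - K * (1 - 1 / 2 ^ k)))\<^sup>2 * m y)" by (rule A_def)
    fix z assume z: "d x z < r + s"
    have "2 * (A / (K * (1 - 1 / 2 ^ Suc k) - K * (1 - 1 / 2 ^ k))\<^sup>2) = 2 * (A / (K / (2 * 2 ^ k))\<^sup>2)"
      by (simp add: field_simps)
    also have "\<dots> = 8 * 4 ^ k * (A / K\<^sup>2)"
      using K by (simp add: power_divide power_mult_distrib pow2_sq)
    also have "\<dots> \<le> 8 * 4 ^ k * (q ^ k * \<epsilon> * V)"
      using IH K by (intro mult_left_mono) (simp_all add: field_simps)
    \<comment> \<open>The 8 in \<open>\<epsilon>\<close> cancels, and \<open>k + t + 2\<close>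
      doublings lead from \<open>oball z s\<close> to a ball containing
      \<open>oball x (2 ^ (n + 1))\<close>; \<open>q\<close> pays for \<open>k\<close> of them and
      \<open>\<epsilon>\<close> for the rest.\<close>
    also have "\<dots> = V / CD ^ (k + t + 2)"
      unfolding \<epsilon> q_def CD_def[symmetric] using CD by (simp add: field_simps power_add power_mult_distrib)
    also have "\<dots> \<le> vol z s"
    proof -
      have "2 ^ (k + t + 2) * s = 2 ^ (k + t + 2 + (n + 1 - k - t))" unfolding s_def by (simp add: power_add)
      also have "k + t + 2 + (n + 1 - k - t) = n + 3" using kn by simp
      finally have e: "2 ^ (k + t + 2) * s = 2 ^ (n + 3)" .
      have "V \<le> (2 ^ p) ^ (k + t + 2) * vol z s" unfolding V
      proof (rule vol_shift)
        have "d z x < 2 ^ (n + 1) + 2 ^ (n + 1)" using z rR sR dist_sym[of x z] by linarith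
        then show "d z x + 2 ^ (n + 1) \<le> 2 ^ (k + t + 2) * s" unfolding e by (simp add: power_add)
      qed (simp add: s_def)
      then show ?thesis using CD by (simp add: CD_def field_simps)
    qed
    finally show "2 * (A / (K * (1 - 1 / 2 ^ Suc k) - K * (1 - 1 / 2 ^ k))\<^sup>2) \<le> vol z s" .
  qed
  also have "K * (1 - 1 / 2 ^ Suc k) - K * (1 - 1 / 2 ^ k) = K / (2 * 2 ^ k)" by (simp add: field_simps)
  also have "cF * (real s)\<^sup>2 * (2 * M / (K / (2 * 2 ^ k)) + 1 / (real r - real r')\<^sup>2) * A \<le> q * A"
  proof (rule mult_right_mono[OF _ A0])
    have MN: "M * N \<le> K" using K(3) unfolding N_def pow2_sq .
    have "2 * M / (K / (2 * 2 ^ k)) = 4 * 2 ^ k * (M / K)" by simp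
    also have "\<dots> \<le> 4 * 4 ^ k * (1 / N)"
      using MN K N0 by (intro mult_mono power_mono) (auto simp: field_simps)
    \<comment> \<open>20 = 4 + 16, from the right-hand side and from the cutoff. Together with the 4
      in \<open>q\<close> it yields the 80 in the hypothesis on \<open>t\<close>.\<close>
    finally have "2 * M / (K / (2 * 2 ^ k)) + 1 / (real r - real r')\<^sup>2 \<le> 20 * 4 ^ k / N"
      unfolding rr2 by simp
    then have "cF * (real s)\<^sup>2 * (2 * M / (K / (2 * 2 ^ k)) + 1 / (real r - real r')\<^sup>2)
      \<le> cF * (real s)\<^sup>2 * (20 * 4 ^ k / N)"
      using cF_pos by (intro mult_left_mono) auto
    also have "\<dots> = 20 * cF / 4 ^ t" unfolding s2 using N0 by simp
    also have "\<dots> \<le> q" using t(1) CD unfolding q_def CD_def[symmetric] by (simp add: field_simps)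
    finally show "cF * (real s)\<^sup>2 * (2 * M / (K / (2 * 2 ^ k)) + 1 / (real r - real r')\<^sup>2) \<le> q" .
  qed
  also have "q * A \<le> q * (q ^ k * \<epsilon> * K\<^sup>2 * V)"
    using IH CD by (intro mult_left_mono) (auto simp: q_def)
  finally show ?case by (simp add: r'_def q_def CD_def mult.assoc)
qed

lemma mean_value_dyadic:
  fixes t n :: nat
  assumes t: "80 * cF * 2 ^ p \<le> 4 ^ t" "1 \<le> t"
    and K: "0 < K" "0 \<le> M" "M * (2 ^ (n + 1))\<^sup>2 \<le> K"
    and \<epsilon>: "\<epsilon> = 1 / (8 * (2 ^ p) ^ (t + 2))"
    and sub: "\<And>y. y \<in> oball x (2 ^ (n + 1)) \<Longrightarrow> lap u y \<le> M * m y"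
    and init: "(\<Sum>y\<in>oball x (2 ^ (n + 1)). (u y)\<^sup>2 * m y) \<le> \<epsilon> * K\<^sup>2 * vol x (2 ^ (n + 1))"
  shows "u x \<le> 2 * K"
proof -
  define V where "V = vol x (2 ^ (n + 1))"
  \<comment> \<open>Truncated subtraction: for \<open>n + 1 \<le> t\<close> no level is passed, and
    \<open>init\<close> bounds the value at the centre directly. In both cases
    \<open>n + 1 \<le> k + t\<close>, which leaves a factor \<open>(2 ^ p) ^ t\<close> for
    \<open>\<epsilon>\<close> to absorb.\<close>
  define k where "k = n + 1 - t"
  define v where "v y = max 0 (u y - K * (1 - 1 / 2 ^ k))" for y
  define CD where "CD = (2::real) ^ p"
  have CD: "1 \<le> CD" by (simp add: CD_def)
  have V0: "0 \<le> V" by (simp add: V_def)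
  have \<epsilon>0: "0 < \<epsilon>" by (simp add: \<epsilon>)
  have VV: "V \<le> CD ^ (n + 1) * m x"
    using vol_doubling_pow[of "Suc 0" x "n + 1"] by (simp add: V_def CD_def vol_1)
  have "(v x)\<^sup>2 * m x \<le> (1 / (4 * CD)) ^ k * \<epsilon> * K\<^sup>2 * V"
  proof (cases "k = 0")
    case True
    have "(v x)\<^sup>2 * m x \<le> (u x)\<^sup>2 * m x"
      using True by (intro mult_right_mono) (auto simp: v_def max_def)
    also have "\<dots> \<le> (\<Sum>y\<in>oball x (2 ^ (n + 1)). (u y)\<^sup>2 * m y)"
      by (rule member_le_sum[of _ _ "\<lambda>y. (u y)\<^sup>2 * m y"]) auto
    finally show ?thesis using init True by (simp add: V_def)
  next
    case False
    then have "k + t \<le> n + 1" by (simp add: k_def)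
    note de_giorgi_levels[OF t K V_def \<epsilon> sub init[folded V_def] this]
    moreover have "(v x)\<^sup>2 * m x \<le> (\<Sum>y\<in>oball x (2 ^ n + 2 ^ (n - k)). (v y)\<^sup>2 * m y)"
      by (rule member_le_sum[of _ _ "\<lambda>y. (v y)\<^sup>2 * m y"]) auto
    ultimately show ?thesis by (simp add: v_def CD_def)
  qed
  also have "\<dots> \<le> (1 / CD) ^ k * \<epsilon> * K\<^sup>2 * (CD ^ (n + 1) * m x)"
    using VV \<epsilon>0 V0 CD K(1) by (intro mult_mono power_mono) (auto simp: field_simps)
  also have "\<dots> \<le> (1 / CD) ^ k * \<epsilon> * K\<^sup>2 * (CD ^ (k + t) * m x)"
    using \<epsilon>0 CD by (intro mult_left_mono mult_right_mono power_increasing) (auto simp: k_def)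
  also have "\<dots> = \<epsilon> * CD ^ t * (K\<^sup>2 * m x)" using CD by (simp add: power_add power_divide)
  also have "\<dots> \<le> 1 * (K\<^sup>2 * m x)"
  proof (rule mult_right_mono)
    have "1 \<le> 8 * CD\<^sup>2" using CD one_le_power[of CD 2] by linarith
    then show "\<epsilon> * CD ^ t \<le> 1" unfolding \<epsilon> CD_def[symmetric] using CD by (simp add: power_add power2_eq_square)
  qed simp
  finally have "(v x)\<^sup>2 \<le> K\<^sup>2" using m_pos[of x] by simp
  then have "v x \<le> K" using K by (simp add: power2_le_iff_abs_le)
  then have "u x - K * (1 - 1 / 2 ^ k) \<le> K" by (simp add: v_def)
  moreover have "K * (1 - 1 / 2 ^ k) \<le> K * 1" using K by (intro mult_left_mono) auto
  ultimately show ?thesis by simp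
qed

text \<open>Enlarging \<open>K\<close> to \<open>\<Lambda> * K\<close> turns a plain
  \<open>L2\<close> bound into the small one of \<open>mean_value_dyadic\<close>;
  \<open>\<Lambda>\<close> also pays for passing to a power of 2. The right-hand side
  \<open>M\<close> is kept for the exit time, whose Laplacian is \<open>m\<close>.\<close>

lemma mean_value_L2:
  "\<exists>C>0. \<forall>u x R M K. 0 < R \<longrightarrow> 0 < K \<longrightarrow> 0 \<le> M \<longrightarrow> M * (real R)\<^sup>2 \<le> K \<longrightarrow>
     (\<forall>y\<in>oball x R. lap u y \<le> M * m y) \<longrightarrow>
     (\<Sum>y\<in>oball x R. (u y)\<^sup>2 * m y) \<le> K\<^sup>2 * vol x R \<longrightarrow> u x \<le> C * K"
proof -
  obtain t0 where t0: "80 * cF * 2 ^ p < (4::real) ^ t0" using real_arch_pow[of 4] by auto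
  define t where "t = Suc t0"
  have "(4::real) ^ t0 \<le> 4 ^ t" unfolding t_def by (intro power_increasing) auto
  with t0 have t: "80 * cF * 2 ^ p \<le> (4::real) ^ t" "1 \<le> t" unfolding t_def by linarith+
  define \<epsilon> where "\<epsilon> = 1 / (8 * ((2::real) ^ p) ^ (t + 2))"
  have \<epsilon>: "0 < \<epsilon>" by (simp add: \<epsilon>_def)
  define \<Lambda> where "\<Lambda> = max 1 (2 ^ p / \<epsilon>)"
  have \<Lambda>: "1 \<le> \<Lambda>" "2 ^ p \<le> \<epsilon> * \<Lambda>" using \<epsilon> by (auto simp: \<Lambda>_def field_simps max_def)
  have \<Lambda>2: "2 ^ p \<le> \<epsilon> * \<Lambda>\<^sup>2"
  proof -
    have "\<epsilon> * \<Lambda> * 1 \<le> \<epsilon> * \<Lambda> * \<Lambda>" using \<Lambda> \<epsilon> by (intro mult_left_mono) auto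
    with \<Lambda> show ?thesis by (simp add: power2_eq_square mult.assoc)
  qed
  have "u x \<le> 2 * \<Lambda> * K"
    if h: "0 < R" "0 < K" "0 \<le> M" "M * (real R)\<^sup>2 \<le> K" "\<And>y. y\<in>oball x R \<Longrightarrow> lap u y \<le> M * m y"
      "(\<Sum>y\<in>oball x R. (u y)\<^sup>2 * m y) \<le> K\<^sup>2 * vol x R" for u x R M K
  proof (cases "R = 1")
    \<comment> \<open>No radius \<open>2 ^ (n + 1)\<close> fits into radius 1, where the sum is a
      single term.\<close>
    case True
    with h(6) have "(u x)\<^sup>2 * m x \<le> K\<^sup>2 * m x" by (simp add: oball_1 mass_def)
    then have "(u x)\<^sup>2 \<le> K\<^sup>2" using m_pos[of x] by simp
    then have "u x \<le> K" using h by (simp add: power2_le_iff_abs_le)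
    also have "\<dots> \<le> 2 * \<Lambda> * K" using h \<Lambda> by simp
    finally show ?thesis .
  next
    case False
    obtain j where j: "R \<le> 2 ^ j * 1" "2 ^ j * 1 < 2 * R" using ex_dyadic_scale[of 1 R] h by auto
    have j2: "2 \<le> j \<or> (j = 1 \<and> R = 2)"
    proof (cases j)
      case (Suc i)
      then show ?thesis using j False h(1) by (cases i) auto
    qed (use j False h in auto)
    have ex: "\<exists>n. 2 ^ (n + 1) \<le> R \<and> R \<le> 2 * 2 ^ (n + 1)"
    proof (cases "j = 1 \<and> R = 2")
      case True
      then show ?thesis by (intro exI[of _ 0]) auto
    next
      case False
      then obtain n where "j = Suc (Suc n)" using j2 by (metis One_nat_def Suc_1 Suc_le_D not_less_eq_eq old.nat.exhaust le0)
      with j show ?thesis by (intro exI[of _ n]) auto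
    qed
    then obtain n where n: "2 ^ (n + 1) \<le> R" "R \<le> 2 * 2 ^ (n + 1)" by blast
    have sub: "oball x (2 ^ (n + 1)) \<subseteq> oball x R" by (rule oball_mono[OF n(1)])
    have "u x \<le> 2 * (\<Lambda> * K)"
    proof (rule mean_value_dyadic[OF t _ h(3) _ \<epsilon>_def])
      show "0 < \<Lambda> * K" using h \<Lambda> by simp
      have "real (2 ^ (n + 1)) \<le> real R" using n(1) by (rule of_nat_mono)
      then have "M * (2 ^ (n + 1))\<^sup>2 \<le> M * (real R)\<^sup>2" using h(3) by (intro mult_left_mono power_mono) auto
      also have "\<dots> \<le> 1 * K" using h by simp
      also have "\<dots> \<le> \<Lambda> * K" using \<Lambda> h by (intro mult_right_mono) auto
      finally show "M * (2 ^ (n + 1))\<^sup>2 \<le> \<Lambda> * K" .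
      show "lap u y \<le> M * m y" if "y \<in> oball x (2 ^ (n + 1))" for y using h(5) that sub by blast
      have "(\<Sum>y\<in>oball x (2 ^ (n + 1)). (u y)\<^sup>2 * m y) \<le> (\<Sum>y\<in>oball x R. (u y)\<^sup>2 * m y)"
        using sub by (intro sum_mono2) auto
      also have "\<dots> \<le> K\<^sup>2 * vol x R" by (rule h)
      also have "\<dots> \<le> K\<^sup>2 * vol x (2 * 2 ^ (n + 1))" using n by (intro mult_left_mono vol_mono) auto
      also have "\<dots> \<le> K\<^sup>2 * (2 ^ p * vol x (2 ^ (n + 1)))" by (intro mult_left_mono doubling) auto
      also have "\<dots> \<le> K\<^sup>2 * (\<epsilon> * \<Lambda>\<^sup>2 * vol x (2 ^ (n + 1)))"
        using \<Lambda>2 by (intro mult_left_mono mult_right_mono) auto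
      finally show "(\<Sum>y\<in>oball x (2 ^ (n + 1)). (u y)\<^sup>2 * m y) \<le> \<epsilon> * (\<Lambda> * K)\<^sup>2 * vol x (2 ^ (n + 1))"
        by (simp add: power_mult_distrib mult_ac)
    qed
    then show ?thesis by simp
  qed
  then show ?thesis using \<Lambda> by (intro exI[of _ "2 * \<Lambda>"]) auto
qed

text \<open>For \<open>M = 0\<close> the lower constraint \<open>M * R\<^sup>2 \<le> K\<close>
  disappears, so \<open>K\<close> can be the \<open>L2\<close> average itself, which is positive as
  soon as \<open>u x\<close> is.\<close>

lemma mean_value_subharmonic_L2:
  "\<exists>C>0. \<forall>u x R. 0 < R \<longrightarrow> (\<forall>y. 0 \<le> u y) \<longrightarrow> (\<forall>y\<in>oball x R. lap u y \<le> 0) \<longrightarrow>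
     (u x)\<^sup>2 * vol x R \<le> C * (\<Sum>y\<in>oball x R. (u y)\<^sup>2 * m y)"
proof -
  obtain C where C: "0 < C" and mv0: "\<forall>u x R M K. 0 < R \<longrightarrow> 0 < K \<longrightarrow> 0 \<le> M \<longrightarrow> M * (real R)\<^sup>2 \<le> K \<longrightarrow>
     (\<forall>y\<in>oball x R. lap u y \<le> M * m y) \<longrightarrow>
     (\<Sum>y\<in>oball x R. (u y)\<^sup>2 * m y) \<le> K\<^sup>2 * vol x R \<longrightarrow> u x \<le> C * K"
    using mean_value_L2 by blast
  have mv: "u x \<le> C * K" if "0 < R" "0 < K" "\<forall>y\<in>oball x R. lap u y \<le> 0"
     "(\<Sum>y\<in>oball x R. (u y)\<^sup>2 * m y) \<le> K\<^sup>2 * vol x R" for u x R K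
    using mv0[THEN spec, of u, THEN spec, of x, THEN spec, of R, THEN spec, of 0, THEN spec, of K] that
    by simp
  have "(u x)\<^sup>2 * vol x R \<le> C\<^sup>2 * (\<Sum>y\<in>oball x R. (u y)\<^sup>2 * m y)"
    if h: "0 < R" "\<forall>y. 0 \<le> u y" "\<forall>y\<in>oball x R. lap u y \<le> 0" for u x R
  proof -
    define S where "S = (\<Sum>y\<in>oball x R. (u y)\<^sup>2 * m y)"
    have V: "0 < vol x R" using h by (intro vol_pos)
    have uS: "(u x)\<^sup>2 * m x \<le> S" unfolding S_def
      using h by (intro member_le_sum[of _ _ "\<lambda>y. (u y)\<^sup>2 * m y"]) auto
    show ?thesis
    proof (cases "u x = 0")
      case True
      then show ?thesis by (simp add: sum_nonneg)
    next
      case False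
      then have "0 < (u x)\<^sup>2 * m x" using m_pos[of x] by simp
      then have S: "0 < S" using uS by linarith
      define K where "K = sqrt (S / vol x R)"
      have K: "0 < K" "K\<^sup>2 * vol x R = S" using S V by (auto simp: K_def)
      have "u x \<le> C * K" using h K by (intro mv[of R K x u]) (auto simp: S_def)
      then have "(u x)\<^sup>2 \<le> (C * K)\<^sup>2" using h by (intro power_mono) auto
      then have "(u x)\<^sup>2 * vol x R \<le> (C * K)\<^sup>2 * vol x R" by (rule mult_right_mono) simp
      also have "\<dots> = C\<^sup>2 * S" by (simp add: power_mult_distrib mult.assoc K(2))
      finally show ?thesis by (simp add: S_def)
    qed
  qed
  then show ?thesis using C by (intro exI[of _ "C\<^sup>2"]) auto
qed

text \<open>
  To pass from \<open>L\<^sup>2\<close> to \<open>L\<^sup>1\<close>, apply the \<open>L\<^sup>2\<close> inequality at a maximum point of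
  \<open>(R - d x y) ^ p * u y\<close>; this weight makes \<open>u\<close> comparable to its value there on a ball of
  proportional radius and absorbs the volume ratio.
\<close>

lemma mean_value_subharmonic_L1:
  "\<exists>C>0. \<forall>u x R. 0 < R \<longrightarrow> (\<forall>y. 0 \<le> u y) \<longrightarrow> (\<forall>y\<in>oball x R. lap u y \<le> 0) \<longrightarrow>
     u x * vol x R \<le> C * (\<Sum>y\<in>oball x R. u y * m y)"
proof -
  obtain C where C: "0 < C" and mv0: "\<forall>u x R. 0 < R \<longrightarrow> (\<forall>y. 0 \<le> u y) \<longrightarrow> (\<forall>y\<in>oball x R. lap u y \<le> 0) \<longrightarrow>
     (u x)\<^sup>2 * vol x R \<le> C * (\<Sum>y\<in>oball x R. (u y)\<^sup>2 * m y)"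
    using mean_value_subharmonic_L2 by blast
  have mv: "(u x)\<^sup>2 * vol x R \<le> C * (\<Sum>y\<in>oball x R. (u y)\<^sup>2 * m y)"
    if "0 < R" "\<forall>y. 0 \<le> u y" "\<forall>y\<in>oball x R. lap u y \<le> 0" for u x R
    using mv0 that by blast
  have "u x * vol x R \<le> (16 ^ p * C) * (\<Sum>y\<in>oball x R. u y * m y)"
    if h: "0 < R" "\<And>y. 0 \<le> u y" "\<forall>y\<in>oball x R. lap u y \<le> 0" for u x R
  proof -
    define S where "S = (\<Sum>y\<in>oball x R. u y * m y)"
    have S0: "0 \<le> S" unfolding S_def using h by (intro sum_nonneg) auto
    define F where "F y = real (R - d x y) ^ p * u y" for y
    define Q where "Q = Max (F ` oball x R)"
    have "x \<in> oball x R" using h by simp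
    then have ne: "F ` oball x R \<noteq> {}" by blast
    have FQ: "F y \<le> Q" if "y \<in> oball x R" for y
      unfolding Q_def using that by (intro Max_ge) auto
    have "Q \<in> F ` oball x R" unfolding Q_def using ne by (intro Max_in) auto
    then obtain y0 where y0: "y0 \<in> oball x R" "Q = F y0" by blast
    define t where "t = R - d x y0"
    \<comment> \<open>Rounded up, so positive; points of \<open>oball y0 s\<close> are at distance
      at most \<open>s - 1\<close> from \<open>y0\<close>, so \<open>R - d x y\<close> is still at
      least \<open>t / 2\<close> there.\<close>
    define s where "s = (t + 1) div 2"
    have t: "0 < t" "t \<le> R" using y0 by (auto simp: t_def)
    have s: "0 < s" "s \<le> t" "t \<le> 2 * s" "2 * s \<le> t + 1" using t by (auto simp: s_def)
    have Q0: "0 \<le> Q" using y0(2) h(2) by (simp add: F_def)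
    have inc: "oball y0 s \<subseteq> oball x R" using s y0 by (intro oball_shift) (simp add: t_def)
    have uy: "u y * real t ^ p \<le> Q * 2 ^ p" if y: "y \<in> oball y0 s" for y
    proof -
      have "t \<le> 2 * (R - d x y)" using dist_triangle[of x y y0] y s y0 by (simp add: t_def)
      then have "real t \<le> real (2 * (R - d x y))" by (rule of_nat_mono)
      then have "real t ^ p \<le> (2 * real (R - d x y)) ^ p" by (intro power_mono) auto
      then have "u y * real t ^ p \<le> u y * (2 * real (R - d x y)) ^ p" using h(2) by (rule mult_left_mono)
      also have "\<dots> = F y * 2 ^ p" by (simp add: F_def power_mult_distrib)
      also have "\<dots> \<le> Q * 2 ^ p" using FQ inc y by (intro mult_right_mono) auto
      finally show ?thesis .
    qed
    have "(u y0)\<^sup>2 * vol y0 s \<le> C * (\<Sum>y\<in>oball y0 s. (u y)\<^sup>2 * m y)"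
      using h inc by (intro mv s) auto
    then have "(u y0)\<^sup>2 * vol y0 s * real t ^ p \<le> C * (\<Sum>y\<in>oball y0 s. (u y)\<^sup>2 * m y) * real t ^ p"
      by (rule mult_right_mono) simp
    also have "\<dots> = C * (\<Sum>y\<in>oball y0 s. (u y * real t ^ p) * (u y * m y))"
      by (simp add: sum_distrib_left sum_distrib_right power2_eq_square mult_ac)
    also have "\<dots> \<le> C * (\<Sum>y\<in>oball y0 s. (Q * 2 ^ p) * (u y * m y))"
      using C h(2) by (intro mult_left_mono sum_mono mult_right_mono uy) auto
    also have "\<dots> = C * Q * 2 ^ p * (\<Sum>y\<in>oball y0 s. u y * m y)"
      by (simp add: sum_distrib_left mult_ac)
    also have "\<dots> \<le> C * Q * 2 ^ p * S"
      unfolding S_def using C Q0 inc h(2) by (intro mult_left_mono sum_mono2) auto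
    finally have 1: "(u y0)\<^sup>2 * vol y0 s * real t ^ p \<le> C * Q * 2 ^ p * S" .
    have "vol x R \<le> vol y0 (2 * R)"
      using y0 dist_sym[of x y0] by (intro mass_mono oball_shift) auto
    also have "\<dots> \<le> (2 * real (2 * R) / real s) ^ p * vol y0 s"
      using s t by (intro vol_poly) auto
    also have "\<dots> \<le> (8 * real R / real t) ^ p * vol y0 s"
    proof (intro mult_right_mono power_mono)
      have "real t \<le> real (2 * s)" using s by (intro of_nat_mono)
      then have "4 * real R * real t \<le> 4 * real R * (2 * real s)" by (intro mult_left_mono) auto
      then show "2 * real (2 * R) / real s \<le> 8 * real R / real t" using s t by (simp add: field_simps)
    qed auto
    finally have "vol x R * real t ^ p \<le> 8 ^ p * real R ^ p * vol y0 s"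
      using t by (simp add: power_divide power_mult_distrib field_simps)
    then have "(vol x R * real t ^ p) * ((u y0)\<^sup>2 * real t ^ p) \<le> (8 ^ p * real R ^ p * vol y0 s) * ((u y0)\<^sup>2 * real t ^ p)"
      by (rule mult_right_mono) simp
    also have "\<dots> = (8 ^ p * real R ^ p) * ((u y0)\<^sup>2 * vol y0 s * real t ^ p)" by simp
    also have "\<dots> \<le> (8 ^ p * real R ^ p) * (C * Q * 2 ^ p * S)" using 1 by (rule mult_left_mono) simp
    also have "\<dots> = Q * (16 ^ p * C * real R ^ p * S)"
    proof -
      have "(16::real) ^ p = 8 ^ p * 2 ^ p" by (simp flip: power_mult_distrib)
      then show ?thesis by simp
    qed
    also have "(vol x R * real t ^ p) * ((u y0)\<^sup>2 * real t ^ p) = Q * (Q * vol x R)"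
      unfolding y0(2) F_def t_def by (simp add: power2_eq_square)
    finally have 2: "Q * (Q * vol x R) \<le> Q * (16 ^ p * C * real R ^ p * S)" .
    have 3: "Q * vol x R \<le> 16 ^ p * C * real R ^ p * S"
    proof (cases "Q = 0")
      case False
      with Q0 2 show ?thesis by simp
    qed (use C S0 in simp)
    have "real R ^ p * u x * vol x R \<le> Q * vol x R"
      using FQ[of x] h by (intro mult_right_mono) (auto simp: F_def)
    with 3 have "real R ^ p * (u x * vol x R) \<le> real R ^ p * (16 ^ p * C * S)" by (simp add: mult_ac)
    then show ?thesis using h(1) by (simp add: S_def)
  qed
  then show ?thesis using C by (intro exI[of _ "16 ^ p * C"]) auto
qed

end

section \<open>The growth lemma and the Dirichlet problem\<close>

lemma log_increment_bound:
  fixes a b P Q :: real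
  assumes "0 < a" "0 < b" "0 \<le> P" "0 \<le> Q"
  shows "1/8 * (min P Q)\<^sup>2 * (ln a - ln b)\<^sup>2 \<le> 2 * (P - Q)\<^sup>2 - (P\<^sup>2 / a - Q\<^sup>2 / b) * (a - b)"
proof -
  have sq2: "(X - Y)\<^sup>2 \<le> 2 * X\<^sup>2 + 2 * Y\<^sup>2" for X Y :: real
    using zero_le_power2[of "X + Y"] by (simp add: power2_eq_square algebra_simps)
  have main: "1/8 * (min P Q)\<^sup>2 * (ln a - ln b)\<^sup>2 \<le> 2 * (P - Q)\<^sup>2 - (P\<^sup>2 / a - Q\<^sup>2 / b) * (a - b)"
    if ab: "0 < a" "a \<le> b" and PQ: "0 \<le> P" "0 \<le> Q" for a b P Q :: real
  proof -
    \<comment> \<open>With \<open>s\<^sup>2 = b / a\<close> the product on the right equals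
      \<open>(P - Q)\<^sup>2 - (s * P - Q / s)\<^sup>2\<close>, while
      \<open>ln s \<le> s - 1\<close> bounds the difference of logarithms by
      \<open>2 * (s - 1 / s)\<close>; this stands in for the chain rule in Moser's estimate.\<close>
    define s where "s = sqrt (b / a)"
    have s1: "1 \<le> s" using ab by (simp add: s_def)
    have s2: "s\<^sup>2 = b / a" using ab by (simp add: s_def)
    have b: "b = s\<^sup>2 * a" using s2 ab by simp
    have lns: "ln b - ln a = 2 * ln s"
      using ab s1 unfolding b by (simp add: ln_mult ln_realpow)
    have "ln s \<le> s - 1" using s1 by (intro ln_le_minus_one) simp
    also have "s - 1 \<le> s - 1 / s" using s1 by (simp add: field_simps)
    finally have "2 * ln s \<le> 2 * (s - 1 / s)" by simp
    then have "(ln b - ln a)\<^sup>2 \<le> (2 * (s - 1 / s))\<^sup>2"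
      unfolding lns using s1 by (intro power_mono) auto
    also have "(2 * (s - 1 / s))\<^sup>2 = 4 * (s - 1 / s)\<^sup>2" by (simp only: power_mult_distrib) simp
    finally have L: "(ln a - ln b)\<^sup>2 \<le> 4 * (s - 1 / s)\<^sup>2"
      by (simp only: power2_commute[of "ln a"])
    have e: "(P\<^sup>2 / a - Q\<^sup>2 / b) * (a - b) = (P - Q)\<^sup>2 - (s * P - Q / s)\<^sup>2"
      unfolding b using ab s1 by (simp add: field_simps power2_eq_square)
    have "s * P - Q / s = (s - 1 / s) * P + (P - Q) / s" using s1 by (simp add: field_simps)
    then have "(s - 1 / s) * P = (s * P - Q / s) + - ((P - Q) / s)" by simp
    then have "((s - 1 / s) * P)\<^sup>2 = ((s * P - Q / s) + - ((P - Q) / s))\<^sup>2" by simp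
    also have "\<dots> \<le> 2 * (s * P - Q / s)\<^sup>2 + 2 * ((P - Q) / s)\<^sup>2"
      using sq2[of "s * P - Q / s" "(P - Q) / s"] by simp
    also have "((P - Q) / s)\<^sup>2 \<le> (P - Q)\<^sup>2"
    proof -
      have "1 \<le> s\<^sup>2" using s1 by simp
      then have "(P - Q)\<^sup>2 * 1 \<le> (P - Q)\<^sup>2 * s\<^sup>2" by (intro mult_left_mono) auto
      then show ?thesis using s1 by (simp add: power_divide field_simps)
    qed
    finally have 1: "(s - 1 / s)\<^sup>2 * P\<^sup>2 \<le> 2 * (s * P - Q / s)\<^sup>2 + 2 * (P - Q)\<^sup>2"
      by (simp add: power_mult_distrib)
    have "1/8 * (min P Q)\<^sup>2 * (ln a - ln b)\<^sup>2 \<le> 1/8 * P\<^sup>2 * (4 * (s - 1 / s)\<^sup>2)"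
      using L PQ by (intro mult_mono power_mono) auto
    also have "\<dots> = 1/2 * ((s - 1 / s)\<^sup>2 * P\<^sup>2)" by simp
    finally show ?thesis unfolding e using 1 by linarith
  qed
  show ?thesis
  proof (cases "a \<le> b")
    case True
    with assms show ?thesis by (intro main)
  next
    case False
    with assms have "1/8 * (min Q P)\<^sup>2 * (ln b - ln a)\<^sup>2 \<le> 2 * (Q - P)\<^sup>2 - (Q\<^sup>2 / b - P\<^sup>2 / a) * (b - a)"
      by (intro main) auto
    moreover have "(Q\<^sup>2 / b - P\<^sup>2 / a) * (b - a) = (P\<^sup>2 / a - Q\<^sup>2 / b) * (a - b)" by algebra
    ultimately show ?thesis
      by (simp add: power2_commute[of "ln b"] power2_commute[of Q] min.commute[of Q])
  qed
qed

context weighted_graph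
begin

text \<open>Moser's logarithmic estimate: \<open>h\<close> is tested with
  \<open>\<phi>\<^sup>2 / h\<close>. The bound does not depend on the size of \<open>h\<close>,
  which is why the constant of the growth lemma is independent of \<open>h\<close>.\<close>

lemma log_energy:
  assumes r: "0 < r" and h: "\<And>y. 0 < h y" "\<And>y. y \<in> oball x (8 * r) \<Longrightarrow> 0 \<le> lap h y"
  shows "energy (oball x (4 * r)) (\<lambda>y. ln (h y)) \<le> 2 / (real r)\<^sup>2 * vol x (8 * r)"
proof -
  define D where "D = oball x (8 * r)"
  define \<phi> where "\<phi> = cutoff x (4 * r) (7 * r)"
  define f where "f y = (\<phi> y)\<^sup>2 / h y" for y
  have finD: "finite D" by (simp add: D_def)
  have \<phi>0: "0 \<le> \<phi> y" for y by (simp add: \<phi>_def cutoff_range)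
  have supp: "supp_inside D \<phi>" unfolding D_def \<phi>_def using r by (intro cutoff_supp) auto
  then have suppf: "supp_inside D f" by (auto simp: supp_inside_def f_def)
  have "0 \<le> (\<Sum>y\<in>D. f y * lap h y)"
    using h by (intro sum_nonneg mult_nonneg_nonneg) (auto simp: D_def f_def less_imp_le)
  then have pos: "0 \<le> (\<Sum>y\<in>D. \<Sum>z\<in>D. \<mu> y z * ((f y - f z) * (h y - h z)))"
    using green_identity[OF finD suppf, of h] by simp
  have "energy (oball x (4 * r)) (\<lambda>y. ln (h y))
      = (\<Sum>y\<in>oball x (4 * r). \<Sum>z\<in>oball x (4 * r). 8 * (\<mu> y z * (1/8 * (min (\<phi> y) (\<phi> z))\<^sup>2 * (ln (h y) - ln (h z))\<^sup>2)))"
    unfolding energy_def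
  proof (intro sum.cong refl)
    fix y z assume "y \<in> oball x (4 * r)" "z \<in> oball x (4 * r)"
    then have "\<phi> y = 1" "\<phi> z = 1" unfolding \<phi>_def using r by (auto intro!: cutoff_eq_1)
    then show "\<mu> y z * (ln (h y) - ln (h z))\<^sup>2 =
      8 * (\<mu> y z * (1/8 * (min (\<phi> y) (\<phi> z))\<^sup>2 * (ln (h y) - ln (h z))\<^sup>2))" by simp
  qed
  also have "\<dots> \<le> (\<Sum>y\<in>oball x (4 * r). \<Sum>z\<in>D. 8 * (\<mu> y z * (1/8 * (min (\<phi> y) (\<phi> z))\<^sup>2 * (ln (h y) - ln (h z))\<^sup>2)))"
    unfolding D_def by (intro sum_mono sum_mono2) (auto simp: weight_nonneg)
  also have "\<dots> \<le> (\<Sum>y\<in>D. \<Sum>z\<in>D. 8 * (\<mu> y z * (1/8 * (min (\<phi> y) (\<phi> z))\<^sup>2 * (ln (h y) - ln (h z))\<^sup>2)))"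
    unfolding D_def by (intro sum_mono2) (auto simp: weight_nonneg intro!: sum_nonneg)
  also have "\<dots> \<le> (\<Sum>y\<in>D. \<Sum>z\<in>D. 8 * (\<mu> y z * (2 * (\<phi> y - \<phi> z)\<^sup>2 - (f y - f z) * (h y - h z))))"
    unfolding f_def using h \<phi>0
    by (intro sum_mono mult_left_mono log_increment_bound weight_nonneg) auto
  also have "\<dots> = 16 * (\<Sum>y\<in>D. \<Sum>z\<in>D. \<mu> y z * (1 * 1 * (\<phi> y - \<phi> z)\<^sup>2))
      - 8 * (\<Sum>y\<in>D. \<Sum>z\<in>D. \<mu> y z * ((f y - f z) * (h y - h z)))"
    unfolding sum_distrib_left sum_subtractf[symmetric] by (intro sum.cong refl) (simp add: algebra_simps)
  also have "\<dots> \<le> 16 * (\<Sum>y\<in>D. \<Sum>z\<in>D. \<mu> y z * (1 * 1 * (\<phi> y - \<phi> z)\<^sup>2))" using pos by simp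
  also have "\<dots> \<le> 16 * (1 / (real (7 * r) - real (4 * r))\<^sup>2 * (\<Sum>y\<in>D. 1\<^sup>2 * m y))"
  proof (intro mult_left_mono double_sum_sq_le[OF finD])
    fix y z assume "(y, z) \<in> E"
    then show "(\<phi> y - \<phi> z)\<^sup>2 \<le> 1 / (real (7 * r) - real (4 * r))\<^sup>2"
      unfolding \<phi>_def using r by (intro cutoff_lipschitz) auto
  qed auto
  also have "(real (7 * r) - real (4 * r))\<^sup>2 = 9 * (real r)\<^sup>2" by (simp add: power2_eq_square)
  also have "16 * (1 / (9 * (real r)\<^sup>2) * (\<Sum>y\<in>D. 1\<^sup>2 * m y)) \<le> 2 / (real r)\<^sup>2 * vol x (8 * r)"
  proof -
    have "16 * (1 / (9 * (real r)\<^sup>2) * (\<Sum>y\<in>D. 1\<^sup>2 * m y)) = 16 / 9 * (vol x (8 * r) / (real r)\<^sup>2)"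
      by (simp add: D_def mass_def)
    moreover have "2 / (real r)\<^sup>2 * vol x (8 * r) = 2 * (vol x (8 * r) / (real r)\<^sup>2)" by simp
    moreover have "0 \<le> vol x (8 * r) / (real r)\<^sup>2" by simp
    ultimately show ?thesis by linarith
  qed
  finally show ?thesis .
qed

text \<open>A convex decreasing function of a superharmonic one is subharmonic; for
  \<open>- ln\<close> this is \<open>ln t \<le> t - 1\<close>. Where \<open>h x \<ge> 1\<close> the
  truncated function has its minimum 0.\<close>

lemma lap_neg_log_le:
  assumes "\<And>y. 0 < h y" "0 \<le> lap h x"
  shows "lap (\<lambda>y. max 0 (- ln (h y))) x \<le> 0"
proof (cases "0 \<le> ln (h x)")
  case True
  then show ?thesis unfolding lap_def by (intro sum_nonpos mult_nonneg_nonpos weight_nonneg) auto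
next
  case False
  have "lap (\<lambda>y. max 0 (- ln (h y))) x \<le> (\<Sum>y\<in>nb x. \<mu> x y * ((h y - h x) / h x))"
    unfolding lap_def
  proof (intro sum_mono mult_left_mono weight_nonneg)
    fix y
    have "ln (h y / h x) \<le> h y / h x - 1" using assms(1) by (intro ln_le_minus_one) simp
    then have "ln (h y) - ln (h x) \<le> (h y - h x) / h x"
      using assms(1)[of x] assms(1)[of y] by (simp add: ln_div diff_divide_distrib)
    then show "max 0 (- ln (h x)) - max 0 (- ln (h y)) \<le> (h y - h x) / h x"
      using False by simp
  qed
  also have "\<dots> = - lap h x / h x"
    unfolding lap_def sum_negf[symmetric] sum_divide_distrib
    by (intro sum.cong refl) (simp add: algebra_simps)
  also have "\<dots> \<le> 0" using assms(1)[of x] assms(2) by simp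
  finally show ?thesis .
qed

text \<open>Partial sums of the Green operator of the walk killed outside \<open>B\<close>: the
  \<open>n\<close>-th iterate sums the first \<open>n\<close> powers (from the zeroth) of the killed
  transition operator applied to \<open>f\<close>, a density with respect to \<open>m\<close>. For
  \<open>B = UNIV\<close> and a pole the same recursion produces the partial sums of
  \<open>green\<close>.\<close>

primrec dirichlet_iter :: "'a set \<Rightarrow> ('a \<Rightarrow> real) \<Rightarrow> nat \<Rightarrow> 'a \<Rightarrow> real" where
  "dirichlet_iter B f 0 x = 0"
| "dirichlet_iter B f (Suc n) x =
    (if x \<in> B then f x + (\<Sum>z\<in>nb x. \<mu> x z * dirichlet_iter B f n z) / m x else 0)"

text \<open>Used for balls, where \<open>dirichlet_iter_tendsto\<close> shows convergence; on the
  whole graph the iterates may diverge.\<close>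

definition dirichlet_sol :: "'a set \<Rightarrow> ('a \<Rightarrow> real) \<Rightarrow> 'a \<Rightarrow> real" where
  "dirichlet_sol B f x = lim (\<lambda>n. dirichlet_iter B f n x)"

lemma lap_diag: "lap u x = m x * u x - (\<Sum>y\<in>nb x. \<mu> x y * u y)"
  by (simp add: lap_def vertex_weight_def right_diff_distrib sum_subtractf sum_distrib_right)

lemma dirichlet_iter_nonneg:
  assumes "\<And>x. 0 \<le> f x"
  shows "0 \<le> dirichlet_iter B f n x"
  by (induction n arbitrary: x) (auto intro!: add_nonneg_nonneg divide_nonneg_nonneg sum_nonneg
      mult_nonneg_nonneg weight_nonneg assms)

lemma dirichlet_iter_outside: "x \<notin> B \<Longrightarrow> dirichlet_iter B f n x = 0"
  by (cases n) auto

lemma dirichlet_iter_Suc_mono: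
  assumes "\<And>x. 0 \<le> f x"
  shows "dirichlet_iter B f n x \<le> dirichlet_iter B f (Suc n) x"
proof (induction n arbitrary: x)
  case 0
  then show ?case using assms by simp
next
  case (Suc n)
  then show ?case
    by (auto simp del: dirichlet_iter.simps(2) simp: dirichlet_iter.simps(2)[of B f n] dirichlet_iter.simps(2)[of B f "Suc n"]
        intro!: divide_right_mono sum_mono mult_left_mono weight_nonneg)
qed

lemma dirichlet_iter_mono:
  assumes "\<And>x. 0 \<le> f x" "A \<subseteq> B"
  shows "dirichlet_iter A f n x \<le> dirichlet_iter B f n x"
proof (induction n arbitrary: x)
  case (Suc n)
  have "0 \<le> dirichlet_iter B f (Suc n) x" by (intro dirichlet_iter_nonneg assms)
  with Suc assms(2) show ?case
    by (auto intro!: divide_right_mono sum_mono mult_left_mono weight_nonneg)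
qed simp

lemma lap_dirichlet_iter_le:
  assumes "\<And>x. 0 \<le> f x" "x \<in> B"
  shows "lap (dirichlet_iter B f n) x \<le> f x * m x"
proof -
  have "m x * dirichlet_iter B f n x \<le> m x * dirichlet_iter B f (Suc n) x"
    by (intro mult_left_mono dirichlet_iter_Suc_mono assms) simp
  also have "\<dots> = m x * f x + (\<Sum>z\<in>nb x. \<mu> x z * dirichlet_iter B f n z)"
    using assms(2) m_pos[of x] by (simp add: algebra_simps)
  finally show ?thesis by (simp add: lap_diag mult.commute)
qed

lemma lap_outside_le:
  assumes "\<And>y. 0 \<le> u y" "u x = 0"
  shows "lap u x \<le> 0"
  unfolding lap_def using assms by (intro sum_nonpos mult_nonneg_nonpos weight_nonneg) auto

end

context vd_pi_graph
begin

text \<open>The negative part \<open>w\<close> of the logarithm vanishes where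
  \<open>h \<ge> 1\<close>, a fixed proportion of the ball, so its \<open>L2\<close> average is at
  most a constant; being subharmonic it is then bounded at every point, by \<open>sqrt W\<close>,
  and \<open>c = exp (- sqrt W)\<close>.\<close>

lemma growth_lemma:
  assumes \<epsilon>: "0 < \<epsilon>" "\<epsilon> \<le> 1"
  shows "\<exists>c>0. \<forall>h x r. 0 < r \<longrightarrow> (\<forall>y. 0 \<le> h y) \<longrightarrow> (\<forall>y\<in>oball x (8 * r). 0 \<le> lap h y) \<longrightarrow>
    \<epsilon> * vol x r \<le> mass {y\<in>oball x r. 1 \<le> h y} \<longrightarrow> (\<forall>z\<in>oball x r. c \<le> h z)"
proof -
  obtain C where C: "0 < C" and mv0: "\<forall>u x R. 0 < R \<longrightarrow> (\<forall>y. 0 \<le> u y) \<longrightarrow> (\<forall>y\<in>oball x R. lap u y \<le> 0) \<longrightarrow>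
     (u x)\<^sup>2 * vol x R \<le> C * (\<Sum>y\<in>oball x R. (u y)\<^sup>2 * m y)"
    using mean_value_subharmonic_L2 by blast
  define W where "W = C * (4 / (\<epsilon> / 2 ^ p) * cP * 8 * (2 ^ p) ^ 4)"
  have W: "0 \<le> W" using C \<epsilon> cP_pos by (simp add: W_def)
  have "exp (- sqrt W) \<le> h z"
    if r: "0 < r" and h': "\<forall>y. 0 \<le> h y" "\<forall>y\<in>oball x (8 * r). 0 \<le> lap h y"
      and big: "\<epsilon> * vol x r \<le> mass {y\<in>oball x r. 1 \<le> h y}" and z: "z \<in> oball x r" for h x r z
  proof (rule field_le_epsilon)
    fix \<delta> :: real assume \<delta>: "0 < \<delta>"
    note h = h'[rule_format]
    \<comment> \<open>\<open>h\<close> may vanish; the shift keeps the logarithm meaningful and is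
      removed by \<open>field_le_epsilon\<close>.\<close>
    define g where "g y = h y + \<delta>" for y
    define w where "w y = max 0 (- ln (g y))" for y
    define A where "A = {y\<in>oball x r. 1 \<le> h y}"
    have g0: "0 < g y" for y using h(1)[of y] \<delta> by (simp add: g_def)
    have gl: "lap g y = lap h y" for y by (simp add: lap_def g_def)
    have Aw: "w y = 0" if "y \<in> A" for y using that \<delta> by (simp add: A_def w_def g_def)
    have lw: "lap w y \<le> 0" if "y \<in> oball x (8 * r)" for y
      unfolding w_def using h(2)[OF that] g0 by (intro lap_neg_log_le) (auto simp: gl)
    have "energy (oball x (4 * r)) w \<le> energy (oball x (4 * r)) (\<lambda>y. ln (g y))"
      unfolding energy_def
    proof (intro sum_mono mult_left_mono weight_nonneg)
      fix a b
      have "\<bar>w a - w b\<bar> \<le> \<bar>ln (g a) - ln (g b)\<bar>" unfolding w_def by linarith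
      then show "(w a - w b)\<^sup>2 \<le> (ln (g a) - ln (g b))\<^sup>2" by (simp add: abs_le_square_iff)
    qed
    also have "\<dots> \<le> 2 / (real r)\<^sup>2 * vol x (8 * r)"
      using r g0 h(2) by (intro log_energy) (auto simp: gl)
    finally have en: "energy (oball x (4 * r)) w \<le> 2 / (real r)\<^sup>2 * vol x (8 * r)" .
    have "(\<Sum>y\<in>oball z r. (w y)\<^sup>2 * m y) \<le> (\<Sum>y\<in>oball x (2 * r). (w y)\<^sup>2 * m y)"
      using z by (intro sum_mono2 oball_shift) auto
    also have "\<dots> \<le> 4 / (\<epsilon> / 2 ^ p) * cP * (real (2 * r))\<^sup>2 * energy (oball x (2 * (2 * r))) w"
    \<comment> \<open>Radius \<open>2 * r\<close>, so that the balls of radius \<open>r\<close>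
      around all \<open>z\<close> in \<open>oball x r\<close> are included; the guaranteed
      proportion of \<open>A\<close> drops to \<open>\<epsilon> / 2 ^ p\<close>.\<close>
    proof (rule poincare_vanishing[of "2 * r" A])
      have "\<epsilon> / 2 ^ p * vol x (2 * r) \<le> \<epsilon> / 2 ^ p * (2 ^ p * vol x r)"
        using \<epsilon> r by (intro mult_left_mono doubling) auto
      also have "\<dots> \<le> mass A" using big by (simp add: A_def)
      finally show "\<epsilon> / 2 ^ p * vol x (2 * r) \<le> mass A" .
      have "\<epsilon> \<le> 2 ^ p" using \<epsilon> one_le_power[of "2::real" p] by linarith
      then show "\<epsilon> / 2 ^ p \<le> 1" by simp
    qed (use r \<epsilon> Aw in \<open>auto simp: A_def\<close>)
    also have "\<dots> \<le> 4 / (\<epsilon> / 2 ^ p) * cP * (real (2 * r))\<^sup>2 * (2 / (real r)\<^sup>2 * vol x (8 * r))"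
      using en \<epsilon> cP_pos by (intro mult_left_mono) auto
    also have "\<dots> = 4 / (\<epsilon> / 2 ^ p) * cP * 8 * vol x (8 * r)"
      using r by (simp add: power2_eq_square)
    also have "\<dots> \<le> 4 / (\<epsilon> / 2 ^ p) * cP * 8 * ((2 ^ p) ^ 4 * vol z r)"
      using \<epsilon> cP_pos r z dist_sym[of x z] by (intro mult_left_mono vol_shift) auto
    finally have S: "(\<Sum>y\<in>oball z r. (w y)\<^sup>2 * m y) \<le> 4 / (\<epsilon> / 2 ^ p) * cP * 8 * ((2 ^ p) ^ 4 * vol z r)" .
    have inc: "oball z r \<subseteq> oball x (8 * r)" using z by (intro oball_shift) simp
    have "(w z)\<^sup>2 * vol z r \<le> C * (\<Sum>y\<in>oball z r. (w y)\<^sup>2 * m y)"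
    proof (rule mv0[rule_format])
      show "lap w y \<le> 0" if "y \<in> oball z r" for y using that inc by (intro lw) auto
    qed (use r in \<open>auto simp: w_def\<close>)
    also have "\<dots> \<le> C * (4 / (\<epsilon> / 2 ^ p) * cP * 8 * ((2 ^ p) ^ 4 * vol z r))"
      using S C by (intro mult_left_mono) auto
    also have "\<dots> = W * vol z r" by (simp add: W_def)
    finally have "(w z)\<^sup>2 \<le> W" using vol_pos[OF r, of z] by simp
    then have "w z \<le> sqrt W" by (rule real_le_rsqrt)
    then have "- sqrt W \<le> ln (g z)" by (simp add: w_def)
    then have "exp (- sqrt W) \<le> g z" using g0[of z] by (simp add: ln_ge_iff)
    then show "exp (- sqrt W) \<le> h z + \<delta>" by (simp add: g_def)
  qed
  then show ?thesis by (intro exI[of _ "exp (- sqrt W)"] conjI allI impI ballI) simp_all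
qed

text \<open>From \<open>dirichlet_poincare\<close>: a factor 4 of \<open>poincare_vanishing\<close>,
  \<open>4\<^sup>2\<close> for the radius \<open>4 * r\<close>, and \<open>8 ^ p\<close> for the
  proportion filled by the vanishing region.\<close>

definition cE :: real where "cE = 64 * 8 ^ p * cP"

lemma cE_pos: "0 < cE"
  using cP_pos by (simp add: cE_def)

text \<open>Since the graph is infinite there is a \<open>z\<close> at distance
  \<open>2 * r\<close>; \<open>oball z r\<close> avoids \<open>oball y r\<close> and fills a fixed
  proportion of \<open>oball y (4 * r)\<close>, and \<open>g\<close> vanishes there.\<close>

lemma dirichlet_poincare:
  assumes r: "0 < r" and g: "\<And>x. x \<notin> oball y r \<Longrightarrow> g x = 0"
  shows "(\<Sum>x\<in>oball y r. (g x)\<^sup>2 * m x) \<le> cE * (real r)\<^sup>2 * energy (oball y (8 * r)) g"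
proof -
  obtain z where z: "d y z = 2 * r" using ex_dist_eq by blast
  have "(\<Sum>x\<in>oball y r. (g x)\<^sup>2 * m x) \<le> (\<Sum>x\<in>oball y (4 * r). (g x)\<^sup>2 * m x)"
    by (intro sum_mono2) auto
  also have "\<dots> \<le> 4 / (1 / (2 ^ p) ^ 3) * cP * (real (4 * r))\<^sup>2 * energy (oball y (2 * (4 * r))) g"
  proof (rule poincare_vanishing[of _ "oball z r"])
    show "oball z r \<subseteq> oball y (4 * r)" using z by (intro oball_shift) simp
    show "g x = 0" if "x \<in> oball z r" for x
    proof (rule g)
      show "x \<notin> oball y r" using that z dist_triangle[of y z x] dist_sym[of x z] by simp
    qed
    have "vol y (4 * r) \<le> (2 ^ p) ^ 3 * vol z r" using r z dist_sym[of y z] by (intro vol_shift) auto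
    then show "1 / (2 ^ p) ^ 3 * vol y (4 * r) \<le> vol z r" by (simp add: field_simps)
  qed (use r in auto)
  also have "((2::real) ^ p) ^ 3 = 8 ^ p" by (simp add: power3_eq_cube flip: power_mult_distrib)
  finally show ?thesis by (simp add: cE_def power2_eq_square mult_ac)
qed

lemma supp_inside_ball:
  assumes r: "0 < r" and g: "\<And>x. x \<notin> oball y r \<Longrightarrow> g x = 0"
  shows "supp_inside (oball y (8 * r)) g"
  unfolding supp_inside_def
proof (intro allI impI)
  fix x assume "g x \<noteq> 0"
  then have x: "x \<in> oball y r" using g by blast
  then have "nb x \<subseteq> oball y (Suc r)" by (rule nb_oball)
  also have "\<dots> \<subseteq> oball y (8 * r)" using r by (intro oball_mono) simp
  finally show "x \<in> oball y (8 * r) \<and> nb x \<subseteq> oball y (8 * r)" using x by simp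
qed

text \<open>The inequality is tested with \<open>g\<close> itself and combined with
  \<open>dirichlet_poincare\<close>. Subsolutions suffice, so the bound is uniform over the
  increasing iterates and thereby gives their convergence.\<close>

lemma dirichlet_L2_bound:
  assumes r: "0 < r" and g: "\<And>x. x \<notin> oball y r \<Longrightarrow> g x = 0" "\<And>x. 0 \<le> g x"
    and f: "\<And>x. x \<in> oball y r \<Longrightarrow> lap g x \<le> f x * m x"
  shows "(\<Sum>x\<in>oball y r. (g x)\<^sup>2 * m x) \<le> 4 * cE\<^sup>2 * real r ^ 4 * (\<Sum>x\<in>oball y r. (f x)\<^sup>2 * m x)"
proof -
  define S where "S = (\<Sum>x\<in>oball y r. (g x)\<^sup>2 * m x)"
  define T where "T = (\<Sum>x\<in>oball y r. (f x)\<^sup>2 * m x)"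
  define k where "k = 2 * cE * (real r)\<^sup>2"
  have S0: "0 \<le> S" "0 \<le> T" unfolding S_def T_def by (auto intro!: sum_nonneg)
  have k: "0 < k" using cE_pos r by (simp add: k_def)
  have "energy (oball y (8 * r)) g = 2 * (\<Sum>x\<in>oball y (8 * r). g x * lap g x)"
    by (intro energy_eq_lap supp_inside_ball r g) auto
  also have "(\<Sum>x\<in>oball y (8 * r). g x * lap g x) = (\<Sum>x\<in>oball y r. g x * lap g x)"
    using g by (intro sum.mono_neutral_right) auto
  also have "\<dots> \<le> (\<Sum>x\<in>oball y r. g x * (f x * m x))"
    using g f by (intro sum_mono mult_left_mono) auto
  finally have en: "energy (oball y (8 * r)) g \<le> 2 * (\<Sum>x\<in>oball y r. g x * (f x * m x))" by simp
  have "S \<le> cE * (real r)\<^sup>2 * energy (oball y (8 * r)) g"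
    unfolding S_def by (rule dirichlet_poincare[OF r g(1)])
  also have "\<dots> \<le> cE * (real r)\<^sup>2 * (2 * (\<Sum>x\<in>oball y r. g x * (f x * m x)))"
    using en cE_pos by (intro mult_left_mono) auto
  finally have "S \<le> k * (\<Sum>x\<in>oball y r. g x * (f x * m x))" by (simp add: k_def)
  \<comment> \<open>Young's inequality with weights chosen so that, after multiplication by
    \<open>k\<close>, half of \<open>S\<close> is absorbed on the left.\<close>
  also have "(\<Sum>x\<in>oball y r. g x * (f x * m x)) \<le> (\<Sum>x\<in>oball y r. (1 / (2 * k)) * ((g x)\<^sup>2 * m x) + (k / 2) * ((f x)\<^sup>2 * m x))"
  proof (rule sum_mono)
    fix x
    have "0 \<le> (g x - k * f x)\<^sup>2 / (2 * k)" using k by simp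
    then have "g x * f x \<le> (1 / (2 * k)) * (g x)\<^sup>2 + (k / 2) * (f x)\<^sup>2"
      using k by (simp add: power2_eq_square field_simps)
    then have "g x * f x * m x \<le> ((1 / (2 * k)) * (g x)\<^sup>2 + (k / 2) * (f x)\<^sup>2) * m x"
      by (rule mult_right_mono) simp
    then show "g x * (f x * m x) \<le> (1 / (2 * k)) * ((g x)\<^sup>2 * m x) + (k / 2) * ((f x)\<^sup>2 * m x)"
      by (simp add: algebra_simps)
  qed
  also have "\<dots> = (1 / (2 * k)) * S + (k / 2) * T"
    by (simp add: S_def T_def sum.distrib sum_distrib_left)
  finally have "S \<le> k * ((1 / (2 * k)) * S + (k / 2) * T)" using k by simp
  also have "\<dots> = S / 2 + k\<^sup>2 / 2 * T" using k by (simp add: field_simps power2_eq_square)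
  finally have "S \<le> k\<^sup>2 * T" by simp
  also have "k\<^sup>2 = 4 * cE\<^sup>2 * real r ^ 4" by (simp add: k_def power_mult_distrib flip: power_mult)
  finally show ?thesis by (simp add: S_def T_def)
qed

context
  fixes f :: "'a \<Rightarrow> real"
  assumes f_nonneg: "\<And>x. 0 \<le> f x"
begin

lemma dirichlet_iter_tendsto:
  assumes r: "0 < r"
  shows "(\<lambda>n. dirichlet_iter (oball y r) f n x) \<longlonglongrightarrow> dirichlet_sol (oball y r) f x"
proof -
  let ?u = "dirichlet_iter (oball y r) f"
  define K where "K = 4 * cE\<^sup>2 * real r ^ 4 * (\<Sum>x\<in>oball y r. (f x)\<^sup>2 * m x)"
  have bd: "?u n x \<le> sqrt (K / m x)" for n
  proof (cases "x \<in> oball y r")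
    case True
    have "(?u n x)\<^sup>2 * m x \<le> (\<Sum>x\<in>oball y r. (?u n x)\<^sup>2 * m x)"
      using True by (intro member_le_sum[of _ _ "\<lambda>x. (?u n x)\<^sup>2 * m x"]) auto
    also have "\<dots> \<le> K" unfolding K_def
      by (intro dirichlet_L2_bound r dirichlet_iter_outside dirichlet_iter_nonneg lap_dirichlet_iter_le f_nonneg)
    finally have "(?u n x)\<^sup>2 \<le> K / m x" using m_pos[of x] by (simp add: field_simps)
    then show ?thesis by (rule real_le_rsqrt)
  next
    case False
    have "0 \<le> K" unfolding K_def by (intro mult_nonneg_nonneg sum_nonneg) auto
    then show ?thesis using False by (simp add: dirichlet_iter_outside)
  qed
  have "incseq (\<lambda>n. ?u n x)" by (intro incseq_SucI dirichlet_iter_Suc_mono f_nonneg)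
  then obtain L where "(\<lambda>n. ?u n x) \<longlonglongrightarrow> L" using incseq_convergent[of _ "sqrt (K / m x)"] bd by blast
  then show ?thesis unfolding dirichlet_sol_def using limI by blast
qed

lemma dirichlet_sol_ge: "0 < r \<Longrightarrow> dirichlet_iter (oball y r) f n x \<le> dirichlet_sol (oball y r) f x"
  by (intro incseq_le[OF _ dirichlet_iter_tendsto] incseq_SucI dirichlet_iter_Suc_mono f_nonneg)

lemma dirichlet_sol_nonneg: "0 < r \<Longrightarrow> 0 \<le> dirichlet_sol (oball y r) f x"
  using dirichlet_sol_ge[of r y 0 x] by simp

lemma dirichlet_sol_outside: "0 < r \<Longrightarrow> x \<notin> oball y r \<Longrightarrow> dirichlet_sol (oball y r) f x = 0"
  using dirichlet_iter_tendsto[of r y x] by (simp add: dirichlet_iter_outside LIMSEQ_const_iff)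

lemma dirichlet_sol_mono:
  assumes "0 < r" "r \<le> s"
  shows "dirichlet_sol (oball y r) f x \<le> dirichlet_sol (oball y s) f x"
proof (rule LIMSEQ_le)
  show "\<exists>N. \<forall>n\<ge>N. dirichlet_iter (oball y r) f n x \<le> dirichlet_iter (oball y s) f n x"
    using assms by (auto intro!: dirichlet_iter_mono f_nonneg)
qed (use assms dirichlet_iter_tendsto in auto)

lemma lap_dirichlet_sol:
  assumes "0 < r" "x \<in> oball y r"
  shows "lap (dirichlet_sol (oball y r) f) x = f x * m x"
proof -
  let ?u = "dirichlet_iter (oball y r) f" and ?s = "dirichlet_sol (oball y r) f"
  note t = dirichlet_iter_tendsto[OF assms(1), of y]
  have "(\<lambda>n. ?u (Suc n) x) \<longlonglongrightarrow> ?s x" using t by (rule LIMSEQ_Suc)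
  moreover have "(\<lambda>n. ?u (Suc n) x) \<longlonglongrightarrow> f x + (\<Sum>z\<in>nb x. \<mu> x z * ?s z) / m x"
    using assms(2) m_pos[of x] by (simp add: less_imp_neq[symmetric]) (intro tendsto_intros t, simp)
  ultimately have "?s x = f x + (\<Sum>z\<in>nb x. \<mu> x z * ?s z) / m x" by (rule LIMSEQ_unique)
  then show ?thesis using m_pos[of x] by (simp add: lap_diag field_simps)
qed

lemma lap_dirichlet_sol_outside:
  "0 < r \<Longrightarrow> x \<notin> oball y r \<Longrightarrow> lap (dirichlet_sol (oball y r) f) x \<le> 0"
  by (intro lap_outside_le dirichlet_sol_nonneg dirichlet_sol_outside)

end

end

section \<open>Exit times and Green functions of balls\<close>

context weighted_graph
begin

lemma lap_divide: "lap (\<lambda>x. u x / k) x = lap u x / k"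
  unfolding lap_def sum_divide_distrib by (intro sum.cong refl) (simp flip: diff_divide_distrib)

lemma lap_diff: "lap (\<lambda>x. u x - v x) x = lap u x - lap v x"
  unfolding lap_def sum_subtractf[symmetric] by (intro sum.cong refl) (simp add: algebra_simps)

lemma paley_zygmund:
  assumes B: "finite B" and f: "\<And>x. 0 \<le> f x" and ab: "0 < a" "0 < b"
    and lo: "a * mass B \<le> (\<Sum>x\<in>B. f x * m x)" and hi: "(\<Sum>x\<in>B. (f x)\<^sup>2 * m x) \<le> b * mass B"
  shows "a\<^sup>2 / (4 * b) * mass B \<le> mass {x\<in>B. a / 2 \<le> f x}"
proof -
  define A where "A = {x\<in>B. a / 2 \<le> f x}"
  \<comment> \<open>Makes the second-moment part of Young's inequality equal to
    \<open>a / 4 * mass B\<close>, half of the lower bound for the first moment on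
    \<open>A\<close>.\<close>
  define k where "k = a / (2 * b)"
  have k: "0 < k" using ab by (simp add: k_def)
  have fin: "finite A" "A \<subseteq> B" using B by (auto simp: A_def)
  have "(\<Sum>x\<in>B. f x * m x) \<le> (\<Sum>x\<in>B. a / 2 * m x + (if x \<in> A then f x * m x else 0))"
  proof (rule sum_mono)
    fix x assume "x \<in> B"
    show "f x * m x \<le> a / 2 * m x + (if x \<in> A then f x * m x else 0)"
    proof (cases "x \<in> A")
      case False
      then have "f x \<le> a / 2" using \<open>x \<in> B\<close> by (simp add: A_def)
      then have "f x * m x \<le> a / 2 * m x" by (rule mult_right_mono) simp
      then show ?thesis using False by simp
    qed (use ab in simp)
  qed
  also have "\<dots> = a / 2 * mass B + (\<Sum>x\<in>A. f x * m x)"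
  proof -
    have "(\<Sum>x\<in>B. if x \<in> A then f x * m x else 0) = (\<Sum>x\<in>B \<inter> A. f x * m x)"
      using B by (simp add: sum.inter_restrict)
    also have "B \<inter> A = A" using fin by blast
    finally show ?thesis by (simp add: sum.distrib mass_def sum_distrib_left)
  qed
  finally have 1: "a / 2 * mass B \<le> (\<Sum>x\<in>A. f x * m x)" using lo by simp
  have "(\<Sum>x\<in>A. f x * m x) \<le> (\<Sum>x\<in>A. k / 2 * ((f x)\<^sup>2 * m x) + 1 / (2 * k) * m x)"
  proof (rule sum_mono)
    fix x
    have "0 \<le> (k * f x - 1)\<^sup>2 / (2 * k)" using k by simp
    then have "f x \<le> k / 2 * (f x)\<^sup>2 + 1 / (2 * k)" using k by (simp add: power2_eq_square field_simps)
    then have "f x * m x \<le> (k / 2 * (f x)\<^sup>2 + 1 / (2 * k)) * m x" by (rule mult_right_mono) simp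
    then show "f x * m x \<le> k / 2 * ((f x)\<^sup>2 * m x) + 1 / (2 * k) * m x" by (simp add: algebra_simps)
  qed
  also have "\<dots> = k / 2 * (\<Sum>x\<in>A. (f x)\<^sup>2 * m x) + 1 / (2 * k) * mass A"
    by (simp add: sum.distrib mass_def sum_distrib_left)
  also have "(\<Sum>x\<in>A. (f x)\<^sup>2 * m x) \<le> (\<Sum>x\<in>B. (f x)\<^sup>2 * m x)"
    using fin B by (intro sum_mono2) auto
  also have "\<dots> \<le> b * mass B" by (rule hi)
  finally have 2: "(\<Sum>x\<in>A. f x * m x) \<le> k / 2 * (b * mass B) + 1 / (2 * k) * mass A" using k by simp
  have k1: "k / 2 * (b * mass B) = a / 4 * mass B" and k2: "1 / (2 * k) = b / a" using ab by (simp_all add: k_def)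
  have "a / 2 * mass B - a / 4 * mass B \<le> b / a * mass A"
    using order_trans[OF 1 2[unfolded k1 k2]] by (simp only: diff_le_eq add.commute)
  moreover have "a / 2 * mass B - a / 4 * mass B = a / 4 * mass B" by (simp add: field_simps)
  ultimately have "a / 4 * mass B \<le> b / a * mass A" by (simp only:)
  then show ?thesis unfolding A_def[symmetric] using ab by (simp add: field_simps power2_eq_square)
qed

text \<open>The delta function with respect to \<open>m\<close>, that is, \<open>heat_kernel\<close>
  at time 0; hence \<open>lap (green_ball y r)\<close> is the indicator of \<open>y\<close> in the
  ball.\<close>

definition pole :: "'a \<Rightarrow> 'a \<Rightarrow> real" where
  "pole y x = (if x = y then 1 / m y else 0)"

lemma pole_nonneg: "0 \<le> pole y x"
  by (simp add: pole_def)

abbreviation exit_time :: "'a \<Rightarrow> nat \<Rightarrow> 'a \<Rightarrow> real" where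
  "exit_time y r \<equiv> dirichlet_sol (oball y r) (\<lambda>_. 1)"

abbreviation green_ball :: "'a \<Rightarrow> nat \<Rightarrow> 'a \<Rightarrow> real" where
  "green_ball y r \<equiv> dirichlet_sol (oball y r) (pole y)"

end

context vd_pi_graph
begin

section \<open>Mean exit times of balls\<close>

lemma lap_exit_time: "0 < r \<Longrightarrow> x \<in> oball y r \<Longrightarrow> lap (exit_time y r) x = m x"
  using lap_dirichlet_sol[of "\<lambda>_. 1" r x y] by simp

lemma lap_green_ball: "0 < r \<Longrightarrow> x \<in> oball y r \<Longrightarrow> lap (green_ball y r) x = (if x = y then 1 else 0)"
  using lap_dirichlet_sol[of "pole y" r x y, OF pole_nonneg] m_pos[of y] by (simp add: pole_def)

lemma lap_green_ball_outside: "0 < r \<Longrightarrow> x \<notin> oball y r \<Longrightarrow> lap (green_ball y r) x \<le> 0"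
  by (rule lap_dirichlet_sol_outside[OF pole_nonneg])

lemma exit_time_L2:
  assumes "0 < r"
  shows "(\<Sum>x\<in>oball y r. (exit_time y r x)\<^sup>2 * m x) \<le> 4 * cE\<^sup>2 * real r ^ 4 * vol y r"
proof -
  have "(\<Sum>x\<in>oball y r. (exit_time y r x)\<^sup>2 * m x) \<le> 4 * cE\<^sup>2 * real r ^ 4 * (\<Sum>x\<in>oball y r. 1\<^sup>2 * m x)"
    using assms by (intro dirichlet_L2_bound)
      (auto simp: dirichlet_sol_outside dirichlet_sol_nonneg lap_exit_time)
  then show ?thesis by (simp add: mass_def)
qed

lemma exit_time_upper: "\<exists>C>0. \<forall>y r. 0 < r \<longrightarrow> exit_time y r y \<le> C * (real r)\<^sup>2"
proof -
  obtain C where C: "0 < C" and mv: "\<forall>u x R M K. 0 < R \<longrightarrow> 0 < K \<longrightarrow> 0 \<le> M \<longrightarrow> M * (real R)\<^sup>2 \<le> K \<longrightarrow>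
     (\<forall>y\<in>oball x R. lap u y \<le> M * m y) \<longrightarrow>
     (\<Sum>y\<in>oball x R. (u y)\<^sup>2 * m y) \<le> K\<^sup>2 * vol x R \<longrightarrow> u x \<le> C * K"
    using mean_value_L2 by blast
  \<comment> \<open>\<open>1 \<le> k\<close> meets the constraint
    \<open>M * R\<^sup>2 \<le> K\<close> with \<open>M = 1\<close>; \<open>2 * cE\<close> comes from
    \<open>exit_time_L2\<close>.\<close>
  define k where "k = max 1 (2 * cE)"
  have k: "1 \<le> k" "2 * cE \<le> k" by (auto simp: k_def)
  have "exit_time y r y \<le> C * k * (real r)\<^sup>2" if r: "0 < r" for y r
  proof -
    have "exit_time y r y \<le> C * (k * (real r)\<^sup>2)"
    proof (rule mv[rule_format, where M = 1 and u = "exit_time y r" and R = r])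
      have "4 * cE\<^sup>2 * real r ^ 4 = (2 * cE * (real r)\<^sup>2)\<^sup>2"
        by (simp add: power_mult_distrib flip: power_mult)
      also have "\<dots> \<le> (k * (real r)\<^sup>2)\<^sup>2" using k cE_pos by (intro power_mono mult_right_mono) auto
      finally show "(\<Sum>x\<in>oball y r. (exit_time y r x)\<^sup>2 * m x) \<le> (k * (real r)\<^sup>2)\<^sup>2 * vol y r"
        using exit_time_L2[OF r, of y] by (meson mass_nonneg mult_right_mono order_trans)
    qed (use r k in \<open>auto simp: lap_exit_time\<close>)
    then show ?thesis by simp
  qed
  then show ?thesis using C k by (intro exI[of _ "C * k"]) auto
qed

text \<open>The energy of the exit time is twice its own mass, because its Laplacian is
  \<open>m\<close>. So pairing it with a cutoff, whose integral is of the order of the volume, and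
  splitting by Young bounds that mass from below.\<close>

lemma exit_time_mass_lower:
  assumes r: "0 < r"
  shows "1 / (2 * 2 ^ p * 16 ^ p) * (real r)\<^sup>2 * vol y r \<le> (\<Sum>x\<in>oball y r. exit_time y r x * m x)"
proof -
  define D where "D = oball y (8 * r)"
  define T where "T = exit_time y r"
  define S where "S = (\<Sum>x\<in>oball y r. T x * m x)"
  define V where "V = vol y r"
  define \<phi> where "\<phi> = cutoff y 0 r"
  \<comment> \<open>Chosen so that the cutoff part of Young's inequality consumes at most half of
    the left-hand side; \<open>16 ^ p = 8 ^ p * 2 ^ p\<close> collects the volumes of radii
    \<open>8 * r\<close> and \<open>r / 2\<close>.\<close>
  define k where "k = (real r)\<^sup>2 / 16 ^ p"
  define s where "s = (r + 1) div 2"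
  have k: "0 < k" using r by (simp add: k_def)
  have finD: "finite D" by (simp add: D_def)
  have T_out: "T x = 0" if "x \<notin> oball y r" for x using that r by (simp add: T_def dirichlet_sol_outside)
  have \<phi>_out: "\<phi> x = 0" if "x \<notin> oball y r" for x unfolding \<phi>_def using that r by (intro cutoff_eq_0) auto
  have supp\<phi>: "supp_inside D \<phi>" unfolding D_def by (rule supp_inside_ball[OF r \<phi>_out])
  have suppT: "supp_inside D T" unfolding D_def by (rule supp_inside_ball[OF r T_out])
  have "vol y r \<le> (2 ^ p) ^ 1 * vol y s" by (intro vol_shift) (use r in \<open>auto simp: s_def\<close>)
  then have "V / (2 * 2 ^ p) \<le> 1 / 2 * vol y s" by (simp add: V_def field_simps)
  also have "\<dots> = (\<Sum>x\<in>oball y s. 1 / 2 * m x)" by (simp add: mass_def sum_distrib_left)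
  also have "\<dots> \<le> (\<Sum>x\<in>oball y s. \<phi> x * m x)"
  proof (intro sum_mono mult_right_mono)
    fix x assume "x \<in> oball y s"
    then have "2 * d y x \<le> r" by (simp add: s_def)
    then have "2 * real (d y x) \<le> real r" by (metis of_nat_le_iff of_nat_mult of_nat_numeral)
    then show "1 / 2 \<le> \<phi> x" using r by (simp add: \<phi>_def cutoff_def field_simps)
  qed simp
  also have "\<dots> \<le> (\<Sum>x\<in>oball y r. \<phi> x * m x)"
    by (intro sum_mono2) (auto simp: s_def \<phi>_def cutoff_range)
  also have "\<dots> = (\<Sum>x\<in>oball y r. \<phi> x * lap T x)"
    using r by (intro sum.cong) (auto simp: T_def lap_exit_time)
  also have "\<dots> = (\<Sum>x\<in>D. \<phi> x * lap T x)"
    using \<phi>_out r by (intro sum.mono_neutral_left) (auto simp: D_def)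
  also have "\<dots> = (\<Sum>x\<in>D. \<Sum>z\<in>D. \<mu> x z * ((\<phi> x - \<phi> z) * (T x - T z))) / 2"
    by (rule green_identity[OF finD supp\<phi>])
  also have "\<dots> \<le> (k / 2 * energy D \<phi> + 1 / (2 * k) * energy D T) / 2"
  proof (rule divide_right_mono)
    have "(\<Sum>x\<in>D. \<Sum>z\<in>D. \<mu> x z * ((\<phi> x - \<phi> z) * (T x - T z))) \<le>
      (\<Sum>x\<in>D. \<Sum>z\<in>D. k / 2 * (\<mu> x z * (\<phi> x - \<phi> z)\<^sup>2) + 1 / (2 * k) * (\<mu> x z * (T x - T z)\<^sup>2))"
    proof (intro sum_mono)
      fix x z
      define a where "a = \<phi> x - \<phi> z"
      define b where "b = T x - T z"
      have "0 \<le> (k * a - b)\<^sup>2 / (2 * k)" using k by simp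
      then have "a * b \<le> k / 2 * a\<^sup>2 + 1 / (2 * k) * b\<^sup>2" using k by (simp add: power2_eq_square field_simps)
      then have "\<mu> x z * (a * b) \<le> \<mu> x z * (k / 2 * a\<^sup>2 + 1 / (2 * k) * b\<^sup>2)"
        by (intro mult_left_mono weight_nonneg)
      then show "\<mu> x z * ((\<phi> x - \<phi> z) * (T x - T z)) \<le>
         k / 2 * (\<mu> x z * (\<phi> x - \<phi> z)\<^sup>2) + 1 / (2 * k) * (\<mu> x z * (T x - T z)\<^sup>2)"
        by (simp add: a_def b_def algebra_simps)
    qed
    also have "\<dots> = k / 2 * energy D \<phi> + 1 / (2 * k) * energy D T"
      by (simp add: energy_def sum.distrib sum_distrib_left)
    finally show "(\<Sum>x\<in>D. \<Sum>z\<in>D. \<mu> x z * ((\<phi> x - \<phi> z) * (T x - T z)))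
      \<le> k / 2 * energy D \<phi> + 1 / (2 * k) * energy D T" .
  qed simp
  also have "energy D T = 2 * S"
  proof -
    have "(\<Sum>x\<in>D. T x * lap T x) = (\<Sum>x\<in>oball y r. T x * lap T x)"
      using T_out r by (intro sum.mono_neutral_right) (auto simp: D_def)
    also have "\<dots> = S" unfolding S_def using r by (intro sum.cong) (auto simp: T_def lap_exit_time)
    finally show ?thesis by (simp add: energy_eq_lap[OF finD suppT])
  qed
  finally have 1: "V / (2 * 2 ^ p) \<le> (k / 2 * energy D \<phi> + 1 / (2 * k) * (2 * S)) / 2" .
  have "energy D \<phi> = (\<Sum>x\<in>D. \<Sum>z\<in>D. \<mu> x z * (1 * 1 * (\<phi> x - \<phi> z)\<^sup>2))" by (simp add: energy_def)
  also have "\<dots> \<le> 1 / (real r - real 0)\<^sup>2 * (\<Sum>x\<in>D. 1\<^sup>2 * m x)"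
    using r by (intro double_sum_sq_le finD) (auto simp only: \<phi>_def intro!: cutoff_lipschitz, auto)
  also have "\<dots> = 1 / (real r)\<^sup>2 * vol y (8 * r)" by (simp add: mass_def D_def)
  also have "\<dots> \<le> 1 / (real r)\<^sup>2 * ((2 ^ p) ^ 3 * V)"
    unfolding V_def using r by (intro mult_left_mono vol_shift) auto
  finally have "energy D \<phi> \<le> 1 / (real r)\<^sup>2 * (8 ^ p * V)"
    by (simp add: power3_eq_cube flip: power_mult_distrib)
  then have "k / 2 * energy D \<phi> \<le> k / 2 * (1 / (real r)\<^sup>2 * (8 ^ p * V))"
    using k by (intro mult_left_mono) auto
  also have "\<dots> = V / (2 * 2 ^ p)"
  proof -
    have "(16::real) ^ p = 8 ^ p * 2 ^ p" by (simp flip: power_mult_distrib)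
    then show ?thesis using r by (simp add: k_def)
  qed
  finally have "V / (4 * 2 ^ p) \<le> S / (2 * k)" using 1 by simp
  then show ?thesis unfolding S_def[symmetric] T_def[symmetric] V_def[symmetric]
    using r by (simp add: k_def field_simps)
qed

text \<open>The moments of the exit time from radius \<open>r\<close> give a large set; the growth
  lemma needs superharmonicity up to radius \<open>8 * r\<close>, so it is applied to the exit time
  from the larger ball, which dominates.\<close>

lemma exit_time_lower: "\<exists>c>0. \<forall>y r. 0 < r \<longrightarrow> c * (real r)\<^sup>2 \<le> exit_time y (8 * r) y"
proof -
  define c1 where "c1 = 1 / (2 * 2 ^ p * (16::real) ^ p)"
  define \<epsilon> where "\<epsilon> = min 1 (c1\<^sup>2 / (16 * cE\<^sup>2))"
  have c1: "0 < c1" by (simp add: c1_def)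
  have \<epsilon>: "0 < \<epsilon>" "\<epsilon> \<le> 1" using c1 cE_pos by (auto simp: \<epsilon>_def)
  obtain c where c: "0 < c" and gr: "\<forall>h x r. 0 < r \<longrightarrow> (\<forall>y. 0 \<le> h y) \<longrightarrow> (\<forall>y\<in>oball x (8 * r). 0 \<le> lap h y) \<longrightarrow>
    \<epsilon> * vol x r \<le> mass {y\<in>oball x r. 1 \<le> h y} \<longrightarrow> (\<forall>z\<in>oball x r. c \<le> h z)"
    using growth_lemma[OF \<epsilon>] by blast
  have "c * c1 / 2 * (real r)\<^sup>2 \<le> exit_time y (8 * r) y" if r: "0 < r" for y r
  proof -
    define a where "a = c1 * (real r)\<^sup>2"
    define b where "b = 4 * cE\<^sup>2 * real r ^ 4"
    have ab: "0 < a" "0 < b" using r c1 cE_pos by (auto simp: a_def b_def)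
    have "a\<^sup>2 / (4 * b) * vol y r \<le> mass {x\<in>oball y r. a / 2 \<le> exit_time y r x}"
      using r ab exit_time_mass_lower[OF r, of y] exit_time_L2[OF r, of y]
      by (intro paley_zygmund) (auto simp: a_def b_def c1_def dirichlet_sol_nonneg)
    also have "a\<^sup>2 / (4 * b) = c1\<^sup>2 / (16 * cE\<^sup>2)"
      using r by (simp add: a_def b_def power_mult_distrib flip: power_mult)
    finally have "c1\<^sup>2 / (16 * cE\<^sup>2) * vol y r \<le> mass {x\<in>oball y r. a / 2 \<le> exit_time y r x}" .
    moreover have "\<epsilon> * vol y r \<le> c1\<^sup>2 / (16 * cE\<^sup>2) * vol y r"
      by (intro mult_right_mono) (auto simp: \<epsilon>_def)
    ultimately have "\<epsilon> * vol y r \<le> mass {x\<in>oball y r. a / 2 \<le> exit_time y r x}" by simp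
    also have "\<dots> \<le> mass {x\<in>oball y r. 1 \<le> exit_time y (8 * r) x / (a / 2)}"
    proof (intro mass_mono)
      have "exit_time y r x \<le> exit_time y (8 * r) x" for x using r by (intro dirichlet_sol_mono) auto
      then have "a / 2 \<le> exit_time y (8 * r) x" if "a / 2 \<le> exit_time y r x" for x
        using that order_trans by blast
      then show "{x\<in>oball y r. a / 2 \<le> exit_time y r x} \<subseteq> {x\<in>oball y r. 1 \<le> exit_time y (8 * r) x / (a / 2)}"
        using ab by (auto simp: field_simps)
    qed (rule finite_subset[of _ "oball y r"], auto)
    finally have big: "\<epsilon> * vol y r \<le> mass {x\<in>oball y r. 1 \<le> exit_time y (8 * r) x / (a / 2)}" .
    have "c \<le> exit_time y (8 * r) y / (a / 2)"
    proof (rule gr[rule_format, where h = "\<lambda>x. exit_time y (8 * r) x / (a / 2)" and r = r and x = y])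
      show "0 \<le> lap (\<lambda>x. exit_time y (8 * r) x / (a / 2)) x" if "x \<in> oball y (8 * r)" for x
        unfolding lap_divide using lap_exit_time[OF _ that] r ab by simp
      show "\<epsilon> * vol y r \<le> mass {x\<in>oball y r. 1 \<le> exit_time y (8 * r) x / (a / 2)}" by (rule big)
    qed (use r ab in \<open>auto intro!: divide_nonneg_nonneg dirichlet_sol_nonneg\<close>)
    then show ?thesis using ab by (simp add: a_def field_simps)
  qed
  then show ?thesis using c c1 by (intro exI[of _ "c * c1 / 2"]) auto
qed

section \<open>Green functions of balls and their increments\<close>

lemma green_ball_mass:
  assumes r: "0 < r"
  shows "(\<Sum>x\<in>oball y r. green_ball y r x * m x) = exit_time y r y"
proof -
  define D where "D = oball y (8 * r)"
  define T where "T = exit_time y r"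
  define G where "G = green_ball y r"
  have T_out: "T x = 0" if "x \<notin> oball y r" for x using that r by (simp add: T_def dirichlet_sol_outside)
  have G_out: "G x = 0" if "x \<notin> oball y r" for x
    using that r by (simp add: G_def dirichlet_sol_outside pole_nonneg)
  have sub: "oball y r \<subseteq> D" using r by (auto simp: D_def)
  \<comment> \<open>Self-adjointness: on \<open>oball y r\<close>, \<open>lap G\<close> is the
    indicator of \<open>y\<close> and \<open>lap T\<close> is \<open>m\<close>, so the two pairings
    are \<open>T y\<close> and the mass of \<open>G\<close>.\<close>
  have "(\<Sum>x\<in>D. T x * lap G x) = (\<Sum>x\<in>D. G x * lap T x)"
    unfolding D_def by (intro lap_selfadjoint supp_inside_ball r T_out G_out) auto
  moreover have "(\<Sum>x\<in>D. T x * lap G x) = (\<Sum>x\<in>oball y r. T x * lap G x)"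
    using T_out sub by (intro sum.mono_neutral_right) (auto simp: D_def)
  moreover have "\<dots> = (\<Sum>x\<in>oball y r. if x = y then T y else 0)"
    using r by (intro sum.cong) (auto simp: G_def lap_green_ball)
  moreover have "\<dots> = T y" using r by simp
  moreover have "(\<Sum>x\<in>D. G x * lap T x) = (\<Sum>x\<in>oball y r. G x * lap T x)"
    using G_out sub by (intro sum.mono_neutral_right) (auto simp: D_def)
  moreover have "\<dots> = (\<Sum>x\<in>oball y r. G x * m x)"
    using r by (intro sum.cong) (auto simp: T_def lap_exit_time)
  ultimately show ?thesis by (simp add: T_def G_def)
qed

text \<open>A function below \<open>green_ball y r\<close> has mass of order at most
  \<open>r\<^sup>2\<close>, to be fed into the \<open>L1\<close> mean value inequality. A general
  \<open>u\<close> covers both the Green function off its pole and the increments.\<close>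

lemma green_ball_mean_value:
  "\<exists>C>0. \<forall>u x y r t. 0 < r \<longrightarrow> 0 < t \<longrightarrow> (\<forall>z. 0 \<le> u z \<and> u z \<le> green_ball y r z) \<longrightarrow>
     (\<forall>z\<in>oball x t. lap u z \<le> 0) \<longrightarrow> u x * vol x t \<le> C * (real r)\<^sup>2"
proof -
  obtain C where C: "0 < C" and mv: "\<forall>u x R. 0 < R \<longrightarrow> (\<forall>y. 0 \<le> u y) \<longrightarrow> (\<forall>y\<in>oball x R. lap u y \<le> 0) \<longrightarrow>
     u x * vol x R \<le> C * (\<Sum>y\<in>oball x R. u y * m y)"
    using mean_value_subharmonic_L1 by blast
  obtain C' where C': "0 < C'" and et: "\<forall>y r. 0 < r \<longrightarrow> exit_time y r y \<le> C' * (real r)\<^sup>2"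
    using exit_time_upper by blast
  have "u x * vol x t \<le> C * C' * (real r)\<^sup>2"
    if h: "0 < r" "0 < t" "\<forall>z. 0 \<le> u z \<and> u z \<le> green_ball y r z" "\<forall>z\<in>oball x t. lap u z \<le> 0" for u x y r t
  proof -
    have "(\<Sum>z\<in>oball x t. u z * m z) \<le> (\<Sum>z\<in>oball x t. green_ball y r z * m z)"
      using h by (intro sum_mono mult_right_mono) auto
    also have "\<dots> \<le> (\<Sum>z\<in>oball x t \<union> oball y r. green_ball y r z * m z)"
      using h(1) by (intro sum_mono2 mult_nonneg_nonneg dirichlet_sol_nonneg pole_nonneg) auto
    also have "\<dots> = (\<Sum>z\<in>oball y r. green_ball y r z * m z)"
      using h(1) by (intro sum.mono_neutral_right) (auto simp: dirichlet_sol_outside pole_nonneg)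
    also have "\<dots> \<le> C' * (real r)\<^sup>2" using et h(1) green_ball_mass by simp
    finally have "C * (\<Sum>z\<in>oball x t. u z * m z) \<le> C * (C' * (real r)\<^sup>2)" using C by (intro mult_left_mono) auto
    moreover have "u x * vol x t \<le> C * (\<Sum>z\<in>oball x t. u z * m z)" using mv h by blast
    ultimately show ?thesis by simp
  qed
  then have "\<forall>u x y r t. 0 < r \<longrightarrow> 0 < t \<longrightarrow> (\<forall>z. 0 \<le> u z \<and> u z \<le> green_ball y r z) \<longrightarrow>
     (\<forall>z\<in>oball x t. lap u z \<le> 0) \<longrightarrow> u x * vol x t \<le> C * C' * (real r)\<^sup>2" by blast
  moreover have "0 < C * C'" using C C' by simp
  ultimately show ?thesis by blast
qed

text \<open>The poles cancel inside the small ball; outside it \<open>green_ball y s\<close>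
  vanishes, and a nonnegative function has nonpositive \<open>lap\<close> at its zeros.\<close>

lemma lap_green_increment:
  assumes "0 < s" "s \<le> r"
  shows "z \<in> oball y s \<Longrightarrow> lap (\<lambda>z. green_ball y r z - green_ball y s z) z = 0"
    and "z \<in> oball y r \<Longrightarrow> 0 \<le> lap (\<lambda>z. green_ball y r z - green_ball y s z) z"
proof -
  show 1: "lap (\<lambda>z. green_ball y r z - green_ball y s z) z = 0" if "z \<in> oball y s"
    unfolding lap_diff using that assms by (simp add: lap_green_ball)
  show "0 \<le> lap (\<lambda>z. green_ball y r z - green_ball y s z) z" if z: "z \<in> oball y r"
  proof (cases "z \<in> oball y s")
    case False
    then have "lap (green_ball y s) z \<le> 0" using assms by (intro lap_green_ball_outside) auto
    moreover have "0 \<le> lap (green_ball y r) z" using z assms by (simp add: lap_green_ball)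
    ultimately show ?thesis unfolding lap_diff by simp
  qed (use 1 in simp)
qed

lemma green_increment_bounds:
  assumes "0 < s" "s \<le> r"
  shows "0 \<le> green_ball y r z - green_ball y s z" "green_ball y r z - green_ball y s z \<le> green_ball y r z"
  using dirichlet_sol_mono[OF pole_nonneg assms] dirichlet_sol_nonneg[OF pole_nonneg assms(1)] by auto

text \<open>
  Away from the pole the increment is dominated by the subharmonic function \<open>green_ball y r\<close>,
  near the pole it is harmonic; in both cases the mean value inequality applies.
\<close>

lemma green_increment_sup:
  "\<exists>C>0. \<forall>y s k x. 0 < s \<longrightarrow> d y x < 2 ^ k * s \<longrightarrow>
     green_ball y (2 ^ (k + 3) * s) x - green_ball y s x
       \<le> C * (2 ^ p) ^ k * (real (2 ^ k * s))\<^sup>2 / vol y (2 ^ k * s)"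
proof -
  obtain C where C: "0 < C" and mv: "\<forall>u x y r t. 0 < r \<longrightarrow> 0 < t \<longrightarrow> (\<forall>z. 0 \<le> u z \<and> u z \<le> green_ball y r z) \<longrightarrow>
     (\<forall>z\<in>oball x t. lap u z \<le> 0) \<longrightarrow> u x * vol x t \<le> C * (real r)\<^sup>2"
    using green_ball_mean_value by blast
  \<comment> \<open>64 is \<open>8\<^sup>2\<close>, from \<open>r = 8 * \<rho>\<close>;
    \<open>k + 2\<close> doublings compare \<open>oball y \<rho>\<close> with a ball around
    \<open>x\<close> of radius at least \<open>s / 2\<close>.\<close>
  have "green_ball y (2 ^ (k + 3) * s) x - green_ball y s x
      \<le> (64 * C * (2 ^ p) ^ 2) * (2 ^ p) ^ k * (real (2 ^ k * s))\<^sup>2 / vol y (2 ^ k * s)"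
    if s: "0 < s" and x: "d y x < 2 ^ k * s" for y s k x
  proof -
    define \<rho> where "\<rho> = 2 ^ k * s"
    define r where "r = 2 ^ (k + 3) * s"
    have r: "r = 8 * \<rho>" "0 < \<rho>" "s \<le> \<rho>" "s \<le> r" "0 < r" using s by (auto simp: r_def \<rho>_def power_add)
    define h where "h z = green_ball y r z - green_ball y s z" for z
    have h01: "0 \<le> h z" "h z \<le> green_ball y r z" for z
      unfolding h_def using green_increment_bounds[OF s r(4)] by auto
    have "\<exists>t. s \<le> 2 * t \<and> h x * vol x t \<le> C * (real r)\<^sup>2"
    proof (cases "2 * d y x \<le> s")
      case True
      define t where "t = (s + 1) div 2"
      have t: "0 < t" "s \<le> 2 * t" "d y x + t \<le> s" using s True by (auto simp: t_def)
      have "h x * vol x t \<le> C * (real r)\<^sup>2"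
      proof (rule mv[rule_format])
        show "0 \<le> h z \<and> h z \<le> green_ball y r z" for z using h01 by simp
        show "lap h z \<le> 0" if "z \<in> oball x t" for z
        proof -
          have "z \<in> oball y s" using that oball_shift[OF t(3)] by blast
          then show ?thesis unfolding h_def using lap_green_increment(1)[OF s r(4)] by simp
        qed
      qed (use t r in auto)
      then show ?thesis using t by blast
    next
      case False
      define t where "t = d y x"
      have t: "0 < t" "s \<le> 2 * t" using False by (auto simp: t_def)
      have "green_ball y r x * vol x t \<le> C * (real r)\<^sup>2"
      proof (rule mv[rule_format])
        show "0 \<le> green_ball y r z \<and> green_ball y r z \<le> green_ball y r z" for z
          using r by (simp add: dirichlet_sol_nonneg pole_nonneg)
        show "lap (green_ball y r) z \<le> 0" if "z \<in> oball x t" for z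
        proof -
          have "z \<noteq> y" using that dist_sym[of x y] by (auto simp: t_def)
          then show ?thesis using r lap_green_ball_outside[of r z y] lap_green_ball[of r z y]
            by (cases "z \<in> oball y r") auto
        qed
      qed (use t r in auto)
      moreover have "h x * vol x t \<le> green_ball y r x * vol x t" using h01 by (intro mult_right_mono) auto
      ultimately show ?thesis using t by (meson order_trans)
    qed
    then obtain t where t: "s \<le> 2 * t" "h x * vol x t \<le> C * (real r)\<^sup>2" by blast
    have "vol y \<rho> \<le> (2 ^ p) ^ (k + 2) * vol x t"
    proof (rule vol_shift)
      show "0 < t" using t s by simp
      have "2 ^ k * s \<le> 2 * (2 ^ k * t)"
        using mult_le_mono2[OF t(1), of "2 ^ k"] by (simp only: mult.left_commute)
      moreover have "2 ^ (k + 2) * t = 4 * (2 ^ k * t)" by (simp add: power_add)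
      ultimately show "d x y + \<rho> \<le> 2 ^ (k + 2) * t"
        using x dist_sym[of x y] unfolding \<rho>_def by linarith
    qed
    then have "h x * vol y \<rho> \<le> h x * ((2 ^ p) ^ (k + 2) * vol x t)" using h01 by (intro mult_left_mono) auto
    also have "\<dots> = (2 ^ p) ^ (k + 2) * (h x * vol x t)" by simp
    also have "\<dots> \<le> (2 ^ p) ^ (k + 2) * (C * (real r)\<^sup>2)" using t by (intro mult_left_mono) auto
    finally have "h x * vol y \<rho> \<le> (64 * C * (2 ^ p) ^ 2) * (2 ^ p) ^ k * (real \<rho>)\<^sup>2"
      by (simp add: r power_add power_mult_distrib power2_eq_square[of "2 ^ p"] mult_ac)
    then show ?thesis using vol_pos[of \<rho> y] r(2) by (simp add: h_def r_def \<rho>_def field_simps)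
  qed
  then have "\<forall>y s k x. 0 < s \<longrightarrow> d y x < 2 ^ k * s \<longrightarrow>
     green_ball y (2 ^ (k + 3) * s) x - green_ball y s x
       \<le> (64 * C * (2 ^ p) ^ 2) * (2 ^ p) ^ k * (real (2 ^ k * s))\<^sup>2 / vol y (2 ^ k * s)" by blast
  moreover have "0 < 64 * C * ((2::real) ^ p) ^ 2" using C by simp
  ultimately show ?thesis by blast
qed

text \<open>Masses give the first moment on \<open>oball y \<rho>\<close>,
  \<open>green_increment_sup\<close> the second; Paley--Zygmund and the growth lemma then spread the
  bound to all \<open>x\<close>. The outer radius is \<open>8 * 2 ^ k * s\<close> because the growth
  lemma needs superharmonicity on that ball.\<close>

lemma green_increment_lower:
  "\<exists>c>0. \<exists>k. \<forall>y s x. 0 < s \<longrightarrow> d y x < 2 ^ k * s \<longrightarrow>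
     c * (real (2 ^ k * s))\<^sup>2 / vol y (2 ^ k * s) \<le> green_ball y (2 ^ (k + 3) * s) x - green_ball y s x"
proof -
  obtain cT where cT: "0 < cT" and Tlo: "\<forall>y r. 0 < r \<longrightarrow> cT * (real r)\<^sup>2 \<le> exit_time y (8 * r) y"
    using exit_time_lower by blast
  obtain CT where CT: "0 < CT" and Tup: "\<forall>y r. 0 < r \<longrightarrow> exit_time y r y \<le> CT * (real r)\<^sup>2"
    using exit_time_upper by blast
  obtain Ch where Ch: "0 < Ch" and hup: "\<forall>y s k x. 0 < s \<longrightarrow> d y x < 2 ^ k * s \<longrightarrow>
     green_ball y (2 ^ (k + 3) * s) x - green_ball y s x
       \<le> Ch * (2 ^ p) ^ k * (real (2 ^ k * s))\<^sup>2 / vol y (2 ^ k * s)"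
    using green_increment_sup by blast
  \<comment> \<open>\<open>exit_time_lower\<close> bounds the exit time of radius
    \<open>8 * r\<close> below by a multiple of \<open>r\<^sup>2\<close>; with
    \<open>\<rho> = 8 * r\<close> this costs the factor 64.\<close>
  define c where "c = cT / 64"
  have c: "0 < c" using cT by (simp add: c_def)
  obtain j where j: "2 * CT / c < 4 ^ j" using real_arch_pow[of 4] by auto
  \<comment> \<open>The offset 3 makes \<open>\<rho> = 2 ^ k * s\<close> a multiple of 8;
    \<open>4 ^ k\<close> is so large that the inner Green function takes at most half of the lower
    bound for the mass.\<close>
  define k where "k = j + 3"
  have "(4::real) ^ j \<le> 4 ^ k" unfolding k_def by (intro power_increasing) auto
  then have "2 * CT / c < 4 ^ k" using j by linarith
  then have kc: "CT \<le> c / 2 * 4 ^ k" using c by (simp add: field_simps)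
  \<comment> \<open>\<open>B\<close> depends on \<open>k\<close>, so \<open>\<epsilon>\<close> and
    the growth constant \<open>g\<close> can be fixed only now.\<close>
  define B where "B = Ch * (2 ^ p) ^ k"
  have B: "0 < B" using Ch by (simp add: B_def)
  define \<epsilon> where "\<epsilon> = min 1 ((c / 2)\<^sup>2 / (4 * B\<^sup>2))"
  have \<epsilon>: "0 < \<epsilon>" "\<epsilon> \<le> 1" using c B by (auto simp: \<epsilon>_def)
  obtain g where g: "0 < g" and gr: "\<forall>h x r. 0 < r \<longrightarrow> (\<forall>y. 0 \<le> h y) \<longrightarrow> (\<forall>y\<in>oball x (8 * r). 0 \<le> lap h y) \<longrightarrow>
    \<epsilon> * vol x r \<le> mass {y\<in>oball x r. 1 \<le> h y} \<longrightarrow> (\<forall>z\<in>oball x r. g \<le> h z)"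
    using growth_lemma[OF \<epsilon>] by blast
  have "g * c / 4 * (real (2 ^ k * s))\<^sup>2 / vol y (2 ^ k * s) \<le> green_ball y (2 ^ (k + 3) * s) x - green_ball y s x"
    if s: "0 < s" and x: "d y x < 2 ^ k * s" for y s x
  proof -
    define \<rho> where "\<rho> = 2 ^ k * s"
    define r where "r = 8 * \<rho>"
    have rr: "2 ^ (k + 3) * s = r" by (simp add: r_def \<rho>_def power_add)
    have r: "0 < \<rho>" "s \<le> \<rho>" "s \<le> r" "\<rho> \<le> r" "0 < r" using s by (auto simp: r_def \<rho>_def)
    define V where "V = vol y \<rho>"
    have V: "0 < V" unfolding V_def by (intro vol_pos r)
    define R where "R = (real \<rho>)\<^sup>2"
    have R: "0 < R" using r by (simp add: R_def)
    define h where "h z = green_ball y r z - green_ball y s z" for z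
    have h0: "0 \<le> h z" for z
      unfolding h_def using green_increment_bounds[OF s r(3)] by auto
    have hle: "h z \<le> B * R / V" if "z \<in> oball y \<rho>" for z
      using hup[rule_format, of s y z k] s that unfolding rr by (simp add: h_def B_def R_def V_def \<rho>_def)
    have "c * R \<le> exit_time y \<rho> y"
    proof -
      have \<rho>8: "\<rho> = 8 * (2 ^ j * s)" by (simp add: \<rho>_def k_def power_add)
      have "cT * (real (2 ^ j * s))\<^sup>2 \<le> exit_time y (8 * (2 ^ j * s)) y"
        using Tlo[rule_format, of "2 ^ j * s" y] s by simp
      moreover have "c * R = cT * (real (2 ^ j * s))\<^sup>2"
        unfolding c_def R_def \<rho>8 by (simp add: power2_eq_square)
      ultimately show ?thesis unfolding \<rho>8 by simp
    qed
    also have "\<dots> = (\<Sum>z\<in>oball y \<rho>. green_ball y \<rho> z * m z)" using green_ball_mass[OF r(1)] by simp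
    also have "\<dots> \<le> (\<Sum>z\<in>oball y \<rho>. green_ball y r z * m z)"
      using r by (intro sum_mono mult_right_mono dirichlet_sol_mono pole_nonneg) auto
    also have "\<dots> = (\<Sum>z\<in>oball y \<rho>. h z * m z) + (\<Sum>z\<in>oball y \<rho>. green_ball y s z * m z)"
      unfolding sum.distrib[symmetric] by (intro sum.cong refl) (simp add: h_def algebra_simps)
    also have "(\<Sum>z\<in>oball y \<rho>. green_ball y s z * m z) = (\<Sum>z\<in>oball y s. green_ball y s z * m z)"
      using s r by (intro sum.mono_neutral_right) (auto simp: dirichlet_sol_outside pole_nonneg)
    also have "\<dots> \<le> CT * (real s)\<^sup>2" using Tup s green_ball_mass[OF s] by simp
    also have "\<dots> \<le> c / 2 * 4 ^ k * (real s)\<^sup>2" using kc by (rule mult_right_mono) simp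
    also have "\<dots> = c / 2 * R"
      by (simp add: R_def \<rho>_def power_mult_distrib pow2_sq)
    finally have mass_h: "c / 2 * R \<le> (\<Sum>z\<in>oball y \<rho>. h z * m z)" by simp
    define a where "a = c / 2 * R / V"
    have a: "0 < a" using c R V by (simp add: a_def)
    have "a\<^sup>2 / (4 * (B * R / V)\<^sup>2) * vol y \<rho> \<le> mass {z\<in>oball y \<rho>. a / 2 \<le> h z}"
    proof (rule paley_zygmund)
      show "0 < (B * R / V)\<^sup>2" using B R V by simp
      show "a * vol y \<rho> \<le> (\<Sum>z\<in>oball y \<rho>. h z * m z)"
        using mass_h V by (simp add: a_def V_def[symmetric])
      have "(\<Sum>z\<in>oball y \<rho>. (h z)\<^sup>2 * m z) \<le> (\<Sum>z\<in>oball y \<rho>. (B * R / V)\<^sup>2 * m z)"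
        using h0 hle by (intro sum_mono mult_right_mono power_mono) auto
      then show "(\<Sum>z\<in>oball y \<rho>. (h z)\<^sup>2 * m z) \<le> (B * R / V)\<^sup>2 * vol y \<rho>"
        by (simp add: mass_def sum_distrib_left)
    qed (use h0 a in auto)
    moreover have "a\<^sup>2 / (4 * (B * R / V)\<^sup>2) = (c / 2)\<^sup>2 / (4 * B\<^sup>2)"
      using R V unfolding a_def by (simp add: power_divide power_mult_distrib)
    moreover have "{z\<in>oball y \<rho>. a / 2 \<le> h z} = {z\<in>oball y \<rho>. 1 \<le> h z / (a / 2)}" using a by (auto simp: field_simps)
    ultimately have "(c / 2)\<^sup>2 / (4 * B\<^sup>2) * vol y \<rho> \<le> mass {z\<in>oball y \<rho>. 1 \<le> h z / (a / 2)}" by simp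
    moreover have "\<epsilon> * vol y \<rho> \<le> (c / 2)\<^sup>2 / (4 * B\<^sup>2) * vol y \<rho>"
      by (intro mult_right_mono) (auto simp: \<epsilon>_def)
    ultimately have big: "\<epsilon> * vol y \<rho> \<le> mass {z\<in>oball y \<rho>. 1 \<le> h z / (a / 2)}" by simp
    have "g \<le> h x / (a / 2)"
    proof (rule gr[rule_format, OF r(1) _ _ big])
      show "0 \<le> h z / (a / 2)" for z using h0[of z] a by simp
      show "0 \<le> lap (\<lambda>z. h z / (a / 2)) z" if "z \<in> oball y (8 * \<rho>)" for z
      proof -
        have "z \<in> oball y r" using that by (simp add: r_def)
        then have "0 \<le> lap h z" unfolding h_def by (rule lap_green_increment(2)[OF s r(3)])
        then show ?thesis unfolding lap_divide using a by simp
      qed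
      show "x \<in> oball y \<rho>" using x by (simp add: \<rho>_def)
    qed
    then have "g * (a / 2) \<le> h x" using a by (simp add: field_simps)
    then show ?thesis unfolding rr by (simp add: h_def a_def R_def V_def \<rho>_def)
  qed
  then have "\<forall>y s x. 0 < s \<longrightarrow> d y x < 2 ^ k * s \<longrightarrow>
     g * c / 4 * (real (2 ^ k * s))\<^sup>2 / vol y (2 ^ k * s) \<le> green_ball y (2 ^ (k + 3) * s) x - green_ball y s x" by blast
  moreover have "0 < g * c / 4" using g c by simp
  ultimately show ?thesis by blast
qed

end

section \<open>Green function bounds\<close>

context vd_pi_graph
begin

text \<open>\<open>oball y (n + 1)\<close> is the closed ball of radius \<open>n\<close>, so this is
  the summand \<open>n / V(y, n)\<close>.\<close>

abbreviation term_at :: "'a \<Rightarrow> nat \<Rightarrow> real" where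
  "term_at y n \<equiv> real n / vol y (n + 1)"

text \<open>The block has \<open>a\<close> terms, each comparable to \<open>a / vol y a\<close>;
  this turns a bound at one scale into a piece of the series.\<close>

lemma annulus_sum_lower:
  assumes "0 < a"
  shows "(real a)\<^sup>2 / vol y a \<le> 2 ^ p * (\<Sum>n\<in>{a..<2 * a}. term_at y n)"
proof -
  have v: "0 < vol y a" using assms by (rule vol_pos)
  have "(real a)\<^sup>2 / vol y a = (\<Sum>n\<in>{a..<2 * a}. real a / vol y a)" by (simp add: power2_eq_square)
  also have "\<dots> \<le> (\<Sum>n\<in>{a..<2 * a}. 2 ^ p * term_at y n)"
  proof (rule sum_mono)
    fix n assume n: "n \<in> {a..<2 * a}"
    have "vol y (n + 1) \<le> vol y (2 * a)" using n by (intro vol_mono) auto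
    also have "\<dots> \<le> 2 ^ p * vol y a" by (rule doubling[OF assms])
    finally have "real a * vol y (n + 1) \<le> real n * (2 ^ p * vol y a)"
      using n by (intro mult_mono) auto
    then show "real a / vol y a \<le> 2 ^ p * term_at y n"
      using v vol_pos[of "n + 1" y] by (simp add: field_simps)
  qed
  finally show ?thesis by (simp add: sum_distrib_left)
qed

text \<open>The block ratio \<open>2 ^ j\<close> and the scale \<open>2 ^ k * a\<close> on the right
  are independent, as the increment in \<open>green_increment_lower\<close> has outer radius
  \<open>2 ^ (k + 3) * s\<close> but its bound is expressed at \<open>2 ^ k * s\<close>.\<close>

lemma annulus_sum_upper:
  assumes "0 < a"
  shows "(\<Sum>n\<in>{a..<2 ^ j * a}. term_at y n) \<le> 4 ^ j * (2 ^ p) ^ k * ((real (2 ^ k * a))\<^sup>2 / vol y (2 ^ k * a))"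
proof -
  have v: "0 < vol y a" "0 < vol y (2 ^ k * a)" using assms by (auto intro!: vol_pos)
  have "(\<Sum>n\<in>{a..<2 ^ j * a}. term_at y n) \<le> (\<Sum>n\<in>{a..<2 ^ j * a}. real (2 ^ j * a) / vol y a)"
  proof (rule sum_mono)
    fix n assume n: "n \<in> {a..<2 ^ j * a}"
    then have "n \<le> 2 ^ j * a" by simp
    then have "real n \<le> real (2 ^ j * a)" by (rule of_nat_mono)
    moreover have "vol y a \<le> vol y (n + 1)" using n by (intro vol_mono) auto
    ultimately show "term_at y n \<le> real (2 ^ j * a) / vol y a" using v by (intro frac_le) auto
  qed
  also have "\<dots> = real (2 ^ j * a - a) * (real (2 ^ j * a) / vol y a)" by simp
  also have "\<dots> \<le> real (2 ^ j * a) * (real (2 ^ j * a) / vol y a)"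
    by (intro mult_right_mono of_nat_mono) auto
  also have "\<dots> = 4 ^ j * ((real a)\<^sup>2 / vol y a)"
    by (simp add: power2_eq_square flip: pow2_sq)
  also have "\<dots> \<le> 4 ^ j * ((2 ^ p) ^ k * ((real (2 ^ k * a))\<^sup>2 / vol y (2 ^ k * a)))"
  proof (rule mult_left_mono)
    have "a \<le> 2 ^ k * a" by simp
    then have "real a \<le> real (2 ^ k * a)" by (rule of_nat_mono)
    then have "(real a)\<^sup>2 * vol y (2 ^ k * a) \<le> (real (2 ^ k * a))\<^sup>2 * ((2 ^ p) ^ k * vol y a)"
      by (intro mult_mono power_mono vol_doubling_pow assms) auto
    then show "(real a)\<^sup>2 / vol y a \<le> (2 ^ p) ^ k * ((real (2 ^ k * a))\<^sup>2 / vol y (2 ^ k * a))"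
      using v by (simp add: field_simps)
  qed simp
  finally show ?thesis by (simp add: mult.assoc)
qed

text \<open>From the one-point ball the walk escapes through edges to other vertices;
  \<open>ellipticity\<close> makes one such edge comparable to \<open>m y\<close>, even if there is
  a loop at \<open>y\<close>.\<close>

lemma green_ball_pole: "green_ball y 1 y \<le> 1 / \<alpha> / m y"
proof -
  let ?G = "green_ball y 1"
  have out: "?G z = 0" if "z \<noteq> y" for z
    using that by (intro dirichlet_sol_outside pole_nonneg) auto
  obtain z where "d y z = 1" using ex_dist_eq by blast
  then have z: "z \<noteq> y" "(y, z) \<in> E" using dist_relpow[of y z] by auto
  have G0: "0 \<le> ?G y" by (intro dirichlet_sol_nonneg pole_nonneg) auto
  have "\<alpha> * m y * ?G y \<le> \<mu> y z * ?G y" using ellipticity[OF z(2)] G0 by (rule mult_right_mono)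
  also have "\<dots> = \<mu> y z * (?G y - ?G z)" using out[OF z(1)] by simp
  also have "\<dots> \<le> (\<Sum>w\<in>nb y. \<mu> y w * (?G y - ?G w))"
  proof (rule member_le_sum)
    fix w show "0 \<le> \<mu> y w * (?G y - ?G w)"
      using G0 out[of w] by (cases "w = y") (auto intro!: mult_nonneg_nonneg weight_nonneg)
  qed (use z locally_finite in auto)
  also have "\<dots> = 1" using lap_green_ball[of 1 y y] by (simp add: lap_def)
  finally show ?thesis using \<alpha>_pos m_pos[of y] by (simp add: field_simps)
qed

text \<open>Start of the telescoping: the smallest ball around \<open>y\<close> that contains
  \<open>x\<close>. For \<open>x \<noteq> y\<close> the ball of radius \<open>d y x\<close> around
  \<open>x\<close> misses the pole; for \<open>x = y\<close> the case is
  \<open>green_ball_pole\<close>.\<close>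

lemma green_ball_base:
  "\<exists>C>0. \<forall>x y. green_ball y (d y x + 1) x \<le> C * ((real (d y x + 1))\<^sup>2 / vol y (d y x + 1))"
proof -
  obtain C where C: "0 < C" and mv: "\<forall>u x y r t. 0 < r \<longrightarrow> 0 < t \<longrightarrow> (\<forall>z. 0 \<le> u z \<and> u z \<le> green_ball y r z) \<longrightarrow>
     (\<forall>z\<in>oball x t. lap u z \<le> 0) \<longrightarrow> u x * vol x t \<le> C * (real r)\<^sup>2"
    using green_ball_mean_value by blast
  define K where "K = max (1 / \<alpha>) (C * (2 ^ p) ^ 2)"
  have K: "1 / \<alpha> \<le> K" "C * (2 ^ p) ^ 2 \<le> K" "0 < K" using \<alpha>_pos C by (auto simp: K_def less_max_iff_disj)
  have "green_ball y (d y x + 1) x \<le> K * ((real (d y x + 1))\<^sup>2 / vol y (d y x + 1))" for x y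
  proof (cases "x = y")
    case True
    have "green_ball y 1 y \<le> 1 / \<alpha> / m y" by (rule green_ball_pole)
    also have "\<dots> \<le> K / m y" using K by (intro divide_right_mono) auto
    finally show ?thesis using True by (simp add: vol_1)
  next
    case False
    define t where "t = d y x"
    have t: "0 < t" using False dist_eq_0_iff[of y x] unfolding t_def by blast
    have v: "0 < vol x t" "0 < vol y (t + 1)" using t by (auto intro!: vol_pos)
    have G0: "0 \<le> green_ball y (t + 1) z" for z by (intro dirichlet_sol_nonneg pole_nonneg) auto
    have "green_ball y (t + 1) x * vol x t \<le> C * (real (t + 1))\<^sup>2"
    proof (rule mv[rule_format, where u = "green_ball y (t + 1)" and y = y])
      show "0 \<le> green_ball y (t + 1) z \<and> green_ball y (t + 1) z \<le> green_ball y (t + 1) z" for z using G0 by simp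
      show "lap (green_ball y (t + 1)) z \<le> 0" if "z \<in> oball x t" for z
      proof -
        have "z \<noteq> y" using that dist_sym[of x y] by (auto simp: t_def)
        then show ?thesis using lap_green_ball_outside[of "t + 1" z y] lap_green_ball[of "t + 1" z y]
          by (cases "z \<in> oball y (t + 1)") auto
      qed
    qed (use t in auto)
    moreover have "vol y (t + 1) \<le> (2 ^ p) ^ 2 * vol x t"
      using t dist_sym[of x y] by (intro vol_shift) (auto simp: t_def)
    ultimately have "green_ball y (t + 1) x * vol y (t + 1) \<le> (2 ^ p) ^ 2 * (C * (real (t + 1))\<^sup>2)"
      using G0[of x] by (smt (verit) mult.assoc mult.commute mult_left_mono zero_le_power)
    also have "\<dots> = C * (2 ^ p) ^ 2 * (real (t + 1))\<^sup>2" by simp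
    also have "\<dots> \<le> K * (real (t + 1))\<^sup>2" using K by (intro mult_right_mono) auto
    finally show ?thesis using v unfolding t_def[symmetric] by (simp add: field_simps)
  qed
  then show ?thesis using K by blast
qed

text \<open>Finite partial sums keep the bound in the reals even if the series diverges. The
  alternative \<open>R = 0\<close> sets the empty ball aside.\<close>

lemma green_ball_upper:
  "\<exists>C>0. \<forall>x y R. \<exists>N. green_ball y R x \<le> C * (\<Sum>n\<in>{d y x..<N}. term_at y n) \<or> R = 0"
proof -
  obtain C1 where C1: "0 < C1" and base: "\<forall>x y. green_ball y (d y x + 1) x \<le> C1 * ((real (d y x + 1))\<^sup>2 / vol y (d y x + 1))"
    using green_ball_base by blast
  obtain C2 where C2: "0 < C2" and inc: "\<forall>y s k x. 0 < s \<longrightarrow> d y x < 2 ^ k * s \<longrightarrow>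
     green_ball y (2 ^ (k + 3) * s) x - green_ball y s x
       \<le> C2 * (2 ^ p) ^ k * (real (2 ^ k * s))\<^sup>2 / vol y (2 ^ k * s)"
    using green_increment_sup by blast
  have "\<exists>N. green_ball y R x \<le> ((C1 + C2) * 2 ^ p) * (\<Sum>n\<in>{d y x..<N}. term_at y n) \<or> R = 0" for x y R
  proof (cases "R = 0")
    case False
    define s where "s = d y x + 1"
    have s: "0 < s" "d y x < s" by (auto simp: s_def)
    have step: "green_ball y (2 ^ M * s) x \<le> C1 * ((real s)\<^sup>2 / vol y s) + C2 * 2 ^ p * (\<Sum>n\<in>{s..<2 ^ M * s}. term_at y n)" for M
    proof (induction M)
      case 0
      then show ?case using base by (simp add: s_def)
    next
      case (Suc M)
      define a where "a = 2 ^ M * s"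
      have "s \<le> a" by (simp add: a_def)
      with s have a: "0 < a" "d y x < a" "s \<le> a" by linarith+
      \<comment> \<open>The increment bound with \<open>k = 0\<close> reaches from \<open>a\<close>
        to \<open>8 * a\<close>; monotonicity in the radius brings it to \<open>2 * a\<close>,
        matching the block.\<close>
      have "green_ball y (2 * a) x \<le> green_ball y (8 * a) x"
        using a by (intro dirichlet_sol_mono pole_nonneg) auto
      also have "\<dots> \<le> green_ball y a x + C2 * ((real a)\<^sup>2 / vol y a)"
        using inc[rule_format, of a y x 0] a by simp
      also have "C2 * ((real a)\<^sup>2 / vol y a) \<le> C2 * (2 ^ p * (\<Sum>n\<in>{a..<2 * a}. term_at y n))"
        using C2 by (intro mult_left_mono annulus_sum_lower a) auto
      finally have "green_ball y (2 * a) x \<le> green_ball y a x + C2 * (2 ^ p * (\<Sum>n\<in>{a..<2 * a}. term_at y n))"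
        by simp
      then have "green_ball y (2 * a) x \<le> C1 * ((real s)\<^sup>2 / vol y s)
          + C2 * 2 ^ p * ((\<Sum>n\<in>{s..<a}. term_at y n) + (\<Sum>n\<in>{a..<2 * a}. term_at y n))"
        using Suc.IH[folded a_def] unfolding distrib_left mult.assoc by linarith
      also have "(\<Sum>n\<in>{s..<a}. term_at y n) + (\<Sum>n\<in>{a..<2 * a}. term_at y n) = (\<Sum>n\<in>{s..<2 * a}. term_at y n)"
        using a by (intro sum.atLeastLessThan_concat) auto
      finally show ?case by (simp add: a_def mult.assoc)
    qed
    define N where "N = 2 ^ (R + 1) * s"
    have RN: "R \<le> 2 ^ R * s" using less_exp[of R] s by (metis One_nat_def Suc_leI less_imp_le_nat mult_le_mono nat_mult_1_right)
    have "2 ^ 1 * s \<le> N" unfolding N_def by (intro mult_le_mono1 power_increasing) auto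
    then have N: "2 * s \<le> N" "2 ^ R * s \<le> N" by (auto simp: N_def)
    have "green_ball y R x \<le> green_ball y (2 ^ R * s) x"
      using False RN by (intro dirichlet_sol_mono pole_nonneg) auto
    also have "\<dots> \<le> C1 * ((real s)\<^sup>2 / vol y s) + C2 * 2 ^ p * (\<Sum>n\<in>{s..<2 ^ R * s}. term_at y n)" by (rule step)
    also have "\<dots> \<le> C1 * (2 ^ p * (\<Sum>n\<in>{s..<2 * s}. term_at y n)) + C2 * 2 ^ p * (\<Sum>n\<in>{s..<2 ^ R * s}. term_at y n)"
      using C1 by (intro add_right_mono mult_left_mono annulus_sum_lower s) auto
    also have "\<dots> \<le> C1 * (2 ^ p * (\<Sum>n\<in>{d y x..<N}. term_at y n)) + C2 * 2 ^ p * (\<Sum>n\<in>{d y x..<N}. term_at y n)"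
      using C1 C2 N s by (intro add_mono mult_left_mono sum_mono2) auto
    also have "\<dots> = ((C1 + C2) * 2 ^ p) * (\<Sum>n\<in>{d y x..<N}. term_at y n)" by (simp add: algebra_simps)
    finally show ?thesis by blast
  qed blast
  moreover have "0 < (C1 + C2) * 2 ^ p" using C1 C2 by simp
  ultimately show ?thesis by blast
qed

text \<open>Telescoping with ratio \<open>2 ^ (k + 3)\<close>, where \<open>k\<close> is the one
  provided by \<open>green_increment_lower\<close>: each increment pays for its whole block.\<close>

lemma green_ball_lower:
  "\<exists>C>0. \<forall>x y N. \<exists>R>0. (\<Sum>n\<in>{d y x..<N}. term_at y n) \<le> C * green_ball y R x"
proof -
  obtain c k where c: "0 < c" and inc: "\<forall>y s x. 0 < s \<longrightarrow> d y x < 2 ^ k * s \<longrightarrow>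
     c * (real (2 ^ k * s))\<^sup>2 / vol y (2 ^ k * s) \<le> green_ball y (2 ^ (k + 3) * s) x - green_ball y s x"
    using green_increment_lower by blast
  define K where "K = 4 ^ (k + 3) * (2 ^ p) ^ k / c"
  have K: "0 < K" using c by (simp add: K_def)
  have "\<exists>R>0. (\<Sum>n\<in>{d y x..<N}. term_at y n) \<le> ((1 + 2 ^ p) * K) * green_ball y R x" for x y N
  proof -
    define s where "s = d y x + 1"
    have s: "0 < s" "d y x < s" by (auto simp: s_def)
    have step: "(\<Sum>n\<in>{s..<2 ^ ((k + 3) * I) * s}. term_at y n) \<le> K * green_ball y (2 ^ ((k + 3) * I) * s) x" for I
    proof (induction I)
      case 0
      have "0 \<le> green_ball y s x" using s by (intro dirichlet_sol_nonneg pole_nonneg)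
      then show ?case using K by simp
    next
      case (Suc I)
      define a where "a = 2 ^ ((k + 3) * I) * s"
      have "s \<le> a" by (simp add: a_def)
      with s have a: "0 < a" "d y x < a" "s \<le> a" by linarith+
      have ak: "a \<le> 2 ^ k * a" "a \<le> 2 ^ (k + 3) * a" by auto
      have "(\<Sum>n\<in>{a..<2 ^ (k + 3) * a}. term_at y n)
          \<le> 4 ^ (k + 3) * (2 ^ p) ^ k * ((real (2 ^ k * a))\<^sup>2 / vol y (2 ^ k * a))"
        by (rule annulus_sum_upper[OF a(1)])
      also have "\<dots> = K * (c * (real (2 ^ k * a))\<^sup>2 / vol y (2 ^ k * a))" using c by (simp add: K_def)
      also have "\<dots> \<le> K * (green_ball y (2 ^ (k + 3) * a) x - green_ball y a x)"
      proof (rule mult_left_mono)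
        show "c * (real (2 ^ k * a))\<^sup>2 / vol y (2 ^ k * a) \<le> green_ball y (2 ^ (k + 3) * a) x - green_ball y a x"
          using inc[rule_format, OF a(1) order_less_le_trans[OF a(2) ak(1)]] .
      qed (use K in simp)
      finally have 1: "(\<Sum>n\<in>{a..<2 ^ (k + 3) * a}. term_at y n)
          \<le> K * (green_ball y (2 ^ (k + 3) * a) x - green_ball y a x)" .
      have e: "2 ^ ((k + 3) * Suc I) * s = 2 ^ (k + 3) * a"
        by (simp add: a_def power_add)
      have "(\<Sum>n\<in>{s..<2 ^ (k + 3) * a}. term_at y n) =
          (\<Sum>n\<in>{s..<a}. term_at y n) + (\<Sum>n\<in>{a..<2 ^ (k + 3) * a}. term_at y n)"
        using a ak by (intro sum.atLeastLessThan_concat[symmetric]) auto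
      also have "\<dots> \<le> K * green_ball y a x + K * (green_ball y (2 ^ (k + 3) * a) x - green_ball y a x)"
        using Suc.IH 1 unfolding a_def[symmetric] by (rule add_mono)
      also have "\<dots> = K * green_ball y (2 ^ (k + 3) * a) x" by (simp add: algebra_simps)
      finally show ?case unfolding e .
    qed
    define I where "I = N + s + 1"
    define R where "R = 2 ^ ((k + 3) * I) * s"
    have "N + s + 1 < 2 ^ I" unfolding I_def by (rule less_exp)
    also have "(2::nat) ^ I \<le> 2 ^ ((k + 3) * I)" by (intro power_increasing) auto
    also have "\<dots> \<le> R" using s by (simp add: R_def)
    finally have R: "N + s + 1 < R" .
    \<comment> \<open>The telescoping starts at \<open>s = d y x + 1\<close>, since \<open>x\<close>
      must lie inside the ball; the term at \<open>d y x\<close> is bounded by the next one.\<close>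
    have "term_at y (d y x) \<le> 2 ^ p * term_at y s"
    proof -
      have "vol y (s + 1) \<le> vol y (2 * s)" using s by (intro vol_mono) auto
      also have "\<dots> \<le> 2 ^ p * vol y s" by (rule doubling[OF s(1)])
      finally have "real (d y x) * vol y (s + 1) \<le> real s * (2 ^ p * vol y s)"
        using s by (intro mult_mono) auto
      then show ?thesis using vol_pos[OF s(1), of y] vol_pos[of "s + 1" y]
        unfolding s_def by (simp add: field_simps)
    qed
    also have "\<dots> \<le> 2 ^ p * (\<Sum>n\<in>{s..<R}. term_at y n)"
      using R by (intro mult_left_mono member_le_sum) auto
    finally have 1: "term_at y (d y x) \<le> 2 ^ p * (\<Sum>n\<in>{s..<R}. term_at y n)" .
    have "(\<Sum>n\<in>{d y x..<N}. term_at y n) \<le> (\<Sum>n\<in>{d y x..<R}. term_at y n)"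
      using R by (intro sum_mono2) auto
    also have "\<dots> = term_at y (d y x) + (\<Sum>n\<in>{s..<R}. term_at y n)"
      using R unfolding s_def by (subst sum.atLeast_Suc_lessThan) auto
    also have "\<dots> \<le> (1 + 2 ^ p) * (\<Sum>n\<in>{s..<R}. term_at y n)" using 1 by (simp add: algebra_simps)
    also have "\<dots> \<le> (1 + 2 ^ p) * (K * green_ball y R x)"
      using step[of I] unfolding R_def by (intro mult_left_mono) auto
    finally show ?thesis using R by (intro exI[of _ R]) auto
  qed
  moreover have "0 < (1 + 2 ^ p) * K" using K by (simp add: add_pos_pos)
  ultimately show ?thesis by blast
qed

text \<open>The Green functions of balls are centred at \<open>y\<close>, the series in the theorem
  at \<open>x\<close>; from \<open>n = d y x\<close> on the two volumes are comparable.\<close>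

lemma term_at_swap:
  assumes "d y x \<le> n"
  shows "term_at y n \<le> 2 ^ p * term_at x n"
proof -
  have "vol x (n + 1) \<le> (2 ^ p) ^ 1 * vol y (n + 1)" using assms by (intro vol_shift) auto
  then have "real n * vol x (n + 1) \<le> real n * (2 ^ p * vol y (n + 1))" by (intro mult_left_mono) auto
  then show ?thesis using vol_pos[of "n + 1" x] vol_pos[of "n + 1" y] by (simp add: field_simps)
qed

section \<open>Passage to the walk on the whole graph\<close>

lemma dirichlet_iter_pole_far: "n \<le> d y x \<Longrightarrow> dirichlet_iter UNIV (pole y) n x = 0"
proof (induction n arbitrary: x)
  case (Suc n)
  then have "x \<noteq> y" by auto
  then have "pole y x = 0" by (simp add: pole_def)
  moreover have "dirichlet_iter UNIV (pole y) n z = 0" if "(x, z) \<in> E" for z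
    using dist_edge_le[of z x y] that edge_sym[of x z] Suc.prems by (intro Suc.IH) simp
  ultimately show ?case by simp
qed simp

text \<open>Finite speed: the \<open>n\<close>-th iterate involves fewer than \<open>n\<close>
  steps, and a path that reaches \<open>y\<close> in that time stays in
  \<open>oball y R\<close>.\<close>

lemma dirichlet_iter_pole_ball:
  "n \<le> R \<Longrightarrow> dirichlet_iter UNIV (pole y) n x = dirichlet_iter (oball y R) (pole y) n x"
proof (induction n arbitrary: x)
  case (Suc n)
  show ?case
  proof (cases "x \<in> oball y R")
    case True
    then show ?thesis using Suc by simp
  next
    case False
    then have "dirichlet_iter UNIV (pole y) (Suc n) x = 0" using Suc.prems by (intro dirichlet_iter_pole_far) simp
    then show ?thesis using False by simp
  qed
qed simp

lemma sum_heat_kernel: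
  "(\<Sum>n<N. heat_kernel E \<mu> n x y) = dirichlet_iter UNIV (pole y) N x"
proof (induction N arbitrary: x)
  case (Suc N)
  have "(\<Sum>n<Suc N. heat_kernel E \<mu> n x y)
      = pole y x + (\<Sum>n<N. heat_kernel E \<mu> (Suc n) x y)"
    unfolding sum.lessThan_Suc_shift by (simp add: heat_kernel_def pole_def)
  also have "(\<Sum>n<N. heat_kernel E \<mu> (Suc n) x y) = (\<Sum>n<N. \<Sum>z\<in>nb x. \<mu> x z * heat_kernel E \<mu> n z y / m x)"
    by (intro sum.cong refl) (simp add: heat_kernel_def transition_def sum_divide_distrib mult_ac)
  also have "\<dots> = (\<Sum>z\<in>nb x. \<mu> x z * (\<Sum>n<N. heat_kernel E \<mu> n z y)) / m x"
    by (subst sum.swap) (simp add: sum_distrib_left sum_divide_distrib)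
  finally show ?case by (simp add: Suc.IH)
qed simp

lemma heat_kernel_nonneg: "0 \<le> heat_kernel E \<mu> n x y"
proof -
  have "0 \<le> transition_n E \<mu> n x y" for x
    by (induction n arbitrary: x) (auto intro!: sum_nonneg simp: transition_def weight_nonneg)
  then show ?thesis by (simp add: heat_kernel_def)
qed

lemma ennreal_dirichlet_iter: "ennreal (dirichlet_iter UNIV (pole y) N x) = (\<Sum>n<N. ennreal (heat_kernel E \<mu> n x y))"
  unfolding sum_heat_kernel[symmetric] by (rule sum_ennreal[symmetric]) (rule heat_kernel_nonneg)

lemma green_ball_le_green:
  assumes "0 < R"
  shows "ennreal (green_ball y R x) \<le> green E \<mu> x y"
proof (rule LIMSEQ_le_const2)
  show "(\<lambda>n. ennreal (dirichlet_iter (oball y R) (pole y) n x)) \<longlonglongrightarrow> ennreal (green_ball y R x)"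
    by (intro tendsto_ennrealI dirichlet_iter_tendsto pole_nonneg assms)
  have "ennreal (dirichlet_iter (oball y R) (pole y) n x) \<le> green E \<mu> x y" for n
  proof -
    have "ennreal (dirichlet_iter (oball y R) (pole y) n x) \<le> ennreal (dirichlet_iter UNIV (pole y) n x)"
      by (intro ennreal_leI dirichlet_iter_mono pole_nonneg) auto
    also have "\<dots> \<le> green E \<mu> x y"
      unfolding ennreal_dirichlet_iter green_def by (rule sum_le_suminf) auto
    finally show ?thesis .
  qed
  then show "\<exists>N. \<forall>n\<ge>N. ennreal (dirichlet_iter (oball y R) (pole y) n x) \<le> green E \<mu> x y" by blast
qed

text \<open>A partial sum over times below \<open>N\<close> agrees with an iterate on
  \<open>oball y (Suc N)\<close>, hence is below the Green function of that ball. With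
  \<open>green_ball_le_green\<close>, \<open>green\<close> is the supremum over all radii.\<close>

lemma green_le:
  assumes "\<And>R. 0 < R \<Longrightarrow> ennreal (green_ball y R x) \<le> B"
  shows "green E \<mu> x y \<le> B"
  unfolding green_def
proof (rule suminf_le_const)
  fix N
  have "dirichlet_iter UNIV (pole y) N x \<le> green_ball y (Suc N) x"
    using dirichlet_iter_pole_ball[of N "Suc N" y x] dirichlet_sol_ge[of "pole y" "Suc N" y N x, OF pole_nonneg] by simp
  then have "ennreal (dirichlet_iter UNIV (pole y) N x) \<le> ennreal (green_ball y (Suc N) x)" by (rule ennreal_leI)
  also have "\<dots> \<le> B" by (rule assms) simp
  finally show "(\<Sum>n<N. ennreal (heat_kernel E \<mu> n x y)) \<le> B" by (simp add: ennreal_dirichlet_iter)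
qed simp

theorem green_two_sided:
  "\<exists>C\<ge>1. \<forall>x y.
      ennreal (1 / C) * (\<Sum>\<^sub>\<infinity>n\<in>{d x y..}. ennreal (term_at x n)) \<le> green E \<mu> x y \<and>
      green E \<mu> x y \<le> ennreal C * (\<Sum>\<^sub>\<infinity>n\<in>{d x y..}. ennreal (term_at x n))"
proof -
  obtain C1 where C1: "0 < C1" and up: "\<forall>x y R. \<exists>N. green_ball y R x \<le> C1 * (\<Sum>n\<in>{d y x..<N}. term_at y n) \<or> R = 0"
    using green_ball_upper by blast
  obtain C2 where C2: "0 < C2" and lo: "\<forall>x y N. \<exists>R>0. (\<Sum>n\<in>{d y x..<N}. term_at y n) \<le> C2 * green_ball y R x"
    using green_ball_lower by blast
  define C where "C = max 1 (max (C1 * 2 ^ p) (C2 * 2 ^ p))"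
  have C: "1 \<le> C" "C1 * 2 ^ p \<le> C" "C2 * 2 ^ p \<le> C" by (auto simp: C_def)
  have "ennreal (1 / C) * (\<Sum>\<^sub>\<infinity>n\<in>{d x y..}. ennreal (term_at x n)) \<le> green E \<mu> x y \<and>
      green E \<mu> x y \<le> ennreal C * (\<Sum>\<^sub>\<infinity>n\<in>{d x y..}. ennreal (term_at x n))" for x y
  proof
    define S where "S = (\<Sum>\<^sub>\<infinity>n\<in>{d x y..}. ennreal (term_at x n))"
    \<comment> \<open>As a supremum over finite sets the series, possibly infinite, is accessible to
      the estimates for finite partial sums.\<close>
    have S: "S = (SUP F\<in>{F. finite F \<and> F \<subseteq> {d x y..}}. \<Sum>n\<in>F. ennreal (term_at x n))"
      unfolding S_def by (rule nonneg_infsum_complete) simp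
    have "S \<le> ennreal C * green E \<mu> x y"
      unfolding S
    proof (rule SUP_least)
      fix F assume "F \<in> {F. finite F \<and> F \<subseteq> {d x y..}}"
      then have F: "finite F" "F \<subseteq> {d y x..<Suc (Max F)}" using dist_sym[of x y] by (auto simp: less_Suc_eq_le)
      obtain R where R: "0 < R" "(\<Sum>n\<in>{d y x..<Suc (Max F)}. term_at y n) \<le> C2 * green_ball y R x" using lo by blast
      have G0: "0 \<le> green_ball y R x" using R by (intro dirichlet_sol_nonneg pole_nonneg)
      have "(\<Sum>n\<in>F. term_at x n) \<le> (\<Sum>n\<in>{d y x..<Suc (Max F)}. term_at x n)"
        using F by (intro sum_mono2) auto
      also have "\<dots> \<le> (\<Sum>n\<in>{d y x..<Suc (Max F)}. 2 ^ p * term_at y n)"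
        by (intro sum_mono term_at_swap) (simp add: dist_sym[of x y])
      also have "\<dots> = 2 ^ p * (\<Sum>n\<in>{d y x..<Suc (Max F)}. term_at y n)" by (rule sum_distrib_left[symmetric])
      also have "\<dots> \<le> 2 ^ p * (C2 * green_ball y R x)" using R by (intro mult_left_mono) auto
      also have "\<dots> = (C2 * 2 ^ p) * green_ball y R x" by simp
      also have "\<dots> \<le> C * green_ball y R x" using C G0 by (intro mult_right_mono) auto
      finally have "(\<Sum>n\<in>F. ennreal (term_at x n)) \<le> ennreal (C * green_ball y R x)"
        by (simp add: sum_ennreal ennreal_leI)
      also have "\<dots> = ennreal C * ennreal (green_ball y R x)" using C G0 by (simp add: ennreal_mult)
      also have "\<dots> \<le> ennreal C * green E \<mu> x y" by (intro mult_left_mono green_ball_le_green R) simp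
      finally show "(\<Sum>n\<in>F. ennreal (term_at x n)) \<le> ennreal C * green E \<mu> x y" .
    qed
    then have "ennreal (1 / C) * S \<le> ennreal (1 / C) * (ennreal C * green E \<mu> x y)" by (intro mult_left_mono) auto
    also have "\<dots> = ennreal (1 / C * C) * green E \<mu> x y" using C by (subst ennreal_mult) (auto simp: mult.assoc)
    also have "\<dots> = green E \<mu> x y" using C by simp
    finally show "ennreal (1 / C) * S \<le> green E \<mu> x y" .
    show "green E \<mu> x y \<le> ennreal C * S"
    proof (rule green_le)
      fix R :: nat assume R: "0 < R"
      obtain N where "green_ball y R x \<le> C1 * (\<Sum>n\<in>{d y x..<N}. term_at y n)" using up R by blast
      also have "\<dots> \<le> C1 * (\<Sum>n\<in>{d y x..<N}. 2 ^ p * term_at x n)"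
        using C1 by (intro mult_left_mono sum_mono term_at_swap) auto
      also have "\<dots> = (C1 * 2 ^ p) * (\<Sum>n\<in>{d y x..<N}. term_at x n)"
        by (simp only: sum_distrib_left[symmetric] mult.assoc)
      also have "\<dots> \<le> C * (\<Sum>n\<in>{d y x..<N}. term_at x n)"
        using C by (intro mult_right_mono sum_nonneg) auto
      finally have "ennreal (green_ball y R x) \<le> ennreal (C * (\<Sum>n\<in>{d y x..<N}. term_at x n))" by (rule ennreal_leI)
      also have "\<dots> = ennreal C * (\<Sum>n\<in>{d y x..<N}. ennreal (term_at x n))"
        using C by (subst ennreal_mult) (auto intro!: sum_nonneg simp: sum_ennreal)
      also have "\<dots> \<le> ennreal C * S"
        unfolding S by (intro mult_left_mono SUP_upper) (auto simp: dist_sym[of x y])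
      finally show "ennreal (green_ball y R x) \<le> ennreal C * S" .
    qed
  qed
  then show ?thesis using C(1) by blast
qed

end

section \<open>Translation of the original hypotheses and statement\<close>

lemma (in weighted_graph) graph_volume_eq_vol: "graph_volume E \<mu> x (real n) = vol x (n + 1)"
proof -
  have "graph_ball E x (real n) = oball x (n + 1)" by (auto simp: graph_ball_def)
  then show ?thesis by (simp add: graph_volume_def mass_def)
qed

lemma (in weighted_graph) graph_ball_half:
  assumes "0 < r"
  shows "graph_ball E x (real r - 1 / 2) = oball x r"
proof -
  have "real k \<le> real r - 1 / 2 \<longleftrightarrow> k < r" for k
  proof
    assume "real k \<le> real r - 1 / 2"
    then have "real k < real r" by simp
    then show "k < r" by simp
  next
    assume "k < r"
    then have "real (Suc k) \<le> real r" by (intro of_nat_mono) simp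
    then show "real k \<le> real r - 1 / 2" by simp
  qed
  then show ?thesis unfolding graph_ball_def oball_def by (simp only:)
qed

text \<open>Doubling \<open>r - 1 / 2\<close> gives the integer \<open>2 * r - 1\<close>, whose
  closed ball is the open ball of radius \<open>2 * r\<close>: at half-integers, doubling of real
  radii matches doubling of natural ones.\<close>

lemma (in weighted_graph) graph_ball_double_half:
  assumes "0 < r"
  shows "graph_ball E x (2 * (real r - 1 / 2)) = oball x (2 * r)"
proof -
  have "2 * (real r - 1 / 2) = real (2 * r - 1)" using assms by (simp add: of_nat_diff)
  then have "graph_ball E x (2 * (real r - 1 / 2)) = graph_ball E x (real (2 * r - 1))" by (simp only:)
  also have "\<dots> = oball x (2 * r)" using assms by (auto simp: graph_ball_def)
  finally show ?thesis .
qed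

lemma vd_pi_graph_exists:
  assumes "weighted_graph E \<mu>" "volume_doubling E \<mu>" "poincare_inequality E \<mu>" "condition_P0 E \<mu>"
  shows "\<exists>p cP \<alpha>. vd_pi_graph E \<mu> p cP \<alpha>"
proof -
  interpret weighted_graph E \<mu> by fact
  obtain C1 where C1: "\<forall>x. \<forall>r>0. graph_volume E \<mu> x (2 * r) \<le> C1 * graph_volume E \<mu> x r"
    using assms(2) unfolding volume_doubling_def by blast
  obtain C2 where C2: "\<forall>x\<^sub>0. \<forall>r>0. \<forall>f :: 'a \<Rightarrow> real.
        (\<Sum>x\<in>graph_ball E x\<^sub>0 r. \<bar>f x - ball_average E \<mu> x\<^sub>0 r f\<bar>\<^sup>2 * vertex_weight E \<mu> x)
        \<le> C2 * r\<^sup>2 * (\<Sum>x\<in>graph_ball E x\<^sub>0 (2 * r). \<Sum>y\<in>graph_ball E x\<^sub>0 (2 * r). \<mu> x y * (f y - f x)\<^sup>2)"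
    using assms(3) unfolding poincare_inequality_def by blast
  obtain \<alpha> where \<alpha>: "0 < \<alpha>" "\<forall>x y. (x, y) \<in> E \<longrightarrow> \<mu> x y / vertex_weight E \<mu> x \<ge> \<alpha>"
    using assms(4) unfolding condition_P0_def by blast
  obtain p where p: "C1 < 2 ^ p" using real_arch_pow[of 2] by auto
  \<comment> \<open>The maximum supplies the positivity of \<open>cP\<close>; replacing
    \<open>r - 1 / 2\<close> by \<open>r\<close> only enlarges the right-hand side.\<close>
  have "vd_pi_graph E \<mu> p (max 1 C2) \<alpha>"
  proof
    fix x :: 'a and r :: nat assume r: "0 < r"
    have "vol x (2 * r) \<le> C1 * vol x r"
      using C1[rule_format, of "real r - 1 / 2" x] r graph_ball_half[OF r, of x] graph_ball_double_half[OF r, of x]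
      by (simp add: graph_volume_def mass_def)
    also have "\<dots> \<le> 2 ^ p * vol x r" using p by (intro mult_right_mono) auto
    finally show "vol x (2 * r) \<le> 2 ^ p * vol x r" .
  next
    fix x :: 'a and r :: nat and f :: "'a \<Rightarrow> real" assume r: "0 < r"
    define a where "a = ball_average E \<mu> x (real r - 1 / 2) f"
    have e: "(\<Sum>z\<in>oball x (2 * r). \<Sum>y\<in>oball x (2 * r). \<mu> z y * (f y - f z)\<^sup>2) = energy (oball x (2 * r)) f"
      unfolding energy_def by (intro sum.cong refl) (simp add: power2_commute)
    have "(\<Sum>y\<in>oball x r. (f y - a)\<^sup>2 * m y) \<le> C2 * (real r - 1 / 2)\<^sup>2 * energy (oball x (2 * r)) f"
      using C2[rule_format, of "real r - 1 / 2" f x] r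
      unfolding graph_ball_half[OF r] graph_ball_double_half[OF r] e a_def[symmetric] by simp
    also have "\<dots> \<le> max 1 C2 * (real r)\<^sup>2 * energy (oball x (2 * r)) f"
      using r by (intro mult_right_mono mult_mono power_mono energy_nonneg) auto
    finally show "\<exists>a. (\<Sum>y\<in>oball x r. (f y - a)\<^sup>2 * m y) \<le> max 1 C2 * (real r)\<^sup>2 * energy (oball x (2 * r)) f" by blast
  next
    show "0 < max 1 C2" "0 < \<alpha>" using \<alpha> by auto
    show "\<alpha> * m x \<le> \<mu> x y" if "(x, y) \<in> E" for x y
      using \<alpha>(2)[rule_format, OF that] m_pos[of x] by (simp add: pos_le_divide_eq)
  qed
  then show ?thesis by blast
qed

theorem theorem1p10:
  fixes E :: "('a \<times> 'a) set" and \<mu> :: "'a \<Rightarrow> 'a \<Rightarrow> real"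
  assumes "weighted_graph E \<mu>"
    and "volume_doubling E \<mu>"
    and "poincare_inequality E \<mu>"
    and "condition_P0 E \<mu>"
  shows "\<exists>C::real. C \<ge> 1 \<and> (\<forall>x y.
      ennreal (1 / C) * (\<Sum>\<^sub>\<infinity>n\<in>{graph_dist E x y..}. ennreal (real n / graph_volume E \<mu> x (real n)))
        \<le> green E \<mu> x y
    \<and> green E \<mu> x y
        \<le> ennreal C * (\<Sum>\<^sub>\<infinity>n\<in>{graph_dist E x y..}. ennreal (real n / graph_volume E \<mu> x (real n))))"
proof -
  obtain p cP \<alpha> where "vd_pi_graph E \<mu> p cP \<alpha>" using vd_pi_graph_exists[OF assms] by blast
  then interpret vd_pi_graph E \<mu> p cP \<alpha> .
  show ?thesis using green_two_sided unfolding graph_volume_eq_vol .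
qed

end
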